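(* Let $\mathcal{G}$ be a directed graph with edge lengths $\ell$ satisfying assumptions (G1), (G2), (G3) (listed in the context), and fix a vertex $v\in V$. Let $c_1,\dots,c_n$ be $n$ costs on the edges, $\overline{c}=(c_1,\dots,c_n)$, and let $\Lambda(\overline{c})\in\mathbb{R}^n$ be the vector of their asymptotic averages. Then there exists a symmetric positive semi-definite real $n\times n$ matrix $\Sigma$ such that the distribution of $$\frac{\overline{c}(p)-\Lambda(\overline{c})T}{\sqrt T}\quad\text{with respect to }\mu_T$$ converges as $T\to\infty$ to the multi-dimensional Gaussian distribution with mean $0$ and covariance matrix $\Sigma$. Furthermore, $\Sigma$ is strictly positive definite if and only if there does not exist a non-zero $t\in\mathbb{R}^n$ such that for all closed paths $p$ in $\mathcal{G}$, $$\langle t,\overline{c}(p)-\Lambda(\overline{c})\ell(p)\rangle=0 .$$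
   Context: $\mathcal{G}$ is a directed graph with countable vertex set $V$ (every vertex being incident to some edge) and countable edge set $\mathcal{E}$; each edge $e$ carries a length $\ell(e)>0$. The length of a path is the sum of the lengths of its edges. Assumptions: (G1) for all $\sigma>0$, $\sum_{e\in\mathcal{E}}e^{-\sigma\ell(e)}<\infty$; (G2) there is a constant $C>0$ such that for all $e,e'\in\mathcal{E}$ there is a path in $\mathcal{G}$ of length less than $C+\ell(e)+\ell(e')$ which starts with $e$ and ends with $e'$; (G3) there does not exist $d>0$ such that $\{\ell(p):p\text{ is a closed path in }\mathcal{G}\}\subset d\mathbb{N}$. A cost is a non-zero function $c:\mathcal{E}\to\mathbb{R}$ for which there is $C>0$ with $|c(e)|\le C\ell(e)$ for all $e\in\mathcal{E}$; it extends to paths by summing over the edges of the path. $\mathcal{P}_v$ is the set of (finite) paths in $\mathcal{G}$ starting at the vertex $v$, $\mathcal{P}_v(T)=\{p\in\mathcal{P}_v:\ell(p)<T\}$, and $\mu_T$ is the uniform counting probability measure on $\mathcal{P}_v(T)$. The vector of asymptotic averages is $\Lambda(\overline{c})=\lim_{T\to\infty}\frac{1}{\#\mathcal{P}_v(T)}\sum_{p\in\mathcal{P}_v(T)}\overline{c}(p)/T$ (this limit exists, and it is also the vector around which $\overline{c}(p)/T$ concentrates exponentially with respect to $\mu_T$). Gaussian distributions may be degenerate. *)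

theory Defs
  imports "HOL-Probability.Probability" "Graph_Theory.Graph_Theory"
begin

text \<open>Paths are the arc walks of \<open>Graph_Theory\<close> (lists of consecutive arcs, loops and parallel arcs
  allowed); \<open>path_sum f p\<close> extends a function on edges to paths.\<close>

abbreviation path_sum :: "('e \<Rightarrow> real) \<Rightarrow> 'e list \<Rightarrow> real" where
  "path_sum \<equiv> wf_digraph.awalk_cost"

locale length_digraph = wf_digraph G for G :: "('v, 'e) pre_digraph" +
  fixes len :: "'e \<Rightarrow> real"
  assumes countable_verts: "countable (verts G)"
    and countable_arcs: "countable (arcs G)"
    and incident: "u \<in> verts G \<Longrightarrow> \<exists>e\<in>arcs G. tail G e = u \<or> head G e = u"
    and len_pos: "e \<in> arcs G \<Longrightarrow> len e > 0"
    and G1: "\<sigma> > 0 \<Longrightarrow> (\<lambda>e. exp (- \<sigma> * len e)) summable_on arcs G"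
    and G2: "\<exists>C>0. \<forall>e\<in>arcs G. \<forall>e'\<in>arcs G. \<exists>u p w.
               awalk u p w \<and> p \<noteq> [] \<and> hd p = e \<and> last p = e' \<and>
               path_sum len p < C + len e + len e'"
    and G3: "\<not> (\<exists>d>0. {path_sum len p | p. closed_w p} \<subseteq> {d * real k | k. True})"

definition is_cost :: "('v, 'e) pre_digraph \<Rightarrow> ('e \<Rightarrow> real) \<Rightarrow> ('e \<Rightarrow> real) \<Rightarrow> bool" where
  "is_cost G len c \<longleftrightarrow>
     (\<exists>e\<in>arcs G. c e \<noteq> 0) \<and> (\<exists>C>0. \<forall>e\<in>arcs G. \<bar>c e\<bar> \<le> C * len e)"

definition cost_vec :: "('n \<Rightarrow> 'e \<Rightarrow> real) \<Rightarrow> 'e list \<Rightarrow> real ^ 'n" where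
  "cost_vec c p = (\<chi> i. path_sum (c i) p)"

text \<open>The trivial path at \<open>v\<close> is included, so that this set is non-empty for every \<open>T > 0\<close>;
  it is finite by \<open>G1\<close>.\<close>

definition paths_below ::
  "('v, 'e) pre_digraph \<Rightarrow> ('e \<Rightarrow> real) \<Rightarrow> 'v \<Rightarrow> real \<Rightarrow> 'e list set" where
  "paths_below G len v T = {p. (\<exists>w. pre_digraph.awalk G v p w) \<and> path_sum len p < T}"

definition path_measure ::
  "('v, 'e) pre_digraph \<Rightarrow> ('e \<Rightarrow> real) \<Rightarrow> 'v \<Rightarrow> real \<Rightarrow> 'e list measure" where
  "path_measure G len v T = uniform_count_measure (paths_below G len v T)"

definition asymp_avg ::
  "('v, 'e) pre_digraph \<Rightarrow> ('e \<Rightarrow> real) \<Rightarrow> 'v \<Rightarrow> ('n::finite \<Rightarrow> 'e \<Rightarrow> real) \<Rightarrow> real ^ 'n" where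
  "asymp_avg G len v c =
     Lim at_top (\<lambda>T. (1 / real (card (paths_below G len v T))) *\<^sub>R
                      (\<Sum>p\<in>paths_below G len v T. (1 / T) *\<^sub>R cost_vec c p))"

definition weak_conv_to :: "('i \<Rightarrow> 'a::topological_space measure) \<Rightarrow> 'a measure \<Rightarrow> 'i filter \<Rightarrow> bool" where
  "weak_conv_to M N F \<longleftrightarrow>
     (\<forall>f :: 'a \<Rightarrow> real. continuous_on UNIV f \<longrightarrow> bounded (range f) \<longrightarrow>
        ((\<lambda>T. \<integral>x. f x \<partial>M T) \<longlongrightarrow> (\<integral>x. f x \<partial>N)) F)"

definition symmetric_mat :: "real ^ 'n ^ 'n \<Rightarrow> bool" where
  "symmetric_mat A \<longleftrightarrow> transpose A = A"

definition pos_semidefinite :: "real ^ 'n ^ 'n \<Rightarrow> bool" where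
  "pos_semidefinite A \<longleftrightarrow> (\<forall>x. x \<bullet> (A *v x) \<ge> 0)"

definition pos_definite :: "real ^ 'n ^ 'n \<Rightarrow> bool" where
  "pos_definite A \<longleftrightarrow> (\<forall>x. x \<noteq> 0 \<longrightarrow> x \<bullet> (A *v x) > 0)"

text \<open>The normal distribution on the line with mean \<open>m\<close> and variance \<open>s\<close> (not standard deviation),
  a point mass if \<open>s = 0\<close>.\<close>

definition normal_measure :: "real \<Rightarrow> real \<Rightarrow> real measure" where
  "normal_measure m s =
     (if s = 0 then return borel m else density lborel (\<lambda>x. ennreal (normal_density m (sqrt s) x)))"

text \<open>A possibly degenerate multi-dimensional Gaussian distribution: every linear functional
  \<open>x \<mapsto> t \<bullet> x\<close> is normally distributed, with the mean and variance prescribed by the mean vector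
  and the covariance matrix.\<close>

definition is_gaussian :: "(real ^ 'n) measure \<Rightarrow> real ^ 'n \<Rightarrow> real ^ 'n ^ 'n \<Rightarrow> bool" where
  "is_gaussian N m S \<longleftrightarrow>
     prob_space N \<and> sets N = sets borel \<and>
     (\<forall>t. distr N borel (\<lambda>x. t \<bullet> x) = normal_measure (t \<bullet> m) (t \<bullet> (S *v t)))"

end

theory Submission
  imports Defs "HOL-Real_Asymp.Real_Asymp"
begin

text \<open>Cut a path at its successive visits to \<open>v\<close>: it becomes a sequence of first-return loops followed by a
  path that never returns. At the growth rate \<open>h\<close> of the number of paths the weights \<open>exp (- h * len g)\<close>
  of the first-return loops \<open>g\<close> add up to \<open>1\<close>, so that loops become independent identically
  distributed and the number of paths of length less than \<open>t\<close>, divided by \<open>exp (h * t)\<close>, solves a renewal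
  equation. (G1) and (G2) give the loops exponential moments: edges outside a finite set carry little weight,
  from everywhere one returns to \<open>v\<close> within bounded length, and hence the series over the paths avoiding
  \<open>v\<close> still converges slightly below \<open>h\<close>. By (G3) the lengths of the loops are not lattice valued,
  and the solution of the renewal equation converges. The cost of a path is, up to a negligible remainder, a sum of
  about \<open>T / m\<close> independent terms, where \<open>m\<close> is the mean length of a loop; therefore \<open>\<Sigma>\<close> is the
  covariance matrix of the centred cost \<open>c g - len g * \<Lambda>\<close> of a random loop divided by \<open>m\<close>, and
  \<open>t \<bullet> \<Sigma> t\<close> vanishes only if \<open>t\<close> annihilates the centred cost of all closed paths. The multi-dimensional
  statement follows from the convergence of the characteristic functions.\<close>

section \<open>The renewal theorem\<close>

text \<open>Multiplied by \<open>exp (- h * t)\<close>, the nondecreasing count can only fall at a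
  bounded exponential rate. A value at one point therefore controls nearby values, and with the
  density of loop lengths, information at the discrete points \<open>t - l p\<close> becomes
  information on whole intervals. The limit is read off from a conserved quantity: the mean
  increment of the integrated count over one random loop converges to a known constant, while a
  nearly constant normalized count \<open>c\<close> makes it about \<open>h * m * c\<close>. That
  the loop weights at \<open>h\<close> sum to exactly 1, and not to less, rests on finiteness
  slightly below \<open>h\<close>: a convex function that is finite to the left of \<open>h\<close>
  cannot jump over the value 1. The sums twisted by \<open>cis (\<theta> * y p)\<close> satisfy a
  renewal equation without positivity, so the extremal argument does not apply to them. They are
  compared with the untwisted sums, whose error terms dominate theirs in norm. Centring at
  \<open>T\<close> instead of at the length of the path is harmless: by exponential growth almost
  all paths below \<open>T\<close> have length close to \<open>T\<close>.\<close>

lemma expectation_bind_pmf_bounded_real: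
  fixes f :: "'a \<Rightarrow> real"
  assumes "\<And>x. \<bar>f x\<bar> \<le> B"
  shows "measure_pmf.expectation (bind_pmf p q) f
       = measure_pmf.expectation p (\<lambda>x. measure_pmf.expectation (q x) f)"
  unfolding measure_pmf_bind
  by (rule integral_bind[where K = "count_space UNIV" and B = B and B' = 1])
     (use assms in \<open>auto simp: measure_pmf.emeasure_space_le_1 measure_pmf_in_subprob_algebra\<close>)

lemma expectation_bind_pmf_bounded_complex:
  fixes f :: "'a \<Rightarrow> complex"
  assumes B: "\<And>x. norm (f x) \<le> B"
  shows "measure_pmf.expectation (bind_pmf p q) f
       = measure_pmf.expectation p (\<lambda>x. measure_pmf.expectation (q x) f)"
proof -
  have int: "integrable (measure_pmf r) f" for r :: "'a pmf"
    by (rule measure_pmf.integrable_const_bound[where B = B]) (use B in auto)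
  have norm_le: "norm (measure_pmf.expectation (q x) f) \<le> B" for x
    by (rule order_trans[OF integral_norm_bound])
       (use B in \<open>auto intro!: measure_pmf.integral_le_const integrable_norm int\<close>)
  have int2: "integrable (measure_pmf p) (\<lambda>x. measure_pmf.expectation (q x) f)"
    by (rule measure_pmf.integrable_const_bound[where B = B]) (use norm_le in auto)
  show ?thesis
  proof (rule complex_eqI)
    show "Re (measure_pmf.expectation (bind_pmf p q) f)
        = Re (measure_pmf.expectation p (\<lambda>x. measure_pmf.expectation (q x) f))"
      using expectation_bind_pmf_bounded_real[of "\<lambda>x. Re (f x)" B p q] B abs_Re_le_cmod
      by (simp add: integral_Re int int2 flip: integral_Re) (meson order_trans)
    show "Im (measure_pmf.expectation (bind_pmf p q) f)
        = Im (measure_pmf.expectation p (\<lambda>x. measure_pmf.expectation (q x) f))"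
      using expectation_bind_pmf_bounded_real[of "\<lambda>x. Im (f x)" B p q] B abs_Im_le_cmod
      by (simp add: integral_Im int int2 flip: integral_Im) (meson order_trans)
  qed
qed

text \<open>If the group of differences of \<open>S\<close> had no element strictly between 0 and
  \<open>\<delta>\<close>, it would be discrete and \<open>A\<close> would lie in a lattice. Hence
  two elements of \<open>S\<close> differ by less than \<open>\<delta>\<close>. Exchanging copies of
  one for copies of the other moves a sum of \<open>n\<close> terms in steps finer than
  \<open>\<delta>\<close>, and for large \<open>n\<close> the ranges so covered overlap.\<close>

lemma nonlattice_semigroup_dense:
  fixes A S :: "real set"
  assumes pos: "\<And>a. a \<in> A \<Longrightarrow> 0 < a"
    and nonlattice: "\<not> (\<exists>d>0. \<forall>a\<in>A. \<exists>k::int. a = d * of_int k)"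
    and A_S: "A \<subseteq> S" and zero: "0 \<in> S" and nonneg: "\<And>s. s \<in> S \<Longrightarrow> 0 \<le> s"
    and add: "\<And>s s'. s \<in> S \<Longrightarrow> s' \<in> S \<Longrightarrow> s + s' \<in> S"
    and \<delta>: "0 < \<delta>"
  shows "\<exists>x0\<ge>0. \<forall>x\<ge>x0. \<exists>s\<in>S. x \<le> s \<and> s \<le> x + \<delta>"
proof -
  define H where "H = {s - s' | s s'. s \<in> S \<and> s' \<in> S}"
  have H_add: "x + y \<in> H" if "x \<in> H" "y \<in> H" for x y
  proof -
    from that obtain a b c d where "x = a - b" "y = c - d" "a \<in> S" "b \<in> S" "c \<in> S" "d \<in> S"
      unfolding H_def by blast
    then have "x + y = (a + c) - (b + d)" "a + c \<in> S" "b + d \<in> S"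
      by (auto intro: add)
    then show ?thesis unfolding H_def by blast
  qed
  have H_minus: "- x \<in> H" if "x \<in> H" for x
    using that unfolding H_def by (smt (verit) mem_Collect_eq)
  have H_0: "0 \<in> H"
    using zero unfolding H_def by force
  have H_nat: "of_nat n * x \<in> H" if "x \<in> H" for x n
    by (induction n) (auto simp: H_0 distrib_right intro: H_add that)
  have H_int: "of_int k * x \<in> H" if "x \<in> H" for x k
    using H_nat[OF that, of "nat \<bar>k\<bar>"] H_minus[OF H_nat[OF that, of "nat \<bar>k\<bar>"]]
    by (cases "k \<ge> 0") auto
  have S_H: "s \<in> H" if "s \<in> S" for s
    using that zero unfolding H_def by force
  have S_nat: "of_nat n * s \<in> S" if "s \<in> S" for s n
    by (induction n) (auto simp: zero distrib_right intro: add that)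
  have "\<exists>x\<in>H. 0 < x \<and> x < \<delta>"
  proof (rule ccontr)
    assume "\<not> ?thesis"
    then have ge: "\<delta> \<le> x" if "x \<in> H" "0 < x" for x
      using that by force
    define X where "X = {x \<in> H. 0 < x}"
    obtain a where "a \<in> A"
      using nonlattice by (metis zero_less_one empty_iff ex_in_conv)
    then have "a \<in> X"
      using pos A_S S_H by (auto simp: X_def)
    have bdd: "bdd_below X"
      by (rule bdd_belowI[where m = 0]) (auto simp: X_def)
    define d where "d = Inf X"
    have d_ge: "\<delta> \<le> d"
      unfolding d_def using \<open>a \<in> X\<close> by (intro cInf_greatest) (auto simp: X_def intro: ge)
    have d_le: "d \<le> x" if "x \<in> X" for x
      unfolding d_def using that bdd by (rule cInf_lower)
    obtain x where x: "x \<in> X" "x < d + \<delta>"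
      using cInf_lessD[of X "d + \<delta>"] \<open>a \<in> X\<close> \<delta> unfolding d_def by auto
    \<comment> \<open>The infimum is attained: a smaller element \<open>y\<close> of
      \<open>X\<close> would lie between \<open>d\<close> and \<open>x\<close>, and
      \<open>x - y\<close> would be a positive element of \<open>H\<close> below
      \<open>\<delta>\<close>.\<close>
    have "x = d"
    proof (rule ccontr)
      assume "x \<noteq> d"
      with d_le[OF x(1)] have "d < x" by simp
      then obtain y where y: "y \<in> X" "y < x"
        using cInf_lessD[of X x] \<open>a \<in> X\<close> unfolding d_def by auto
      have "x + - y \<in> H"
        using x y by (intro H_add H_minus) (auto simp: X_def)
      from ge[OF this] show False
        using y x d_le[OF y(1)] by simp
    qed
    then have d_H: "d \<in> H" and d_pos: "0 < d"
      using x by (auto simp: X_def)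
    have "\<exists>k::int. a = d * of_int k" if "a \<in> A" for a
    proof -
      \<comment> \<open>Division with remainder: the remainder lies in \<open>H\<close> and is
        smaller than the least positive element, hence zero.\<close>
      define k where "k = \<lfloor>a / d\<rfloor>"
      define r where "r = a + - (of_int k * d)"
      have "r \<in> H"
        unfolding r_def using that A_S by (intro H_add H_minus H_int d_H S_H) auto
      moreover have "0 \<le> r" "r < d"
        using floor_divide_lower[OF d_pos, of a] floor_divide_upper[OF d_pos, of a]
        by (simp_all add: r_def k_def algebra_simps)
      ultimately have "r = 0"
        using d_le[of r] by (force simp: X_def)
      then have "a = d * of_int k"
        by (simp add: r_def mult.commute)
      then show ?thesis ..
    qed
    with d_pos nonlattice show False by blast
  qed
  then obtain s1 s2 where s: "s1 \<in> S" "s2 \<in> S" "0 < s1 - s2" "s1 - s2 < \<delta>"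
    unfolding H_def by blast
  define \<eta> where "\<eta> = s1 - s2"
  have \<eta>: "0 < \<eta>" "\<eta> < \<delta>" using s by (auto simp: \<eta>_def)
  have s2: "0 \<le> s2" and s1: "0 < s1"
    using nonneg s by force+
  have cover: "\<exists>s\<in>S. x \<le> s \<and> s \<le> x + \<delta>" if x: "s1 * s2 / \<eta> \<le> x" for x
  proof -
    have "0 \<le> s1 * s2 / \<eta>" using s1 s2 \<eta> by simp
    with x have x0: "0 \<le> x" by linarith
    \<comment> \<open>This \<open>n\<close> puts \<open>x\<close> between \<open>n * s2\<close> and
      \<open>n * s1\<close>; the assumption \<open>s1 * s2 / \<eta> \<le> x\<close> makes the
      rounding up harmless at the lower end.\<close>
    define n where "n = nat \<lceil>x / s1\<rceil>"
    have n: "x \<le> real n * s1" "real n \<le> x / s1 + 1"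
      using x0 s1 by (auto simp: n_def pos_divide_le_eq[symmetric])
    have "real n * s2 \<le> (x / s1 + 1) * s2"
      using n(2) s2 by (rule mult_right_mono)
    also have "\<dots> \<le> x"
    proof -
      have "s1 * s2 \<le> x * \<eta>" using x \<eta> by (simp add: pos_divide_le_eq)
      then have "x * s2 + s1 * s2 \<le> x * s1" by (simp add: \<eta>_def algebra_simps)
      then show ?thesis using s1 by (simp add: field_simps)
    qed
    finally have n2: "real n * s2 \<le> x" .
    define j where "j = nat \<lceil>(x - real n * s2) / \<eta>\<rceil>"
    have j: "x - real n * s2 \<le> real j * \<eta>" "real j \<le> (x - real n * s2) / \<eta> + 1"
      using n2 \<eta> by (auto simp: j_def pos_divide_le_eq[symmetric])
    have "(x - real n * s2) / \<eta> \<le> real n"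
      using n(1) \<eta>(1) by (simp add: pos_divide_le_eq \<eta>_def algebra_simps)
    then have jn: "j \<le> n"
      by (simp add: j_def ceiling_le_iff)
    have "real j * \<eta> \<le> x - real n * s2 + \<eta>"
      using mult_right_mono[OF j(2), of \<eta>] \<eta>(1) by (simp add: distrib_right)
    moreover have "real (n - j) * s2 + real j * s1 = real n * s2 + real j * \<eta>"
      using jn by (simp add: of_nat_diff \<eta>_def algebra_simps)
    moreover have "real (n - j) * s2 + real j * s1 \<in> S"
      by (intro add S_nat s)
    ultimately show ?thesis
      using j(1) \<eta>(2) by (intro bexI[of _ "real (n - j) * s2 + real j * s1"]) auto
  qed
  show ?thesis
    using cover s1 s2 \<eta> by (intro exI[of _ "s1 * s2 / \<eta>"]) auto
qed

text \<open>\<open>\<eta>\<close> is the upper limit of \<open>H\<close> at infinity, the infimum of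
  the suprema over the half-lines starting at \<open>n\<close>. A sequence realising it is what the
  extremal value argument starts from.\<close>

lemma limsup_sequence:
  fixes H :: "real \<Rightarrow> real"
  assumes B: "\<And>x. \<bar>H x\<bar> \<le> B"
  obtains \<eta> and t :: "nat \<Rightarrow> real"
  where "filterlim t at_top sequentially" "(\<lambda>n. H (t n)) \<longlonglongrightarrow> \<eta>"
    "\<And>e. e > 0 \<Longrightarrow> eventually (\<lambda>x. H x \<le> \<eta> + e) at_top"
proof -
  have bdd: "bdd_above (H ` A)" for A
    by (rule bdd_aboveI[where M = B]) (use B in \<open>auto simp: abs_le_iff\<close>)
  define s where "s n = Sup (H ` {real n..})" for n :: nat
  have s_ge: "H x \<le> s n" if "real n \<le> x" for x n
    unfolding s_def by (rule cSup_upper[OF _ bdd]) (use that in auto)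
  have "- B \<le> s n" for n
    using s_ge[of n "real n"] B[of "real n"] by (simp add: abs_le_iff)
  then have bddb: "bdd_below (range s)"
    by (intro bdd_belowI[where m = "- B"]) auto
  define \<eta> where "\<eta> = Inf (range s)"
  have \<eta>_le: "\<eta> \<le> s n" for n
    unfolding \<eta>_def by (rule cInf_lower[OF _ bddb]) auto
  have ev: "eventually (\<lambda>x. H x \<le> \<eta> + e) at_top" if "e > 0" for e
  proof -
    obtain n where "s n < \<eta> + e"
      using cInf_lessD[of "range s" "\<eta> + e"] \<open>e > 0\<close> unfolding \<eta>_def by auto
    then show ?thesis
      using s_ge by (auto simp: eventually_at_top_linorder intro!: exI[of _ "real n"] dest: order_trans[OF _ less_imp_le])
  qed
  have "\<exists>x\<ge>real n. \<eta> - 1 / (real n + 1) < H x" for n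
  proof -
    have "\<eta> - 1 / (real n + 1) < s n"
      using \<eta>_le[of n] by (smt (verit) of_nat_0_le_iff zero_less_divide_1_iff)
    then show ?thesis
      unfolding s_def using less_cSupD[of "H ` {real n..}"] by force
  qed
  then obtain t where t: "\<And>n. real n \<le> t n" "\<And>n. \<eta> - 1 / (real n + 1) < H (t n)"
    by metis
  have lim: "filterlim t at_top sequentially"
    by (rule filterlim_at_top_mono[OF filterlim_real_sequentially]) (simp add: t)
  have "(\<lambda>n. H (t n)) \<longlonglongrightarrow> \<eta>"
  proof (rule order_tendstoI)
    fix a assume "a < \<eta>"
    have "(\<lambda>n. \<eta> - 1 / (real n + 1)) \<longlonglongrightarrow> \<eta>"
      by real_asymp
    from order_tendstoD(1)[OF this \<open>a < \<eta>\<close>]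
    show "eventually (\<lambda>n. a < H (t n)) sequentially"
      by eventually_elim (use t(2) in \<open>force intro: less_trans\<close>)
  next
    fix a assume "\<eta> < a"
    then have "eventually (\<lambda>x. H x \<le> \<eta> + (a - \<eta>) / 2) at_top"
      by (intro ev) auto
    from eventually_compose_filterlim[OF this lim]
    show "eventually (\<lambda>n. H (t n) < a) sequentially"
      by eventually_elim (use \<open>\<eta> < a\<close> in \<open>simp add: field_simps\<close>)
  qed
  from that[OF lim this ev] show thesis .
qed

text \<open>\<open>P\<close> stands for the paths from the base vertex, \<open>L\<close> for the first-return loops and \<open>R\<close> for the
  paths that do not return; concatenation is unique on \<open>L \<times> P\<close>. The weights \<open>exp (- h * l g)\<close> form a
  probability distribution on \<open>L\<close>.\<close>

locale renewal =
  fixes L R P :: "'a list set" and l :: "'a list \<Rightarrow> real" and h \<epsilon> l0 :: real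
  assumes P_decomp: "P = R \<union> (\<lambda>(g, p). g @ p) ` (L \<times> P)"
    and inj_L: "inj_on (\<lambda>(g, p). g @ p) (L \<times> P)"
    and R_disjoint: "R \<inter> (\<lambda>(g, p). g @ p) ` (L \<times> P) = {}"
    and l_append: "l (p @ q) = l p + l q"
    and l_nonneg: "p \<in> P \<Longrightarrow> 0 \<le> l p"
    and l0_pos: "0 < l0"
    and l0_le: "g \<in> L \<Longrightarrow> l0 \<le> l g"
    and Nil_R: "[] \<in> R"
    and finite_below: "finite {p \<in> P. l p < t}"
    and h_pos: "0 < h" and eps_pos: "0 < \<epsilon>" and eps_less: "\<epsilon> < h"
    and L_sum: "(\<integral>\<^sup>+g. ennreal (exp (- h * l g)) \<partial>count_space L) = 1"
    and L_exp: "(\<integral>\<^sup>+g. ennreal (exp (- (h - \<epsilon>) * l g)) \<partial>count_space L) < \<infinity>"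
    and R_exp: "(\<integral>\<^sup>+r. ennreal (exp (- (h - \<epsilon>) * l r)) \<partial>count_space R) < \<infinity>"
    and nonlattice: "\<not> (\<exists>d>0. \<forall>g\<in>L. \<exists>k::int. l g = d * of_int k)"
begin

section \<open>Unique factorisation of paths and the probability distribution on loops\<close>

lemma l_Nil [simp]: "l [] = 0"
  using l_append[of "[]" "[]"] by simp

lemma R_subset: "R \<subseteq> P"
  using P_decomp by blast

lemma Nil_P [simp]: "[] \<in> P"
  using Nil_R R_subset by auto

lemma append_P: "g \<in> L \<Longrightarrow> p \<in> P \<Longrightarrow> g @ p \<in> P"
  by (subst P_decomp) auto

lemma L_subset: "L \<subseteq> P"
  using append_P[of _ "[]"] by auto

definition below :: "'a list set \<Rightarrow> real \<Rightarrow> 'a list set" where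
  "below A t = {p \<in> A. l p < t}"

lemma finite_below_P [simp]: "finite (below P t)"
  using finite_below by (simp add: below_def)

lemma finite_below_R [simp]: "finite (below R t)"
  by (rule finite_subset[OF _ finite_below_P[of t]]) (use R_subset in \<open>auto simp: below_def\<close>)

lemma finite_below_L [simp]: "finite (below L t)"
  by (rule finite_subset[OF _ finite_below_P[of t]]) (use L_subset in \<open>auto simp: below_def\<close>)

lemma finite_R [simp]: "finite {p \<in> R. l p < t}"
  using finite_below_R[of t] unfolding below_def .

lemma finite_L [simp]: "finite {p \<in> L. l p < t}"
  using finite_below_L[of t] unfolding below_def .

declare finite_below [simp]

lemma below_P_decomp:
  "below P t = below R t \<union> (\<lambda>(g, p). g @ p) ` (SIGMA g:below L t. below P (t - l g))"
proof (intro equalityI subsetI)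
  fix p assume p: "p \<in> below P t"
  then consider "p \<in> R" | g q where "g \<in> L" "q \<in> P" "p = g @ q"
    using P_decomp unfolding below_def by (smt (verit, best) UnE imageE mem_Collect_eq mem_Sigma_iff old.prod.exhaust split_conv)
  then show "p \<in> below R t \<union> (\<lambda>(g, p). g @ p) ` (SIGMA g:below L t. below P (t - l g))"
  proof cases
    case 1
    then show ?thesis using p by (auto simp: below_def)
  next
    case 2
    \<comment> \<open>Lengths on \<open>P\<close> are nonnegative, so the loop in front is shorter
      than \<open>t\<close> as well.\<close>
    then have "l g < t" "l q < t - l g"
      using p l_nonneg[of q] by (auto simp: below_def l_append)
    with 2 show ?thesis
      by (intro UnI2 image_eqI[where x = "(g, q)"]) (auto simp: below_def)
  qed
next
  fix p assume "p \<in> below R t \<union> (\<lambda>(g, p). g @ p) ` (SIGMA g:below L t. below P (t - l g))"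
  then have "p \<in> below R t \<or> (\<exists>g q. g \<in> below L t \<and> q \<in> below P (t - l g) \<and> p = g @ q)"
    by auto
  then consider "p \<in> below R t" | g q where "g \<in> below L t" "q \<in> below P (t - l g)" "p = g @ q"
    by blast
  then show "p \<in> below P t"
    by cases (use R_subset in \<open>auto simp: below_def l_append append_P\<close>)
qed

lemma sum_below_P:
  fixes f :: "'a list \<Rightarrow> 'b::comm_monoid_add"
  shows "(\<Sum>p\<in>below P t. f p) = (\<Sum>r\<in>below R t. f r)
      + (\<Sum>g\<in>below L t. \<Sum>p\<in>below P (t - l g). f (g @ p))"
proof -
  have inj: "inj_on (\<lambda>(g, p). g @ p) (SIGMA g:below L t. below P (t - l g))"
    by (rule inj_on_subset[OF inj_L]) (auto simp: below_def)
  have "(\<Sum>p\<in>below P t. f p) = (\<Sum>r\<in>below R t. f r)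
      + (\<Sum>p\<in>(\<lambda>(g, p). g @ p) ` (SIGMA g:below L t. below P (t - l g)). f p)"
    unfolding below_P_decomp[of t]
  proof (rule sum.union_disjoint)
    show "below R t \<inter> (\<lambda>(g, p). g @ p) ` (SIGMA g:below L t. below P (t - l g)) = {}"
      using R_disjoint unfolding below_def by blast
  qed (auto intro!: finite_imageI finite_SigmaI)
  also have "(\<Sum>p\<in>(\<lambda>(g, p). g @ p) ` (SIGMA g:below L t. below P (t - l g)). f p)
      = (\<Sum>g\<in>below L t. \<Sum>p\<in>below P (t - l g). f (g @ p))"
    by (subst sum.reindex[OF inj]) (simp add: sum.Sigma split_def)
  finally show ?thesis .
qed

definition D :: "'a list pmf" where
  "D = embed_pmf (\<lambda>g. exp (- h * l g) * indicator L g)"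

abbreviation E :: "('a list \<Rightarrow> 'b::{banach,second_countable_topology}) \<Rightarrow> 'b" where
  "E \<equiv> measure_pmf.expectation D"

lemma pmf_D: "pmf D g = exp (- h * l g) * indicator L g"
  unfolding D_def
proof (rule pmf_embed_pmf)
  have "(\<integral>\<^sup>+g. ennreal (exp (- h * l g) * indicator L g) \<partial>count_space UNIV)
      = (\<integral>\<^sup>+g. ennreal (exp (- h * l g)) * indicator L g \<partial>count_space UNIV)"
    by (intro nn_integral_cong) (auto split: split_indicator)
  then show "(\<integral>\<^sup>+g. ennreal (exp (- h * l g) * indicator L g) \<partial>count_space UNIV) = 1"
    using L_sum by (simp add: nn_integral_count_space_indicator)
qed auto

lemma set_D: "set_pmf D = L"
  by (auto simp: set_pmf_eq pmf_D split: split_indicator)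

lemma AE_D: "(AE g in measure_pmf D. Q g) \<longleftrightarrow> (\<forall>g\<in>L. Q g)"
  by (simp add: AE_measure_pmf_iff set_D)

lemma E_bounded_integrable:
  fixes \<phi> :: "'a list \<Rightarrow> 'b::{banach,second_countable_topology}"
  assumes "\<And>g. g \<in> L \<Longrightarrow> norm (\<phi> g) \<le> B"
  shows "integrable (measure_pmf D) \<phi>"
  by (rule measure_pmf.integrable_const_bound[where B = B]) (use assms in \<open>auto simp: AE_D\<close>)

lemma E_below:
  fixes \<phi> :: "'a list \<Rightarrow> 'b::{banach,second_countable_topology}"
  assumes "\<And>g. g \<in> L \<Longrightarrow> l g \<ge> t \<Longrightarrow> \<phi> g = 0"
  shows "E \<phi> = (\<Sum>g\<in>below L t. exp (- h * l g) *\<^sub>R \<phi> g)"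
proof -
  have "E \<phi> = (\<Sum>g\<in>below L t. pmf D g *\<^sub>R \<phi> g)"
  proof (rule integral_measure_pmf)
    fix g assume "g \<in> set_pmf D" "\<phi> g \<noteq> 0"
    then show "g \<in> below L t"
      using assms[of g] by (force simp: set_D below_def)
  qed simp
  also have "\<dots> = (\<Sum>g\<in>below L t. exp (- h * l g) *\<^sub>R \<phi> g)"
    by (rule sum.cong) (auto simp: pmf_D below_def)
  finally show ?thesis .
qed

definition wsum :: "'a list set \<Rightarrow> ('a list \<Rightarrow> 'b::real_vector) \<Rightarrow> real \<Rightarrow> 'b" where
  "wsum A f t = exp (- h * t) *\<^sub>R (\<Sum>p\<in>below A t. f p)"

lemma below_empty: "A \<subseteq> P \<Longrightarrow> t \<le> 0 \<Longrightarrow> below A t = {}"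
  using l_nonneg by (force simp: below_def)

lemma wsum_nonpos: "A \<subseteq> P \<Longrightarrow> t \<le> 0 \<Longrightarrow> wsum A f t = 0"
  by (simp add: wsum_def below_empty)

text \<open>Formulated for functions that are multiplicative when a loop is put in front, so that
  one equation serves both for plain counting (\<open>u g = 1\<close>) and for characteristic
  functions (\<open>u g = cis (\<theta> * y g)\<close>).\<close>

lemma wsum_renewal:
  fixes f :: "'a list \<Rightarrow> 'b::{real_normed_algebra,banach,second_countable_topology}"
  assumes "\<And>g p. g \<in> L \<Longrightarrow> p \<in> P \<Longrightarrow> f (g @ p) = u g * f p"
  shows "wsum P f t = wsum R f t + E (\<lambda>g. u g * wsum P f (t - l g))"
proof -
  have "E (\<lambda>g. u g * wsum P f (t - l g))
      = (\<Sum>g\<in>below L t. exp (- h * l g) *\<^sub>R (u g * wsum P f (t - l g)))"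
    by (rule E_below) (simp add: wsum_nonpos)
  also have "\<dots> = (\<Sum>g\<in>below L t. exp (- h * t) *\<^sub>R (\<Sum>p\<in>below P (t - l g). f (g @ p)))"
  proof (rule sum.cong[OF refl])
    fix g assume "g \<in> below L t"
    then have "(\<Sum>p\<in>below P (t - l g). f (g @ p)) = u g * (\<Sum>p\<in>below P (t - l g). f p)"
      unfolding sum_distrib_left by (intro sum.cong) (auto simp: below_def assms)
    moreover have "exp (- h * l g) * exp (- h * (t - l g)) = exp (- h * t)"
      unfolding exp_add[symmetric] by (simp add: algebra_simps)
    ultimately show "exp (- h * l g) *\<^sub>R (u g * wsum P f (t - l g))
        = exp (- h * t) *\<^sub>R (\<Sum>p\<in>below P (t - l g). f (g @ p))"
      by (simp add: wsum_def)
  qed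
  finally show ?thesis
    by (simp add: wsum_def sum_below_P[of f t] scaleR_right_distrib scaleR_sum_right)
qed

definition residual_sum :: real where
  "residual_sum = enn2real (\<integral>\<^sup>+r. ennreal (exp (- (h - \<epsilon>) * l r)) \<partial>count_space R)"

lemma sum_R_le:
  assumes "finite A" "A \<subseteq> R"
  shows "(\<Sum>r\<in>A. exp (- (h - \<epsilon>) * l r)) \<le> residual_sum"
proof -
  have "ennreal (\<Sum>r\<in>A. exp (- (h - \<epsilon>) * l r))
      = (\<integral>\<^sup>+r. ennreal (exp (- (h - \<epsilon>) * l r)) \<partial>count_space A)"
    using assms(1) by (simp add: nn_integral_count_space_finite)
  also have "\<dots> = (\<integral>\<^sup>+r. ennreal (exp (- (h - \<epsilon>) * l r)) * indicator A r \<partial>count_space R)"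
    using assms(2)
    by (simp add: nn_integral_count_space_indicator mult.assoc indicator_inter_arith[symmetric] Int_absorb2)
  also have "\<dots> \<le> (\<integral>\<^sup>+r. ennreal (exp (- (h - \<epsilon>) * l r)) \<partial>count_space R)"
    by (intro nn_integral_mono) (auto split: split_indicator)
  also have "\<dots> = ennreal residual_sum"
    using R_exp by (simp add: residual_sum_def less_top)
  finally show ?thesis
    by (simp add: residual_sum_def)
qed

lemma exp_moment_integrable: "integrable (measure_pmf D) (\<lambda>g. exp (\<epsilon> * l g))"
proof (rule integrableI_bounded)
  have "(\<integral>\<^sup>+g. ennreal (norm (exp (\<epsilon> * l g))) \<partial>measure_pmf D)
      = (\<integral>\<^sup>+g. ennreal (pmf D g) * ennreal (exp (\<epsilon> * l g)) \<partial>count_space UNIV)"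
    by (simp add: nn_integral_measure_pmf)
  also have "\<dots> = (\<integral>\<^sup>+g. ennreal (exp (- (h - \<epsilon>) * l g)) * indicator L g \<partial>count_space UNIV)"
  proof (rule nn_integral_cong)
    fix g
    have "exp (- h * l g) * exp (\<epsilon> * l g) = exp (- (h - \<epsilon>) * l g)"
      unfolding exp_add[symmetric] by (simp add: algebra_simps)
    then show "ennreal (pmf D g) * ennreal (exp (\<epsilon> * l g))
        = ennreal (exp (- (h - \<epsilon>) * l g)) * indicator L g"
      by (cases "g \<in> L") (simp_all add: pmf_D ennreal_mult[symmetric])
  qed
  also have "\<dots> < \<infinity>"
    using L_exp by (simp add: nn_integral_count_space_indicator)
  finally show "(\<integral>\<^sup>+g. ennreal (norm (exp (\<epsilon> * l g))) \<partial>measure_pmf D) < \<infinity>" .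
qed simp

lemma l_pos_L: "g \<in> L \<Longrightarrow> 0 < l g"
  using l0_le l0_pos by (meson less_le_trans)

lemma power_moment_integrable: "integrable (measure_pmf D) (\<lambda>g. l g ^ k)"
proof (rule Bochner_Integration.integrable_bound)
  show "integrable (measure_pmf D) (\<lambda>g. fact k / \<epsilon> ^ k * exp (\<epsilon> * l g))"
    by (intro integrable_mult_right exp_moment_integrable)
  have "l g ^ k \<le> fact k / \<epsilon> ^ k * exp (\<epsilon> * l g)" if "g \<in> L" for g
  proof -
    have "(\<epsilon> * l g) ^ k / fact k \<le> exp (\<epsilon> * l g)"
      using l_pos_L[OF that] eps_pos sum_le_suminf[OF summable_exp, of "{k}" "\<epsilon> * l g"]
      by (simp add: exp_def divide_inverse scaleR_conv_of_real mult.commute)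
    then have "\<epsilon> ^ k * l g ^ k \<le> fact k * exp (\<epsilon> * l g)"
      by (simp add: divide_le_eq power_mult_distrib mult.commute)
    then show ?thesis
      using eps_pos by (simp add: pos_le_divide_eq mult.commute)
  qed
  then show "AE g in measure_pmf D. norm (l g ^ k) \<le> norm (fact k / \<epsilon> ^ k * exp (\<epsilon> * l g))"
    using l_pos_L eps_pos by (auto simp: AE_D less_imp_le)
qed simp

definition m :: real where "m = E l"

lemma l_integrable: "integrable (measure_pmf D) l"
  using power_moment_integrable[of 1] by simp

lemma m_ge: "l0 \<le> m"
  unfolding m_def
  by (rule measure_pmf.integral_ge_const[OF l_integrable]) (simp add: AE_D l0_le)

lemma m_pos: "0 < m"
  using m_ge l0_pos by simp

section \<open>The normalized counting function and its integrated form\<close>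

definition G :: "real \<Rightarrow> real" where
  "G = wsum P (\<lambda>_. 1)"

lemma G_eq: "G t = exp (- h * t) * real (card (below P t))"
  by (simp add: G_def wsum_def)

lemma G_nonneg: "0 \<le> G t"
  by (simp add: G_eq)

lemma card_below_mono: "s \<le> t \<Longrightarrow> card (below P s) \<le> card (below P t)"
  by (rule card_mono) (auto simp: below_def)

text \<open>The count is nondecreasing, so only the factor \<open>exp (- h * t)\<close> can make
  \<open>G\<close> fall.\<close>

lemma G_slow:
  assumes "s \<le> t"
  shows "exp (- h * (t - s)) * G s \<le> G t"
proof -
  have "exp (- h * (t - s)) * G s = exp (- h * t) * real (card (below P s))"
    unfolding G_eq mult.assoc[symmetric] exp_add[symmetric] by (simp add: algebra_simps)
  also have "\<dots> \<le> G t"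
    unfolding G_eq using card_below_mono[OF assms] by (intro mult_left_mono) auto
  finally show ?thesis .
qed

lemma G_renewal: "G t = wsum R (\<lambda>_. 1) t + E (\<lambda>g. G (t - l g))"
  unfolding G_def using wsum_renewal[of "\<lambda>_. 1::real" "\<lambda>_. 1" t] by simp

lemma residual_sum_nonneg: "0 \<le> residual_sum"
  by (simp add: residual_sum_def)

text \<open>Each path counted is shorter than \<open>t\<close>, so its weight at the rate
  \<open>h - \<epsilon>\<close> is at least \<open>exp (- (h - \<epsilon>) * t)\<close>. Summability
  at that rate leaves a factor \<open>exp (- \<epsilon> * t)\<close> to spare.\<close>

lemma wsum_R_bound:
  fixes f :: "'a list \<Rightarrow> 'b::real_normed_vector"
  assumes "\<And>r. r \<in> R \<Longrightarrow> norm (f r) \<le> 1"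
  shows "norm (wsum R f t) \<le> residual_sum * exp (- \<epsilon> * t)"
proof -
  have "norm (wsum R f t) \<le> exp (- h * t) * (\<Sum>r\<in>below R t. 1)"
    unfolding wsum_def norm_scaleR abs_exp_cancel
    by (intro mult_left_mono order_trans[OF norm_sum] sum_mono) (auto simp: below_def assms)
  also have "\<dots> = exp (- \<epsilon> * t) * (\<Sum>r\<in>below R t. exp (- (h - \<epsilon>) * t))"
  proof -
    have "exp (- h * t) = exp (- \<epsilon> * t) * exp (- (h - \<epsilon>) * t)"
      unfolding exp_add[symmetric] by (simp add: algebra_simps)
    then show ?thesis by simp
  qed
  also have "\<dots> \<le> exp (- \<epsilon> * t) * (\<Sum>r\<in>below R t. exp (- (h - \<epsilon>) * l r))"
    using eps_less by (intro mult_left_mono sum_mono) (auto simp: below_def)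
  also have "\<dots> \<le> exp (- \<epsilon> * t) * residual_sum"
    by (intro mult_left_mono sum_R_le) (auto simp: below_def)
  finally show ?thesis by (simp add: mult.commute)
qed

lemma wsum_R_tendsto:
  fixes f :: "'a list \<Rightarrow> 'b::real_normed_vector"
  assumes "\<And>r. r \<in> R \<Longrightarrow> norm (f r) \<le> 1"
  shows "(wsum R f \<longlongrightarrow> 0) at_top"
proof (rule Lim_null_comparison)
  show "\<forall>\<^sub>F t in at_top. norm (wsum R f t) \<le> residual_sum * exp (- \<epsilon> * t)"
    using wsum_R_bound[of f, OF assms] by simp
  show "((\<lambda>t. residual_sum * exp (- \<epsilon> * t)) \<longlongrightarrow> 0) at_top"
  proof -
    have "((\<lambda>t. exp (- (\<epsilon> * t))) \<longlongrightarrow> 0) at_top"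
      using eps_pos by real_asymp
    from tendsto_mult_right_zero[OF this, of residual_sum] show ?thesis by simp
  qed
qed

text \<open>\<open>I A t\<close> is \<open>h\<close> times the integral of \<open>exp (- h * u) * card (below A u)\<close> over \<open>u \<le> t\<close>.\<close>

definition I :: "'a list set \<Rightarrow> real \<Rightarrow> real" where
  "I A t = (\<Sum>p\<in>below A t. exp (- h * l p) - exp (- h * t))"

text \<open>Cutting off at zero lets the sum run over any larger set \<open>below A t'\<close>, so
  that values of \<open>I A\<close> at different times become sums over the same set.\<close>

lemma I_altdef:
  assumes "t \<le> t'" "A \<subseteq> P"
  shows "I A t = (\<Sum>p\<in>below A t'. max 0 (exp (- h * l p) - exp (- h * t)))"
proof -
  have "finite (below A t')"
    by (rule finite_subset[OF _ finite_below_P[of t']]) (use assms in \<open>auto simp: below_def\<close>)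
  moreover have "max 0 (exp (- h * l p) - exp (- h * t)) = 0" if "p \<in> below A t' - below A t" for p
    using that h_pos by (auto simp: below_def)
  moreover have "below A t \<subseteq> below A t'"
    using assms by (auto simp: below_def)
  ultimately have "(\<Sum>p\<in>below A t'. max 0 (exp (- h * l p) - exp (- h * t)))
      = (\<Sum>p\<in>below A t. max 0 (exp (- h * l p) - exp (- h * t)))"
    by (intro sum.mono_neutral_right) auto
  also have "\<dots> = I A t"
    unfolding I_def using h_pos by (intro sum.cong) (auto simp: below_def)
  finally show ?thesis ..
qed

lemma I_mono:
  assumes "s \<le> t" "A \<subseteq> P"
  shows "I A s \<le> I A t"
proof -
  have "exp (- h * t) \<le> exp (- h * s)"
    using assms h_pos by simp
  then show ?thesis
    unfolding I_altdef[OF assms] I_altdef[OF order_refl assms(2), of t]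
    by (intro sum_mono) linarith
qed

lemma I_nonpos: "A \<subseteq> P \<Longrightarrow> t \<le> 0 \<Longrightarrow> I A t = 0"
  by (simp add: I_def below_empty)

lemma I_nonneg: "A \<subseteq> P \<Longrightarrow> 0 \<le> I A t"
  unfolding I_altdef[OF order_refl] by (intro sum_nonneg) auto

text \<open>The factorisation of paths gives \<open>I P\<close> a renewal equation like that of
  \<open>G\<close>, with \<open>I R\<close> as inhomogeneous term. Since \<open>I R\<close>
  converges, this is the conserved quantity that determines the limit of \<open>G\<close>.\<close>

lemma E_I_diff: "E (\<lambda>g. I P t - I P (t - l g)) = I R t"
proof -
  have int: "integrable (measure_pmf D) (\<lambda>g. I P (t - l g))"
    by (rule E_bounded_integrable[where B = "I P t"])
       (use I_nonneg[of P] l_pos_L in \<open>auto intro!: I_mono simp: less_imp_le\<close>)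
  have "E (\<lambda>g. I P (t - l g)) = (\<Sum>g\<in>below L t. exp (- h * l g) *\<^sub>R I P (t - l g))"
    by (rule E_below) (simp add: I_nonpos)
  also have "\<dots> = (\<Sum>g\<in>below L t. \<Sum>p\<in>below P (t - l g). exp (- h * l (g @ p)) - exp (- h * t))"
    unfolding I_def real_scaleR_def sum_distrib_left
  proof (intro sum.cong refl)
    fix g p
    have "exp (- h * l g) * exp (- h * l p) = exp (- h * l (g @ p))"
      "exp (- h * l g) * exp (- h * (t - l g)) = exp (- h * t)"
      unfolding exp_add[symmetric] by (simp_all add: l_append algebra_simps)
    then show "exp (- h * l g) * (exp (- h * l p) - exp (- h * (t - l g)))
        = exp (- h * l (g @ p)) - exp (- h * t)"
      by (simp add: right_diff_distrib)
  qed
  finally have "I P t = I R t + E (\<lambda>g. I P (t - l g))"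
    unfolding I_def[of P t] I_def[of R t]
    by (simp only: sum_below_P[of "\<lambda>p. exp (- h * l p) - exp (- h * t)" t])
  then show ?thesis
    by (simp add: int)
qed

lemma I_R_le: "I R t \<le> residual_sum"
proof -
  have "I R t \<le> (\<Sum>r\<in>below R t. exp (- (h - \<epsilon>) * l r))"
    unfolding I_def
  proof (intro sum_mono)
    fix r assume "r \<in> below R t"
    then have "0 \<le> l r"
      using l_nonneg R_subset by (auto simp: below_def)
    then have "- h * l r \<le> - (h - \<epsilon>) * l r"
      using eps_pos by (intro mult_right_mono) auto
    then have "exp (- h * l r) \<le> exp (- (h - \<epsilon>) * l r)"
      by simp
    then show "exp (- h * l r) - exp (- h * t) \<le> exp (- (h - \<epsilon>) * l r)"
      by (smt (verit) exp_gt_zero)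
  qed
  also have "\<dots> \<le> residual_sum"
    by (intro sum_R_le) (auto simp: below_def)
  finally show ?thesis .
qed

definition residual_mass :: real where "residual_mass = (SUP t. I R t)"

lemma I_R_le_RH: "I R t \<le> residual_mass"
  unfolding residual_mass_def by (rule cSUP_upper) (auto intro: bdd_aboveI2 I_R_le)

lemma I_R_tendsto: "(I R \<longlongrightarrow> residual_mass) at_top"
proof (rule increasing_tendsto)
  show "\<forall>\<^sub>F t in at_top. I R t \<le> residual_mass"
    by (simp add: I_R_le_RH)
  fix x assume "x < residual_mass"
  then obtain t where "x < I R t"
    unfolding residual_mass_def by (subst (asm) less_cSUP_iff) (auto intro: bdd_aboveI2 I_R_le)
  then show "\<forall>\<^sub>F t in at_top. x < I R t"
    unfolding eventually_at_top_linorder using I_mono[OF _ R_subset] by (meson less_le_trans)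
qed

lemma residual_mass_pos: "0 < residual_mass"
proof -
  have "0 < exp (- h * l []) - exp (- h * 1)"
    using h_pos by simp
  also have "\<dots> \<le> I R 1"
    unfolding I_def using Nil_R h_pos
    by (intro member_le_sum) (auto simp: below_def)
  also have "\<dots> \<le> residual_mass" by (rule I_R_le_RH)
  finally show ?thesis .
qed

text \<open>Between \<open>t - d\<close> and \<open>t\<close> the count is at least its value at the
  left end; what remains is the integral of \<open>h * exp (- h * u)\<close>. The upper bound takes
  the value at the right end.\<close>

lemma I_diff_lower:
  assumes "0 \<le> d"
  shows "G (t - d) * (1 - exp (- h * d)) \<le> I P t - I P (t - d)"
proof -
  have le: "exp (- h * t) \<le> exp (- h * (t - d))"
    using assms h_pos by simp
  have "I P t = (\<Sum>p\<in>below P t. max 0 (exp (- h * l p) - exp (- h * t)))"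
    by (rule I_altdef) auto
  also have "\<dots> \<ge> (\<Sum>p\<in>below P (t - d). max 0 (exp (- h * l p) - exp (- h * t)))"
    using assms by (intro sum_mono2) (auto simp: below_def)
  finally have 1: "(\<Sum>p\<in>below P (t - d). max 0 (exp (- h * l p) - exp (- h * t))) \<le> I P t" .
  have "(\<Sum>p\<in>below P (t - d). exp (- h * (t - d)) - exp (- h * t))
      \<le> (\<Sum>p\<in>below P (t - d). max 0 (exp (- h * l p) - exp (- h * t)) - (exp (- h * l p) - exp (- h * (t - d))))"
    by (intro sum_mono) linarith
  also have "\<dots> \<le> I P t - I P (t - d)"
    using 1 by (simp add: sum_subtractf I_def[of P "t - d"])
  finally have "real (card (below P (t - d))) * (exp (- h * (t - d)) - exp (- h * t))
      \<le> I P t - I P (t - d)" by simp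
  moreover have "exp (- h * t) = exp (- h * (t - d)) * exp (- h * d)"
    unfolding exp_add[symmetric] by (simp add: algebra_simps)
  ultimately show ?thesis
    by (simp add: G_eq algebra_simps)
qed

lemma I_diff_upper:
  assumes "0 \<le> d"
  shows "I P t - I P (t - d) \<le> G t * (exp (h * d) - 1)"
proof -
  have le: "exp (- h * t) \<le> exp (- h * (t - d))"
    using assms h_pos by simp
  have "I P (t - d) = (\<Sum>p\<in>below P t. max 0 (exp (- h * l p) - exp (- h * (t - d))))"
    using assms by (intro I_altdef) auto
  then have "I P t - I P (t - d) \<le> (\<Sum>p\<in>below P t. exp (- h * (t - d)) - exp (- h * t))"
    unfolding I_def[of P t] using le by (simp only: sum_subtractf[symmetric]) (intro sum_mono, linarith)
  also have "\<dots> = real (card (below P t)) * (exp (- h * (t - d)) - exp (- h * t))" by simp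
  moreover have "exp (- h * (t - d)) = exp (- h * t) * exp (h * d)"
    unfolding exp_add[symmetric] by (simp add: algebra_simps)
  ultimately show ?thesis
    by (simp add: G_eq algebra_simps)
qed

definition G_bound :: real where "G_bound = residual_sum / (1 - exp (- h * l0))"

text \<open>Every loop has length at least \<open>l0\<close>, so the increment of \<open>I P\<close>
  over a random loop is at least the one over a step of length \<open>l0\<close>, hence at least
  \<open>G t * (1 - exp (- h * l0))\<close>. Its mean is a value of \<open>I R\<close>, and these
  are bounded.\<close>

lemma G_le: "G t \<le> G_bound"
proof -
  have lt: "exp (- h * l0) < 1"
    using h_pos l0_pos by simp
  have "G t * (1 - exp (- h * l0)) \<le> E (\<lambda>g. I P (t + l0) - I P (t + l0 - l g))"
  proof (rule measure_pmf.integral_ge_const)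
    show "integrable (measure_pmf D) (\<lambda>g. I P (t + l0) - I P (t + l0 - l g))"
    proof (rule E_bounded_integrable)
      fix g assume "g \<in> L"
      then have "I P (t + l0 - l g) \<le> I P (t + l0)"
        by (intro I_mono) (auto simp: less_imp_le l_pos_L)
      then show "norm (I P (t + l0) - I P (t + l0 - l g)) \<le> I P (t + l0)"
        using I_nonneg[of P "t + l0 - l g"] by simp
    qed
    have "G t * (1 - exp (- h * l0)) \<le> I P (t + l0) - I P (t + l0 - l g)" if "g \<in> L" for g
      using I_diff_lower[of l0 "t + l0"] l0_pos I_mono[of "t + l0 - l g" t P] l0_le[OF that] by simp
    then show "AE g in measure_pmf D. G t * (1 - exp (- h * l0)) \<le> I P (t + l0) - I P (t + l0 - l g)"
      by (simp add: AE_D)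
  qed
  also have "\<dots> \<le> residual_sum"
    unfolding E_I_diff by (rule I_R_le)
  finally show ?thesis
    using lt by (simp add: G_bound_def pos_le_divide_eq)
qed

lemma G_abs_le: "\<bar>G t\<bar> \<le> G_bound"
  using G_le[of t] G_nonneg[of t] by simp

lemma G_bound_nonneg: "0 \<le> G_bound"
  using G_le[of 0] G_nonneg[of 0] by linarith

text \<open>An extremal value of a solution of the renewal equation is an average of values that do not
  exceed it, so it propagates backwards along every jump of positive probability.\<close>

lemma extremal_shift:
  fixes H zf :: "real \<Rightarrow> real" and t :: "nat \<Rightarrow> real"
  assumes bound: "\<And>x. \<bar>H x\<bar> \<le> B"
    and eq: "\<And>x. H x = zf x + E (\<lambda>g. H (x - l g))"
    and zf: "(zf \<longlongrightarrow> 0) at_top"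
    and t: "filterlim t at_top sequentially"
    and lim: "(\<lambda>n. H (t n)) \<longlonglongrightarrow> \<eta>"
    and le: "\<And>e. e > 0 \<Longrightarrow> eventually (\<lambda>x. H x \<le> \<eta> + e) at_top"
    and g: "g \<in> L"
  shows "(\<lambda>n. H (t n - l g)) \<longlonglongrightarrow> \<eta>"
proof -
  have t_shift: "filterlim (\<lambda>n. t n - c) at_top sequentially" for c
    unfolding filterlim_at_top
  proof
    fix Z
    have "eventually (\<lambda>n. Z + c \<le> t n) sequentially"
      using t by (simp add: filterlim_at_top)
    then show "eventually (\<lambda>n. Z \<le> t n - c) sequentially"
      by eventually_elim simp
  qed
  have int: "integrable (measure_pmf D) (\<lambda>g. H (t n - l g))" for n
    by (rule E_bounded_integrable[where B = B]) (simp add: bound)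
  have intd: "integrable (measure_pmf D) (\<lambda>g. H (t n - l g) - \<eta>)" for n
    by (intro Bochner_Integration.integrable_diff int) simp
  \<comment> \<open>Dominated convergence applies to the excess over \<open>\<eta>\<close> only,
    since \<open>\<eta>\<close> is merely an asymptotic upper bound.\<close>
  have pos: "(\<lambda>n. E (\<lambda>g. max 0 (H (t n - l g) - \<eta>))) \<longlonglongrightarrow> E (\<lambda>g. 0)"
  proof (rule integral_dominated_convergence[where w = "\<lambda>_. B + \<bar>\<eta>\<bar>"])
    show "AE g in measure_pmf D. (\<lambda>n. max 0 (H (t n - l g) - \<eta>)) \<longlonglongrightarrow> 0"
    proof (rule AE_I2, rule order_tendstoI)
      fix g and a :: real assume "0 < a"
      then have "eventually (\<lambda>x. H x \<le> \<eta> + a / 2) at_top" by (intro le) auto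
      from eventually_compose_filterlim[OF this t_shift[of "l g"]]
      show "\<forall>\<^sub>F n in sequentially. max 0 (H (t n - l g) - \<eta>) < a"
        by eventually_elim (use \<open>0 < a\<close> in \<open>simp add: field_simps\<close>)
    qed (auto intro!: always_eventually simp: less_max_iff_disj)
    have "max 0 (H x - \<eta>) \<le> B + \<bar>\<eta>\<bar>" for x
      using bound[of x] by (auto simp: max_def abs_le_iff)
    then show "AE g in measure_pmf D. norm (max 0 (H (t n - l g) - \<eta>)) \<le> B + \<bar>\<eta>\<bar>" for n
      by (intro AE_I2) simp
  qed auto
  have "(\<lambda>n. H (t n) - zf (t n)) \<longlonglongrightarrow> \<eta> - 0"
    by (intro tendsto_diff lim filterlim_compose[OF zf t])
  moreover have "H (t n) - zf (t n) = E (\<lambda>g. H (t n - l g))" for n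
    using eq[of "t n"] by linarith
  ultimately have "(\<lambda>n. E (\<lambda>g. H (t n - l g))) \<longlonglongrightarrow> \<eta>"
    by simp
  \<comment> \<open>An absolute value is twice the positive part minus the value itself. The
    positive part vanishes in the limit, and so does the mean deviation by the renewal equation;
    hence the convergence holds in mean.\<close>
  then have "(\<lambda>n. 2 * E (\<lambda>g. max 0 (H (t n - l g) - \<eta>)) - (E (\<lambda>g. H (t n - l g)) - \<eta>)) \<longlonglongrightarrow> 2 * 0 - (\<eta> - \<eta>)"
    using pos by (intro tendsto_intros) simp_all
  moreover have intm: "integrable (measure_pmf D) (\<lambda>g. max 0 (H (t n - l g) - \<eta>))" for n
    by (intro integrable_max intd) simp
  have "2 * E (\<lambda>g. max 0 (H (t n - l g) - \<eta>)) - (E (\<lambda>g. H (t n - l g)) - \<eta>)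
      = E (\<lambda>g. \<bar>H (t n - l g) - \<eta>\<bar>)" for n
  proof -
    have "E (\<lambda>g. \<bar>H (t n - l g) - \<eta>\<bar>)
        = E (\<lambda>g. 2 * max 0 (H (t n - l g) - \<eta>) - (H (t n - l g) - \<eta>))"
      by (intro Bochner_Integration.integral_cong) (auto simp: max_def abs_if)
    also have "\<dots> = 2 * E (\<lambda>g. max 0 (H (t n - l g) - \<eta>)) - (E (\<lambda>g. H (t n - l g)) - \<eta>)"
      using int intm intd by simp
    finally show ?thesis ..
  qed
  ultimately have abs0: "(\<lambda>n. E (\<lambda>g. \<bar>H (t n - l g) - \<eta>\<bar>)) \<longlonglongrightarrow> 0"
    by simp
  \<comment> \<open>A single loop has positive probability, so convergence in mean implies
    convergence along it.\<close>
  have "pmf D g * \<bar>H (t n - l g) - \<eta>\<bar> \<le> E (\<lambda>g. \<bar>H (t n - l g) - \<eta>\<bar>)" for n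
  proof -
    have "pmf D g * \<bar>H (t n - l g) - \<eta>\<bar> = E (\<lambda>g'. \<bar>H (t n - l g') - \<eta>\<bar> * indicator {g} g')"
      by (subst integral_measure_pmf[where A = "{g}"]) (auto simp: indicator_def split: if_splits)
    also have "\<dots> \<le> E (\<lambda>g. \<bar>H (t n - l g) - \<eta>\<bar>)"
      using intd by (intro integral_mono' integrable_abs) (auto split: split_indicator)
    finally show ?thesis .
  qed
  moreover have "pmf D g > 0" using g by (simp add: pmf_D)
  ultimately have "norm (H (t n - l g) - \<eta>) \<le> E (\<lambda>g. \<bar>H (t n - l g) - \<eta>\<bar>) / pmf D g" for n
    by (simp add: pos_le_divide_eq mult.commute)
  then have "(\<lambda>n. H (t n - l g) - \<eta>) \<longlonglongrightarrow> 0"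
    by (rule Lim_null_comparison[OF always_eventually[OF allI]])
       (use tendsto_divide[OF abs0 tendsto_const[of "pmf D g"]] \<open>pmf D g > 0\<close> in simp)
  then show ?thesis by (simp add: LIM_zero_iff)
qed

section \<open>Concatenated loops and the limit of the normalized count\<close>

inductive_set loops :: "'a list set" where
  Nil: "[] \<in> loops"
| Cons: "g \<in> L \<Longrightarrow> p \<in> loops \<Longrightarrow> g @ p \<in> loops"

lemma loops_append: "p \<in> loops \<Longrightarrow> q \<in> loops \<Longrightarrow> p @ q \<in> loops"
  by (induction rule: loops.induct) (auto intro: loops.intros)

lemma L_loops: "g \<in> L \<Longrightarrow> g \<in> loops"
  using loops.Cons[OF _ loops.Nil] by simp

lemma loops_nonneg: "p \<in> loops \<Longrightarrow> 0 \<le> l p"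
proof (induction rule: loops.induct)
  case (Cons g p)
  then show ?case using l_pos_L[of g] by (simp add: l_append)
qed simp

lemma extremal_shift_loops:
  fixes H zf :: "real \<Rightarrow> real" and t :: "nat \<Rightarrow> real"
  assumes bound: "\<And>x. \<bar>H x\<bar> \<le> B"
    and eq: "\<And>x. H x = zf x + E (\<lambda>g. H (x - l g))"
    and zf: "(zf \<longlongrightarrow> 0) at_top"
    and le: "\<And>e. e > 0 \<Longrightarrow> eventually (\<lambda>x. H x \<le> \<eta> + e) at_top"
    and p: "p \<in> loops"
    and t: "filterlim t at_top sequentially" and lim: "(\<lambda>n. H (t n)) \<longlonglongrightarrow> \<eta>"
  shows "(\<lambda>n. H (t n - l p)) \<longlonglongrightarrow> \<eta>"
  using p t lim
proof (induction p arbitrary: t rule: loops.induct)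
  case (Cons g p)
  have 1: "(\<lambda>n. H (t n - l g)) \<longlonglongrightarrow> \<eta>"
    by (rule extremal_shift[OF bound eq zf Cons.prems le Cons.hyps(1)])
  have "filterlim (\<lambda>n. - l g + t n) at_top sequentially"
    by (rule filterlim_tendsto_add_at_top[OF tendsto_const Cons.prems(1)])
  then have 2: "filterlim (\<lambda>n. t n - l g) at_top sequentially" by simp
  have "(\<lambda>n. H (t n - l g - l p)) \<longlonglongrightarrow> \<eta>"
    by (rule Cons.IH[OF 2 1])
  then show ?case by (simp add: l_append algebra_simps)
qed simp

lemma loops_dense:
  assumes "0 < \<delta>"
  obtains x0 where "0 \<le> x0" "\<And>x. x0 \<le> x \<Longrightarrow> \<exists>p\<in>loops. x \<le> l p \<and> l p \<le> x + \<delta>"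
proof -
  have "\<exists>x0\<ge>0. \<forall>x\<ge>x0. \<exists>s\<in>l ` loops. x \<le> s \<and> s \<le> x + \<delta>"
  proof (rule nonlattice_semigroup_dense[where A = "l ` L"])
    show "s + s' \<in> l ` loops" if "s \<in> l ` loops" "s' \<in> l ` loops" for s s'
      using that by (auto simp: l_append[symmetric] intro!: imageI loops_append)
    show "0 \<in> l ` loops"
      using loops.Nil by force
  qed (use l_pos_L nonlattice L_loops loops_nonneg assms in auto)
  then show ?thesis using that by blast
qed

lemma integrable_D_bound:
  fixes f w :: "'a list \<Rightarrow> real"
  assumes w: "integrable (measure_pmf D) w" and le: "\<And>g. g \<in> L \<Longrightarrow> \<bar>f g\<bar> \<le> w g"
  shows "integrable (measure_pmf D) f"
proof (rule Bochner_Integration.integrable_bound[OF w])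
  have "norm (f g) \<le> norm (w g)" if "g \<in> L" for g
    using le[OF that] by simp
  then show "AE g in measure_pmf D. norm (f g) \<le> norm (w g)"
    by (simp add: AE_D)
qed simp

lemma I_diff_steps_lower:
  assumes "0 \<le> d"
  shows "(\<Sum>j<k. G (t - real (Suc j) * d)) * (1 - exp (- h * d)) \<le> I P t - I P (t - real k * d)"
proof (induction k)
  case (Suc k)
  have eq: "t - real (Suc k) * d = (t - real k * d) - d"
    by (simp add: algebra_simps)
  show ?case
    unfolding sum.lessThan_Suc distrib_right[of _ _ "_ - _"] eq
    using I_diff_lower[OF assms, of "t - real k * d"] Suc unfolding eq by linarith
qed simp

lemma I_diff_steps_upper:
  assumes "0 \<le> d"
  shows "I P t - I P (t - real k * d) \<le> (\<Sum>j<k. G (t - real j * d)) * (exp (h * d) - 1)"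
proof (induction k)
  case (Suc k)
  have eq: "t - real (Suc k) * d = (t - real k * d) - d"
    by (simp add: algebra_simps)
  show ?case
    unfolding sum.lessThan_Suc distrib_right[of _ _ "_ - _"] eq
    using I_diff_upper[OF assms, of "t - real k * d"] Suc unfolding eq by linarith
qed simp

lemma I_diff_integrable: "integrable (measure_pmf D) (\<lambda>g. I P t - I P (t - l g))"
proof (rule E_bounded_integrable)
  fix g assume "g \<in> L"
  then have "I P (t - l g) \<le> I P t"
    by (intro I_mono) (auto simp: less_imp_le l_pos_L)
  then show "norm (I P t - I P (t - l g)) \<le> I P t"
    using I_nonneg[of P "t - l g"] by simp
qed

text \<open>The value \<open>\<eta>\<close> propagates backwards along loops whose lengths are
  \<open>\<delta>\<close>-dense beyond \<open>x0\<close>. So \<open>G\<close> is nearly at least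
  \<open>\<eta>\<close> on arbitrarily long stretches to the left of \<open>t n - x0\<close>. There
  the increment of \<open>I P\<close> over a loop \<open>g\<close> is at least about
  \<open>h * \<eta> * l g\<close>, and its mean cannot exceed \<open>residual_mass\<close>.\<close>

lemma limsup_G_le:
  assumes t: "filterlim t at_top sequentially" and lim: "(\<lambda>n. G (t n)) \<longlonglongrightarrow> \<eta>"
    and le: "\<And>e. e > 0 \<Longrightarrow> eventually (\<lambda>x. G x \<le> \<eta> + e) at_top"
  shows "h * m * \<eta> \<le> residual_mass"
proof -
  have \<eta>: "0 \<le> \<eta>"
    by (rule tendsto_lowerbound[OF lim]) (auto simp: G_nonneg)
  have key: "(1 - exp (- h * \<delta>)) * exp (- h * \<delta>) * (m / \<delta> - 1) * \<eta> \<le> residual_mass" if \<delta>: "0 < \<delta>" for \<delta>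
  proof -
    obtain x0 where x0: "0 \<le> x0" "\<And>x. x0 \<le> x \<Longrightarrow> \<exists>p\<in>loops. x \<le> l p \<and> l p \<le> x + \<delta>"
      using loops_dense[OF \<delta>] by blast
    define a where "a n = t n - x0" for n
    define c where "c = exp (- h * \<delta>) * \<eta>"
    have c: "0 \<le> c" using \<eta> by (simp add: c_def)
    \<comment> \<open>Truncation at \<open>c\<close> turns an asymptotic lower bound into a limit,
      as dominated convergence requires.\<close>
    have lim_min: "(\<lambda>n. min (G (a n - y)) c) \<longlonglongrightarrow> c" if "0 \<le> y" for y
    proof -
      from x0(2)[of "x0 + y"] that obtain p where p: "p \<in> loops" "x0 + y \<le> l p" "l p \<le> x0 + y + \<delta>"
        by auto
      have shift: "(\<lambda>n. G (t n - l p)) \<longlonglongrightarrow> \<eta>"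
        by (rule extremal_shift_loops[OF G_abs_le G_renewal wsum_R_tendsto le p(1) t lim]) auto
      have "exp (- h * \<delta>) * G (t n - l p) \<le> G (a n - y)" for n
      proof -
        have "exp (- h * \<delta>) * G (t n - l p) \<le> exp (- h * ((a n - y) - (t n - l p))) * G (t n - l p)"
          using p h_pos by (intro mult_right_mono G_nonneg) (simp add: a_def)
        also have "\<dots> \<le> G (a n - y)"
          by (rule G_slow) (use p in \<open>simp add: a_def\<close>)
        finally show ?thesis .
      qed
      then have 1: "min (exp (- h * \<delta>) * G (t n - l p)) c \<le> min (G (a n - y)) c" for n
        by (meson min.mono order_refl)
      have "(\<lambda>n. min (exp (- h * \<delta>) * G (t n - l p)) c) \<longlonglongrightarrow> min (exp (- h * \<delta>) * \<eta>) c"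
        by (intro tendsto_min tendsto_mult shift tendsto_const)
      then have 2: "(\<lambda>n. min (exp (- h * \<delta>) * G (t n - l p)) c) \<longlonglongrightarrow> c"
        by (simp add: c_def)
      show ?thesis
        by (rule tendsto_sandwich[OF _ _ 2 tendsto_const]) (use 1 in auto)
    qed
    \<comment> \<open>The loop is cut into whole steps of length \<open>\<delta>\<close>; rounding
      down loses at most one step, which disappears as \<open>\<delta>\<close> tends to 0.\<close>
    define k where "k g = nat \<lfloor>l g / \<delta>\<rfloor>" for g
    have k: "real (k g) * \<delta> \<le> l g" "l g / \<delta> - 1 \<le> real (k g)" if "g \<in> L" for g
    proof -
      have "0 \<le> l g / \<delta>" using l_pos_L[OF that] \<delta> by simp
      then have k_eq: "real (k g) = of_int \<lfloor>l g / \<delta>\<rfloor>" by (simp add: k_def)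
      then show "l g / \<delta> - 1 \<le> real (k g)" by linarith
      have "real (k g) \<le> l g / \<delta>" using k_eq by linarith
      then show "real (k g) * \<delta> \<le> l g" using \<delta> by (simp add: pos_le_divide_eq)
    qed
    define F where "F n g = (\<Sum>j<k g. min (G (a n - real (Suc j) * \<delta>)) c)" for n g
    have F_bound: "0 \<le> F n g" "F n g \<le> real (k g) * c" for n g
    proof -
      show "0 \<le> F n g"
        unfolding F_def using G_nonneg c by (intro sum_nonneg) simp
      have "F n g \<le> (\<Sum>j<k g. c)"
        unfolding F_def by (intro sum_mono) simp
      then show "F n g \<le> real (k g) * c" by simp
    qed
    have w_int: "integrable (measure_pmf D) (\<lambda>g. l g / \<delta> * c)"
      using l_integrable by simp
    have kc_le: "real (k g) * c \<le> l g / \<delta> * c" if "g \<in> L" for g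
      using k(1)[OF that] \<delta> c by (intro mult_right_mono) (simp_all add: pos_le_divide_eq)
    have F_le: "F n g \<le> l g / \<delta> * c" if "g \<in> L" for n g
      using F_bound(2)[of n g] kc_le[OF that] by linarith
    have F_int: "integrable (measure_pmf D) (F n)" for n
      by (rule integrable_D_bound[OF w_int]) (use F_le F_bound in simp)
    have kc_int: "integrable (measure_pmf D) (\<lambda>g. real (k g) * c)"
      by (rule integrable_D_bound[OF w_int]) (use kc_le c in simp)
    have "(\<lambda>n. E (F n)) \<longlonglongrightarrow> E (\<lambda>g. real (k g) * c)"
    proof (rule integral_dominated_convergence[OF _ _ w_int])
      show "AE g in measure_pmf D. (\<lambda>n. F n g) \<longlonglongrightarrow> real (k g) * c"
      proof (rule AE_I2)
        fix g
        have "(\<lambda>n. F n g) \<longlonglongrightarrow> (\<Sum>j<k g. c)"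
          unfolding F_def using \<delta> by (intro tendsto_sum lim_min) simp
        then show "(\<lambda>n. F n g) \<longlonglongrightarrow> real (k g) * c" by simp
      qed
      show "AE g in measure_pmf D. norm (F n g) \<le> l g / \<delta> * c" for n
        using F_le F_bound(1) by (auto simp: AE_D)
    qed auto
    then have "(\<lambda>n. (1 - exp (- h * \<delta>)) * E (F n)) \<longlonglongrightarrow> (1 - exp (- h * \<delta>)) * E (\<lambda>g. real (k g) * c)"
      by (intro tendsto_mult tendsto_const)
    moreover have "(1 - exp (- h * \<delta>)) * E (F n) \<le> residual_mass" for n
    proof -
      have e1: "0 \<le> 1 - exp (- h * \<delta>)" using h_pos \<delta> by simp
      have "(1 - exp (- h * \<delta>)) * E (F n) = E (\<lambda>g. (1 - exp (- h * \<delta>)) * F n g)" by simp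
      also have "\<dots> \<le> E (\<lambda>g. I P (a n) - I P (a n - l g))"
      proof (rule integral_mono_AE)
        have "(1 - exp (- h * \<delta>)) * F n g \<le> I P (a n) - I P (a n - l g)" if "g \<in> L" for g
        proof -
          have "F n g \<le> (\<Sum>j<k g. G (a n - real (Suc j) * \<delta>))"
            unfolding F_def by (intro sum_mono) simp
          then have "(1 - exp (- h * \<delta>)) * F n g \<le> (\<Sum>j<k g. G (a n - real (Suc j) * \<delta>)) * (1 - exp (- h * \<delta>))"
            using e1 by (subst mult.commute) (rule mult_right_mono)
          also have "\<dots> \<le> I P (a n) - I P (a n - real (k g) * \<delta>)"
            by (rule I_diff_steps_lower) (use \<delta> in simp)
          also have "\<dots> \<le> I P (a n) - I P (a n - l g)"
            using I_mono[of "a n - l g" "a n - real (k g) * \<delta>" P] k(1)[OF that] by simp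
          finally show ?thesis .
        qed
        then show "AE g in measure_pmf D. (1 - exp (- h * \<delta>)) * F n g \<le> I P (a n) - I P (a n - l g)"
          by (simp add: AE_D)
      qed (use F_int I_diff_integrable in auto)
      also have "\<dots> \<le> residual_mass" unfolding E_I_diff by (rule I_R_le_RH)
      finally show ?thesis .
    qed
    ultimately have "(1 - exp (- h * \<delta>)) * E (\<lambda>g. real (k g) * c) \<le> residual_mass"
      by (intro tendsto_upperbound) auto
    moreover have "(m / \<delta> - 1) * c \<le> E (\<lambda>g. real (k g) * c)"
    proof -
      have "(m / \<delta> - 1) * c = E (\<lambda>g. (l g / \<delta> - 1) * c)"
        using l_integrable by (simp add: m_def)
      also have "\<dots> \<le> E (\<lambda>g. real (k g) * c)"
      proof (rule integral_mono_AE)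
        have "(l g / \<delta> - 1) * c \<le> real (k g) * c" if "g \<in> L" for g
          using k(2)[OF that] c by (rule mult_right_mono)
        then show "AE g in measure_pmf D. (l g / \<delta> - 1) * c \<le> real (k g) * c"
          by (simp add: AE_D)
      qed (use l_integrable kc_int in auto)
      finally show ?thesis .
    qed
    moreover have "0 \<le> 1 - exp (- h * \<delta>)" using h_pos \<delta> by simp
    ultimately have "(1 - exp (- h * \<delta>)) * ((m / \<delta> - 1) * c) \<le> residual_mass"
      by (meson mult_left_mono order_trans)
    then show ?thesis by (simp add: c_def mult_ac)
  qed
  \<comment> \<open>As \<open>\<delta>\<close> tends to 0, the mean number of steps is about
    \<open>m / \<delta>\<close>, and each contributes about
    \<open>h * \<delta> * \<eta>\<close>.\<close>
  have "((\<lambda>\<delta>. (1 - exp (- (h * \<delta>))) / \<delta>) \<longlongrightarrow> h) (at_right 0)"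
    using h_pos by real_asymp
  moreover have "((\<lambda>\<delta>. exp (- (h * \<delta>)) * (m - \<delta>)) \<longlongrightarrow> exp (- (h * 0)) * (m - 0)) (at_right 0)"
    by (intro tendsto_intros)
  ultimately have "((\<lambda>\<delta>. (1 - exp (- (h * \<delta>))) / \<delta> * (exp (- (h * \<delta>)) * (m - \<delta>))) \<longlongrightarrow> h * m) (at_right 0)"
    using tendsto_mult by fastforce
  moreover have "eventually (\<lambda>\<delta>. (1 - exp (- (h * \<delta>))) / \<delta> * (exp (- (h * \<delta>)) * (m - \<delta>))
      = (1 - exp (- (h * \<delta>))) * exp (- (h * \<delta>)) * (m / \<delta> - 1)) (at_right 0)"
    using eventually_at_right_less[of "0::real"] by eventually_elim (simp add: field_simps)
  ultimately have "((\<lambda>\<delta>. (1 - exp (- (h * \<delta>))) * exp (- (h * \<delta>)) * (m / \<delta> - 1)) \<longlongrightarrow> h * m) (at_right 0)"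
    by (rule Lim_transform_eventually)
  then have "((\<lambda>\<delta>. (1 - exp (- h * \<delta>)) * exp (- h * \<delta>) * (m / \<delta> - 1) * \<eta>) \<longlongrightarrow> h * m * \<eta>) (at_right 0)"
    by (intro tendsto_mult_right) simp
  moreover have "eventually (\<lambda>\<delta>. (1 - exp (- h * \<delta>)) * exp (- h * \<delta>) * (m / \<delta> - 1) * \<eta> \<le> residual_mass) (at_right 0)"
    using eventually_at_right_less[of "0::real"] by eventually_elim (rule key)
  ultimately show ?thesis
    by (rule tendsto_upperbound) simp
qed

text \<open>The mirror image of the upper bound: extremal values of \<open>- G\<close>, truncation
  by \<open>max\<close>, rounding up, and increments bounded by values at right ends. This time it
  matters that \<open>I R (a n)\<close> converges to \<open>residual_mass\<close> and does not
  merely stay below it.\<close>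

lemma liminf_G_ge:
  assumes t: "filterlim t at_top sequentially" and lim: "(\<lambda>n. G (t n)) \<longlonglongrightarrow> \<gamma>"
    and le: "\<And>e. e > 0 \<Longrightarrow> eventually (\<lambda>x. - G x \<le> - \<gamma> + e) at_top"
  shows "residual_mass \<le> h * m * \<gamma>"
proof -
  have \<gamma>: "0 \<le> \<gamma>"
    by (rule tendsto_lowerbound[OF lim]) (auto simp: G_nonneg)
  have key: "residual_mass \<le> (exp (h * \<delta>) - 1) * exp (h * \<delta>) * (m / \<delta> + 1) * \<gamma>" if \<delta>: "0 < \<delta>" for \<delta>
  proof -
    obtain x0 where x0: "0 \<le> x0" "\<And>x. x0 \<le> x \<Longrightarrow> \<exists>p\<in>loops. x \<le> l p \<and> l p \<le> x + \<delta>"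
      using loops_dense[OF \<delta>] by blast
    \<comment> \<open>The additional \<open>\<delta>\<close> puts \<open>a n - y\<close> to the left
      of \<open>t n - l p\<close>, so that \<open>G_slow\<close> bounds \<open>G (a n - y)\<close>
      from above.\<close>
    define a where "a n = t n - x0 - \<delta>" for n
    define c where "c = exp (h * \<delta>) * \<gamma>"
    have c: "0 \<le> c" using \<gamma> by (simp add: c_def)
    have lim_max: "(\<lambda>n. max (G (a n - y)) c) \<longlonglongrightarrow> c" if "0 \<le> y" for y
    proof -
      from x0(2)[of "x0 + y"] that obtain p where p: "p \<in> loops" "x0 + y \<le> l p" "l p \<le> x0 + y + \<delta>"
        by auto
      have bound: "\<bar>- G x\<bar> \<le> G_bound" for x
        using G_abs_le[of x] by simp
      have eq: "- G x = - wsum R (\<lambda>_. 1) x + E (\<lambda>g. - G (x - l g))" for x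
        using G_renewal[of x] by simp
      have "((\<lambda>x. - wsum R (\<lambda>_. 1::real) x) \<longlongrightarrow> - 0) at_top"
        by (intro tendsto_minus wsum_R_tendsto) simp
      then have zf: "((\<lambda>x. - wsum R (\<lambda>_. 1::real) x) \<longlongrightarrow> 0) at_top"
        by simp
      have "(\<lambda>n. - G (t n - l p)) \<longlonglongrightarrow> - \<gamma>"
        by (rule extremal_shift_loops[OF bound eq zf le p(1) t tendsto_minus[OF lim]])
      then have shift: "(\<lambda>n. G (t n - l p)) \<longlonglongrightarrow> \<gamma>"
        by (rule tendsto_minus_cancel)
      have "G (a n - y) \<le> exp (h * \<delta>) * G (t n - l p)" for n
      proof -
        have "exp (- h * \<delta>) * G (a n - y) \<le> exp (- h * ((t n - l p) - (a n - y))) * G (a n - y)"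
          using p h_pos by (intro mult_right_mono G_nonneg) (simp add: a_def)
        also have "\<dots> \<le> G (t n - l p)"
          by (rule G_slow) (use p in \<open>simp add: a_def\<close>)
        finally show ?thesis by (simp add: exp_minus field_simps)
      qed
      then have 1: "max (G (a n - y)) c \<le> max (exp (h * \<delta>) * G (t n - l p)) c" for n
        by (meson max.mono order_refl)
      have "(\<lambda>n. max (exp (h * \<delta>) * G (t n - l p)) c) \<longlonglongrightarrow> max (exp (h * \<delta>) * \<gamma>) c"
        by (intro tendsto_max tendsto_mult shift tendsto_const)
      then have 2: "(\<lambda>n. max (exp (h * \<delta>) * G (t n - l p)) c) \<longlonglongrightarrow> c"
        by (simp add: c_def)
      show ?thesis
        by (rule tendsto_sandwich[OF _ _ tendsto_const 2]) (use 1 in auto)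
    qed
    define k where "k g = nat \<lceil>l g / \<delta>\<rceil>" for g
    have k: "l g \<le> real (k g) * \<delta>" "real (k g) \<le> l g / \<delta> + 1" if "g \<in> L" for g
    proof -
      have "0 \<le> l g / \<delta>" using l_pos_L[OF that] \<delta> by simp
      then have k_eq: "real (k g) = of_int \<lceil>l g / \<delta>\<rceil>" by (simp add: k_def)
      then show "real (k g) \<le> l g / \<delta> + 1" by linarith
      have "l g / \<delta> \<le> real (k g)" using k_eq by linarith
      then show "l g \<le> real (k g) * \<delta>" using \<delta> by (simp add: pos_divide_le_eq)
    qed
    define B where "B = max G_bound c"
    have B: "0 \<le> B" using G_bound_nonneg by (simp add: B_def)
    define F where "F n g = (\<Sum>j<k g. max (G (a n - real j * \<delta>)) c)" for n g
    have F_nonneg: "0 \<le> F n g" for n g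
      unfolding F_def using G_nonneg by (intro sum_nonneg) (simp add: le_max_iff_disj)
    have F_le': "F n g \<le> real (k g) * B" for n g
    proof -
      have "F n g \<le> (\<Sum>j<k g. B)"
        unfolding F_def B_def by (intro sum_mono max.mono G_le order_refl)
      then show ?thesis by simp
    qed
    have w_int: "integrable (measure_pmf D) (\<lambda>g. (l g / \<delta> + 1) * B)"
      using l_integrable by simp
    have kB: "real (k g) * B \<le> (l g / \<delta> + 1) * B" if "g \<in> L" for g
      using k(2)[OF that] B by (rule mult_right_mono)
    have F_le: "F n g \<le> (l g / \<delta> + 1) * B" if "g \<in> L" for n g
      using F_le'[of n g] kB[OF that] by linarith
    have F_int: "integrable (measure_pmf D) (F n)" for n
      by (rule integrable_D_bound[OF w_int]) (use F_le F_nonneg in simp)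
    have kc_le: "real (k g) * c \<le> (l g / \<delta> + 1) * c" if "g \<in> L" for g
      using k(2)[OF that] c by (rule mult_right_mono)
    have wc_int: "integrable (measure_pmf D) (\<lambda>g. (l g / \<delta> + 1) * c)"
      using l_integrable by simp
    have kc_int: "integrable (measure_pmf D) (\<lambda>g. real (k g) * c)"
      by (rule integrable_D_bound[OF wc_int]) (use kc_le c in simp)
    have "(\<lambda>n. E (F n)) \<longlonglongrightarrow> E (\<lambda>g. real (k g) * c)"
    proof (rule integral_dominated_convergence[OF _ _ w_int])
      show "AE g in measure_pmf D. (\<lambda>n. F n g) \<longlonglongrightarrow> real (k g) * c"
      proof (rule AE_I2)
        fix g
        have "(\<lambda>n. F n g) \<longlonglongrightarrow> (\<Sum>j<k g. c)"
          unfolding F_def using \<delta> by (intro tendsto_sum lim_max) simp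
        then show "(\<lambda>n. F n g) \<longlonglongrightarrow> real (k g) * c" by simp
      qed
      show "AE g in measure_pmf D. norm (F n g) \<le> (l g / \<delta> + 1) * B" for n
        using F_le F_nonneg by (auto simp: AE_D)
    qed auto
    then have limE: "(\<lambda>n. (exp (h * \<delta>) - 1) * E (F n)) \<longlonglongrightarrow> (exp (h * \<delta>) - 1) * E (\<lambda>g. real (k g) * c)"
      by (intro tendsto_mult tendsto_const)
    have le_F: "I R (a n) \<le> (exp (h * \<delta>) - 1) * E (F n)" for n
    proof -
      have e1: "0 \<le> exp (h * \<delta>) - 1" using h_pos \<delta> by simp
      have "I R (a n) = E (\<lambda>g. I P (a n) - I P (a n - l g))"
        by (rule E_I_diff[symmetric])
      also have "\<dots> \<le> E (\<lambda>g. (exp (h * \<delta>) - 1) * F n g)"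
      proof (rule integral_mono_AE)
        have "I P (a n) - I P (a n - l g) \<le> (exp (h * \<delta>) - 1) * F n g" if "g \<in> L" for g
        proof -
          have "I P (a n) - I P (a n - l g) \<le> I P (a n) - I P (a n - real (k g) * \<delta>)"
            using I_mono[of "a n - real (k g) * \<delta>" "a n - l g" P] k(1)[OF that] by simp
          also have "\<dots> \<le> (\<Sum>j<k g. G (a n - real j * \<delta>)) * (exp (h * \<delta>) - 1)"
            by (rule I_diff_steps_upper) (use \<delta> in simp)
          also have "\<dots> \<le> F n g * (exp (h * \<delta>) - 1)"
            unfolding F_def using e1 by (intro mult_right_mono sum_mono) auto
          finally show ?thesis by (simp add: mult.commute)
        qed
        then show "AE g in measure_pmf D. I P (a n) - I P (a n - l g) \<le> (exp (h * \<delta>) - 1) * F n g"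
          by (simp add: AE_D)
      qed (use F_int I_diff_integrable in auto)
      finally show ?thesis by simp
    qed
    have "filterlim (\<lambda>n. - (x0 + \<delta>) + t n) at_top sequentially"
      by (rule filterlim_tendsto_add_at_top[OF tendsto_const t])
    then have "filterlim a at_top sequentially"
      by (rule filterlim_cong[THEN iffD1, rotated -1]) (auto simp: a_def)
    from filterlim_compose[OF I_R_tendsto this]
    have "residual_mass \<le> (exp (h * \<delta>) - 1) * E (\<lambda>g. real (k g) * c)"
      by (rule tendsto_le[OF sequentially_bot limE]) (use le_F in auto)
    also have "\<dots> \<le> (exp (h * \<delta>) - 1) * ((m / \<delta> + 1) * c)"
    proof (rule mult_left_mono)
      have "E (\<lambda>g. real (k g) * c) \<le> E (\<lambda>g. (l g / \<delta> + 1) * c)"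
        by (rule integral_mono_AE) (use kc_le kc_int wc_int in \<open>auto simp: AE_D\<close>)
      also have "\<dots> = (m / \<delta> + 1) * c"
        using l_integrable by (simp add: m_def)
      finally show "E (\<lambda>g. real (k g) * c) \<le> (m / \<delta> + 1) * c" .
    qed (use h_pos \<delta> in simp)
    finally show ?thesis by (simp add: c_def mult_ac)
  qed
  have "((\<lambda>\<delta>. (exp (h * \<delta>) - 1) / \<delta>) \<longlongrightarrow> h) (at_right 0)"
    using h_pos by real_asymp
  moreover have "((\<lambda>\<delta>. exp (h * \<delta>) * (m + \<delta>)) \<longlongrightarrow> exp (h * 0) * (m + 0)) (at_right 0)"
    by (intro tendsto_intros)
  ultimately have "((\<lambda>\<delta>. (exp (h * \<delta>) - 1) / \<delta> * (exp (h * \<delta>) * (m + \<delta>))) \<longlongrightarrow> h * m) (at_right 0)"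
    using tendsto_mult by fastforce
  moreover have "eventually (\<lambda>\<delta>. (exp (h * \<delta>) - 1) / \<delta> * (exp (h * \<delta>) * (m + \<delta>))
      = (exp (h * \<delta>) - 1) * exp (h * \<delta>) * (m / \<delta> + 1)) (at_right 0)"
    using eventually_at_right_less[of "0::real"] by eventually_elim (simp add: field_simps)
  ultimately have "((\<lambda>\<delta>. (exp (h * \<delta>) - 1) * exp (h * \<delta>) * (m / \<delta> + 1)) \<longlongrightarrow> h * m) (at_right 0)"
    by (rule Lim_transform_eventually)
  then have "((\<lambda>\<delta>. (exp (h * \<delta>) - 1) * exp (h * \<delta>) * (m / \<delta> + 1) * \<gamma>) \<longlongrightarrow> h * m * \<gamma>) (at_right 0)"
    by (intro tendsto_mult_right)
  moreover have "eventually (\<lambda>\<delta>. residual_mass \<le> (exp (h * \<delta>) - 1) * exp (h * \<delta>) * (m / \<delta> + 1) * \<gamma>) (at_right 0)"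
    using eventually_at_right_less[of "0::real"] by eventually_elim (rule key)
  ultimately show ?thesis
    by (rule tendsto_lowerbound) simp
qed

text \<open>The constant value of the count for which the mean increment of \<open>I P\<close> over
  a loop, \<open>h * m\<close> times that value, equals \<open>residual_mass\<close>.\<close>

definition G_infinity :: real where "G_infinity = residual_mass / (h * m)"

lemma G_infinity_pos: "0 < G_infinity"
  using residual_mass_pos h_pos m_pos by (simp add: G_infinity_def)

theorem G_tendsto: "(G \<longlongrightarrow> G_infinity) at_top"
proof -
  obtain \<eta> t where 1: "filterlim t at_top sequentially" "(\<lambda>n. G (t n)) \<longlonglongrightarrow> \<eta>"
    "\<And>e. e > 0 \<Longrightarrow> eventually (\<lambda>x. G x \<le> \<eta> + e) at_top"
    using limsup_sequence[of G G_bound] G_abs_le by metis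
  \<comment> \<open>Here \<open>\<gamma>\<close> is the upper limit of \<open>- G\<close>, so
    \<open>- \<gamma>\<close> is the lower limit of \<open>G\<close>.\<close>
  obtain \<gamma> s where 2: "filterlim s at_top sequentially" "(\<lambda>n. - G (s n)) \<longlonglongrightarrow> \<gamma>"
    "\<And>e. e > 0 \<Longrightarrow> eventually (\<lambda>x. - G x \<le> \<gamma> + e) at_top"
    using limsup_sequence[of "\<lambda>x. - G x" G_bound] G_abs_le by (metis abs_minus_cancel)
  have hm: "0 < h * m" using h_pos m_pos by simp
  have "h * m * \<eta> \<le> residual_mass"
    by (rule limsup_G_le[OF 1])
  then have le: "\<eta> \<le> G_infinity"
    using hm by (simp add: G_infinity_def pos_le_divide_eq mult.commute)
  have "residual_mass \<le> h * m * (- \<gamma>)"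
    by (rule liminf_G_ge[OF 2(1)]) (use tendsto_minus[OF 2(2)] 2(3) in auto)
  then have ge: "G_infinity \<le> - \<gamma>"
    using hm by (simp add: G_infinity_def pos_divide_le_eq mult.commute)
  show ?thesis
  proof (rule order_tendstoI)
    fix a assume "a < G_infinity"
    then have "eventually (\<lambda>x. - G x \<le> \<gamma> + (G_infinity - a) / 2) at_top"
      by (intro 2(3)) simp
    then show "eventually (\<lambda>x. a < G x) at_top"
      by eventually_elim (use ge \<open>a < G_infinity\<close> in \<open>simp add: field_simps\<close>)
  next
    fix a assume "G_infinity < a"
    then have "eventually (\<lambda>x. G x \<le> \<eta> + (a - G_infinity) / 2) at_top"
      by (intro 1(3)) simp
    then show "eventually (\<lambda>x. G x < a) at_top"
      by eventually_elim (use le \<open>G_infinity < a\<close> in \<open>simp add: field_simps\<close>)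
  qed
qed

end

section \<open>The central limit theorem for renewal processes\<close>

lemma exp_quadratic_bound: "exp x \<le> 1 + x + x\<^sup>2 / 2 * exp \<bar>x\<bar>" for x :: real
proof -
  obtain t where t: "\<bar>t\<bar> \<le> \<bar>x\<bar>" "exp x = (\<Sum>k<2. x ^ k / fact k) + exp t / fact 2 * x ^ 2"
    using Maclaurin_exp_le[of x 2] by blast
  have "exp t / 2 * x\<^sup>2 \<le> exp \<bar>x\<bar> / 2 * x\<^sup>2"
    using t(1) by (intro mult_right_mono divide_right_mono) auto
  with t(2) show ?thesis
    by (simp add: numeral_2_eq_2 algebra_simps)
qed

text \<open>Serves to separate cost and length in a common exponent without knowledge of their joint
  distribution.\<close>

lemma exp_convex_half: "exp (a + b) \<le> exp (2 * a) / 2 + exp (2 * b) / 2" for a b :: real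
proof -
  have "0 \<le> (exp a - exp b)\<^sup>2" by simp
  moreover have "exp (2 * a) = (exp a)\<^sup>2" "exp (2 * b) = (exp b)\<^sup>2"
    by (simp_all add: exp_double)
  ultimately show ?thesis
    by (simp add: power2_diff exp_add)
qed

lemma exp_minus_quadratic: "exp (- x) \<le> 1 - x + x\<^sup>2 / 2" if "0 \<le> x" for x :: real
proof -
  obtain t where t: "exp (- x) = (\<Sum>k<3. (- x) ^ k / fact k) + exp t / fact 3 * (- x) ^ 3"
    using Maclaurin_exp_le[of "- x" 3] by blast
  have "0 \<le> exp t / 6 * x ^ 3" using that by simp
  with t show ?thesis
    by (simp add: numeral_2_eq_2 numeral_3_eq_3 algebra_simps)
qed

section \<open>Exponential moments of a random loop\<close>

context renewal begin

definition exp_moment :: real where "exp_moment = E (\<lambda>g. exp (\<epsilon> * l g))"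

lemma exp_moment_nonneg: "0 \<le> exp_moment"
  unfolding exp_moment_def by (rule Bochner_Integration.integral_nonneg) simp

lemma exp_bound_integrable:
  assumes "\<And>g. g \<in> L \<Longrightarrow> \<bar>u g\<bar> \<le> \<epsilon> * l g"
  shows "integrable (measure_pmf D) (\<lambda>g. exp (u g))"
  by (rule integrable_D_bound[OF exp_moment_integrable]) (use assms in \<open>auto simp: abs_le_iff\<close>)

lemma linear_integrable:
  assumes "\<And>g. g \<in> L \<Longrightarrow> \<bar>u g\<bar> \<le> c * l g"
  shows "integrable (measure_pmf D) u"
  by (rule integrable_D_bound[where w = "\<lambda>g. c * l g"]) (use assms l_integrable in auto)

text \<open>Centring removes the linear term. Half of the available exponential moment absorbs the
  factor \<open>exp \<bar>\<theta> * u g\<bar>\<close> in the Taylor remainder, the other half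
  absorbs the square of \<open>l g\<close>. The constant 4 is half of the 8 that comes from
  \<open>x\<^sup>2 / 2 \<le> exp x\<close> at \<open>x = \<epsilon> / 2 * l g\<close>.\<close>

lemma centered_exp_moment:
  assumes bound: "\<And>g. g \<in> L \<Longrightarrow> \<bar>u g\<bar> \<le> c * l g" and centered: "E u = 0"
    and c: "0 \<le> c" and \<theta>: "\<bar>\<theta>\<bar> * c \<le> \<epsilon> / 2"
  shows "E (\<lambda>g. exp (\<theta> * u g)) \<le> 1 + 4 * c\<^sup>2 / \<epsilon>\<^sup>2 * exp_moment * \<theta>\<^sup>2"
proof -
  have abs_le: "\<bar>\<theta> * u g\<bar> \<le> \<epsilon> / 2 * l g" if "g \<in> L" for g
  proof -
    have "\<bar>\<theta> * u g\<bar> \<le> \<bar>\<theta>\<bar> * (c * l g)"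
      unfolding abs_mult by (intro mult_left_mono bound that) simp
    also have "\<dots> \<le> \<epsilon> / 2 * l g"
      using mult_right_mono[OF \<theta>, of "l g"] l_pos_L[OF that] by (simp add: mult.assoc)
    finally show ?thesis .
  qed
  have point: "exp (\<theta> * u g) \<le> 1 + \<theta> * u g + 4 * c\<^sup>2 / \<epsilon>\<^sup>2 * \<theta>\<^sup>2 * exp (\<epsilon> * l g)" if g: "g \<in> L" for g
  proof -
    have "(u g)\<^sup>2 \<le> (c * l g)\<^sup>2"
      using bound[OF g] by (metis abs_ge_zero power2_abs power_mono)
    have "(\<epsilon> / 2 * l g)\<^sup>2 / 2 \<le> exp (\<epsilon> / 2 * l g)"
    proof -
      have nn: "0 \<le> \<epsilon> / 2 * l g" using eps_pos l_pos_L[OF g] by simp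
      have "1 + \<epsilon> / 2 * l g + (\<epsilon> / 2 * l g)\<^sup>2 / 2 \<le> exp (\<epsilon> / 2 * l g)"
        by (rule exp_lower_Taylor_quadratic[OF nn])
      then show ?thesis using nn by linarith
    qed
    then have sq: "(l g)\<^sup>2 \<le> 8 / \<epsilon>\<^sup>2 * exp (\<epsilon> / 2 * l g)"
      using eps_pos by (simp add: power_mult_distrib power_divide pos_le_divide_eq mult.commute)
    have "(u g)\<^sup>2 \<le> c\<^sup>2 * (l g)\<^sup>2"
      using \<open>(u g)\<^sup>2 \<le> (c * l g)\<^sup>2\<close> unfolding power_mult_distrib .
    also have "\<dots> \<le> c\<^sup>2 * (8 / \<epsilon>\<^sup>2 * exp (\<epsilon> / 2 * l g))"
      by (rule mult_left_mono[OF sq]) simp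
    finally have "(\<theta> * u g)\<^sup>2 \<le> \<theta>\<^sup>2 * (c\<^sup>2 * (8 / \<epsilon>\<^sup>2 * exp (\<epsilon> / 2 * l g)))"
      unfolding power_mult_distrib by (rule mult_left_mono) simp
    then have "(\<theta> * u g)\<^sup>2 / 2 * exp \<bar>\<theta> * u g\<bar>
        \<le> (\<theta>\<^sup>2 * (c\<^sup>2 * (8 / \<epsilon>\<^sup>2 * exp (\<epsilon> / 2 * l g)))) / 2 * exp (\<epsilon> / 2 * l g)"
      by (rule mult_mono[OF divide_right_mono]) (use abs_le[OF g] in simp_all)
    also have "\<dots> = 4 * c\<^sup>2 / \<epsilon>\<^sup>2 * \<theta>\<^sup>2 * (exp (\<epsilon> / 2 * l g) * exp (\<epsilon> / 2 * l g))"
      by simp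
    also have "exp (\<epsilon> / 2 * l g) * exp (\<epsilon> / 2 * l g) = exp (\<epsilon> * l g)"
      unfolding exp_add[symmetric] by simp
    finally show ?thesis
      using exp_quadratic_bound[of "\<theta> * u g"] by linarith
  qed
  have u_int: "integrable (measure_pmf D) u"
    by (rule linear_integrable[OF bound])
  have "\<bar>\<theta> * u g\<bar> \<le> \<epsilon> * l g" if "g \<in> L" for g
  proof -
    have "0 \<le> \<epsilon> / 2 * l g" using eps_pos l_pos_L[OF that] by simp
    then show ?thesis using abs_le[OF that] by linarith
  qed
  then have exp_int: "integrable (measure_pmf D) (\<lambda>g. exp (\<theta> * u g))"
    by (rule exp_bound_integrable)
  have "E (\<lambda>g. exp (\<theta> * u g)) \<le> E (\<lambda>g. 1 + \<theta> * u g + 4 * c\<^sup>2 / \<epsilon>\<^sup>2 * \<theta>\<^sup>2 * exp (\<epsilon> * l g))"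
    by (rule integral_mono_AE) (use point exp_int u_int exp_moment_integrable in \<open>auto simp: AE_D\<close>)
  also have "\<dots> = 1 + \<theta> * E u + 4 * c\<^sup>2 / \<epsilon>\<^sup>2 * \<theta>\<^sup>2 * exp_moment"
    using u_int exp_moment_integrable by (simp add: exp_moment_def)
  finally show ?thesis
    by (simp add: centered mult_ac)
qed

definition sq_moment :: real where "sq_moment = E (\<lambda>g. (l g)\<^sup>2)"

lemma sq_moment_pos: "0 < sq_moment"
proof -
  have "l0\<^sup>2 \<le> sq_moment"
    unfolding sq_moment_def
  proof (rule measure_pmf.integral_ge_const[OF power_moment_integrable])
    have "l0\<^sup>2 \<le> (l g)\<^sup>2" if "g \<in> L" for g
      using l0_le[OF that] l0_pos by (intro power_mono) auto
    then show "AE g in measure_pmf D. l0\<^sup>2 \<le> (l g)\<^sup>2" by (simp add: AE_D)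
  qed
  then show ?thesis using l0_pos by (meson less_le_trans zero_less_power)
qed

text \<open>Tilting by \<open>\<theta> * u g\<close> raises the total weight only to second order,
  because \<open>u\<close> is centred; charging \<open>\<kappa> * \<theta>\<^sup>2\<close> per unit
  of length lowers it by about \<open>\<kappa> * \<theta>\<^sup>2 * m\<close>. For large
  \<open>\<kappa>\<close> the charge wins, and the tilted loop weights sum to less than 1 unless
  \<open>\<theta> = 0\<close>.\<close>

lemma tilted_weight_bound:
  assumes bound: "\<And>g. g \<in> L \<Longrightarrow> \<bar>u g\<bar> \<le> c * l g" and centered: "E u = 0"
    and c: "0 \<le> c"
  obtains \<kappa> \<theta>0 where "0 < \<kappa>" "0 < \<theta>0" "\<theta>0 * c \<le> \<epsilon> / 2"
    "\<And>\<theta>. \<bar>\<theta>\<bar> \<le> \<theta>0 \<Longrightarrow> integrable (measure_pmf D) (\<lambda>g. exp (\<theta> * u g - \<kappa> * \<theta>\<^sup>2 * l g))"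
    "\<And>\<theta>. \<bar>\<theta>\<bar> \<le> \<theta>0 \<Longrightarrow> E (\<lambda>g. exp (\<theta> * u g - \<kappa> * \<theta>\<^sup>2 * l g)) \<le> 1 - \<kappa> * \<theta>\<^sup>2 * m / 2"
proof -
  define K where "K = 4 * c\<^sup>2 / \<epsilon>\<^sup>2 * exp_moment"
  have K: "0 \<le> K" using exp_moment_nonneg by (simp add: K_def)
  \<comment> \<open>Large enough for the second-order gain \<open>K * \<theta>\<^sup>2\<close> to be
    at most an eighth of the charge \<open>\<kappa> * \<theta>\<^sup>2 * m\<close>.\<close>
  define \<kappa> where "\<kappa> = 8 * (K + 1) / m"
  have \<kappa>: "0 < \<kappa>" "K \<le> \<kappa> * m / 8"
    using K m_pos by (simp_all add: \<kappa>_def)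
  \<comment> \<open>The first bound admits the exponential moment at \<open>2 * \<theta>\<close>;
    the second keeps the mean quadratic term of \<open>exp (- (2 * s * l g))\<close> below a quarter
    of the linear one.\<close>
  define \<theta>0 where "\<theta>0 = min (\<epsilon> / (4 * (c + 1))) (sqrt (m / (4 * \<kappa> * sq_moment)))"
  have "0 < m / (4 * \<kappa> * sq_moment)" using m_pos \<kappa> sq_moment_pos by simp
  then have \<theta>0: "0 < \<theta>0"
    using eps_pos c by (simp add: \<theta>0_def)
  have "\<theta>0 * (4 * (c + 1)) \<le> \<epsilon>"
    using c by (simp add: \<theta>0_def pos_le_divide_eq[symmetric])
  then have \<theta>0c: "\<theta>0 * c \<le> \<epsilon> / 4"
    using \<theta>0 by (simp add: algebra_simps)
  have main: "integrable (measure_pmf D) (\<lambda>g. exp (\<theta> * u g - \<kappa> * \<theta>\<^sup>2 * l g)) \<and>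
      E (\<lambda>g. exp (\<theta> * u g - \<kappa> * \<theta>\<^sup>2 * l g)) \<le> 1 - \<kappa> * \<theta>\<^sup>2 * m / 2" if "\<bar>\<theta>\<bar> \<le> \<theta>0" for \<theta>
  proof -
    define s where "s = \<kappa> * \<theta>\<^sup>2"
    have s: "0 \<le> s" using \<kappa> by (simp add: s_def)
    have l2: "\<theta>\<^sup>2 \<le> m / (4 * \<kappa> * sq_moment)"
    proof -
      have "\<bar>\<theta>\<bar> \<le> sqrt (m / (4 * \<kappa> * sq_moment))" using that by (simp add: \<theta>0_def)
      then have "\<bar>\<theta>\<bar>\<^sup>2 \<le> (sqrt (m / (4 * \<kappa> * sq_moment)))\<^sup>2" by (intro power_mono) auto
      then show ?thesis using \<open>0 < m / (4 * \<kappa> * sq_moment)\<close> by simp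
    qed
    have sM2: "s * sq_moment \<le> m / 4"
      using l2 \<kappa> sq_moment_pos by (simp add: s_def pos_le_divide_eq mult_ac)
    have "\<bar>\<theta>\<bar> * c \<le> \<epsilon> / 4"
      using mult_right_mono[OF that c] \<theta>0c by linarith
    then have 2: "\<bar>2 * \<theta>\<bar> * c \<le> \<epsilon> / 2" by (simp add: abs_mult)
    have e2: "E (\<lambda>g. exp (2 * \<theta> * u g)) \<le> 1 + K * (2 * \<theta>)\<^sup>2"
      using centered_exp_moment[OF bound centered c 2] by (simp add: K_def)
    have int2: "integrable (measure_pmf D) (\<lambda>g. exp (2 * \<theta> * u g))"
    proof (rule exp_bound_integrable)
      fix g assume g: "g \<in> L"
      have "\<bar>2 * \<theta> * u g\<bar> \<le> \<bar>2 * \<theta>\<bar> * (c * l g)"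
        unfolding abs_mult[of "2 * \<theta>"] by (intro mult_left_mono bound g) simp
      also have "\<dots> \<le> \<epsilon> / 2 * l g"
        using mult_right_mono[OF 2, of "l g"] l_pos_L[OF g] by (simp only: mult.assoc less_imp_le)
      also have "\<dots> \<le> \<epsilon> * l g"
        using eps_pos l_pos_L[OF g] by simp
      finally show "\<bar>2 * \<theta> * u g\<bar> \<le> \<epsilon> * l g" .
    qed
    have int3: "integrable (measure_pmf D) (\<lambda>g. exp (- (2 * s * l g)))"
      by (rule E_bounded_integrable[where B = 1]) (use s l_pos_L in \<open>simp add: less_imp_le\<close>)
    have l2_int: "integrable (measure_pmf D) (\<lambda>g. (l g)\<^sup>2)"
      by (rule power_moment_integrable)
    have "E (\<lambda>g. exp (- (2 * s * l g))) \<le> E (\<lambda>g. 1 - 2 * s * l g + 2 * s\<^sup>2 * (l g)\<^sup>2)"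
    proof (rule integral_mono_AE)
      have "exp (- (2 * s * l g)) \<le> 1 - 2 * s * l g + 2 * s\<^sup>2 * (l g)\<^sup>2" if "g \<in> L" for g
        using exp_minus_quadratic[of "2 * s * l g"] s l_pos_L[OF that]
        by (simp add: power_mult_distrib)
      then show "AE g in measure_pmf D. exp (- (2 * s * l g)) \<le> 1 - 2 * s * l g + 2 * s\<^sup>2 * (l g)\<^sup>2"
        by (simp add: AE_D)
    qed (use int3 l_integrable l2_int in auto)
    also have "\<dots> = 1 - 2 * s * m + 2 * s * (s * sq_moment)"
      using l_integrable l2_int by (simp add: m_def sq_moment_def power2_eq_square)
    also have "\<dots> \<le> 1 - 2 * s * m + 2 * s * (m / 4)"
      using mult_left_mono[OF sM2, of "2 * s"] s by simp
    finally have e3: "E (\<lambda>g. exp (- (2 * s * l g))) \<le> 1 - 3 / 2 * (s * m)"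
      by simp
    have point: "exp (\<theta> * u g - s * l g) \<le> exp (2 * \<theta> * u g) / 2 + exp (- (2 * s * l g)) / 2" for g
      using exp_convex_half[of "\<theta> * u g" "- (s * l g)"] by (simp add: mult.assoc)
    have int_half: "integrable (measure_pmf D) (\<lambda>g. exp (2 * \<theta> * u g) / 2 + exp (- (2 * s * l g)) / 2)"
      using int2 int3 by simp
    have int: "integrable (measure_pmf D) (\<lambda>g. exp (\<theta> * u g - s * l g))"
      by (rule integrable_D_bound[OF int_half]) (use point in simp)
    have "E (\<lambda>g. exp (\<theta> * u g - s * l g)) \<le> E (\<lambda>g. exp (2 * \<theta> * u g) / 2 + exp (- (2 * s * l g)) / 2)"
      by (rule integral_mono[OF int int_half point])
    also have "\<dots> = E (\<lambda>g. exp (2 * \<theta> * u g)) / 2 + E (\<lambda>g. exp (- (2 * s * l g))) / 2"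
      using int2 int3 by simp
    also have "\<dots> \<le> 1 + 2 * (K * \<theta>\<^sup>2) - 3 / 4 * (s * m)"
      using e2 e3 by (simp add: power_mult_distrib)
    also have "K * \<theta>\<^sup>2 \<le> s * m / 8"
      using mult_right_mono[OF \<kappa>(2), of "\<theta>\<^sup>2"] by (simp add: s_def mult_ac)
    finally have "E (\<lambda>g. exp (\<theta> * u g - s * l g)) \<le> 1 - s * m / 2"
      by simp
    with int show ?thesis by (simp add: s_def)
  qed
  have le2: "\<theta>0 * c \<le> \<epsilon> / 2" using \<theta>0c eps_pos by linarith
  from that[OF \<kappa>(1) \<theta>0 le2] main show thesis by blast
qed

end

section \<open>Tail bounds for centred costs\<close>

locale renewal_cost = renewal +
  fixes y :: "'a list \<Rightarrow> real" and C :: real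
  assumes y_append: "y (p @ q) = y p + y q"
    and y_le: "p \<in> P \<Longrightarrow> \<bar>y p\<bar> \<le> C * l p"
    and C_nonneg: "0 \<le> C"
    and y_centered: "E y = 0"
begin

lemma y_le_L: "g \<in> L \<Longrightarrow> \<bar>y g\<bar> \<le> C * l g"
  using y_le L_subset by blast

text \<open>Since \<open>W\<close> is nondecreasing, splitting off the first loop bounds
  \<open>W t\<close> by \<open>residual_sum + (1 - q) * W t\<close>. A total loop weight below 1
  thus bounds the sum uniformly in \<open>t\<close>.\<close>

lemma weighted_sum_bound:
  assumes s: "0 \<le> s" and \<theta>: "\<bar>\<theta>\<bar> * C \<le> \<epsilon>" and q: "0 < q"
    and int: "integrable (measure_pmf D) (\<lambda>g. exp (\<theta> * y g - s * l g))"
    and E_le: "E (\<lambda>g. exp (\<theta> * y g - s * l g)) \<le> 1 - q"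
  shows "(\<Sum>p\<in>below P t. exp (\<theta> * y p - (h + s) * l p)) \<le> residual_sum / q"
proof -
  define W where "W t = (\<Sum>p\<in>below P t. exp (\<theta> * y p - (h + s) * l p))" for t
  have W_nonneg: "0 \<le> W t" for t by (simp add: W_def sum_nonneg)
  have W_mono: "W t' \<le> W t" if "t' \<le> t" for t t'
    unfolding W_def using that by (intro sum_mono2) (auto simp: below_def)
  have "W t = (\<Sum>r\<in>below R t. exp (\<theta> * y r - (h + s) * l r))
      + (\<Sum>g\<in>below L t. \<Sum>p\<in>below P (t - l g). exp (\<theta> * y (g @ p) - (h + s) * l (g @ p)))"
    unfolding W_def by (rule sum_below_P)
  also have "(\<Sum>g\<in>below L t. \<Sum>p\<in>below P (t - l g). exp (\<theta> * y (g @ p) - (h + s) * l (g @ p)))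
      = (\<Sum>g\<in>below L t. exp (\<theta> * y g - (h + s) * l g) * W (t - l g))"
    unfolding W_def sum_distrib_left
    by (intro sum.cong refl) (simp add: exp_add[symmetric] l_append y_append algebra_simps)
  also have "\<dots> \<le> (\<Sum>g\<in>below L t. exp (\<theta> * y g - (h + s) * l g) * W t)"
    using l_pos_L by (intro sum_mono mult_left_mono W_mono) (auto simp: below_def less_imp_le)
  also have "\<dots> = (\<Sum>g\<in>below L t. exp (\<theta> * y g - (h + s) * l g)) * W t"
    by (rule sum_distrib_right[symmetric])
  also have "(\<Sum>g\<in>below L t. exp (\<theta> * y g - (h + s) * l g)) \<le> 1 - q"
  proof -
    have "(\<Sum>g\<in>below L t. exp (\<theta> * y g - (h + s) * l g))
        = (\<Sum>g\<in>below L t. exp (- h * l g) *\<^sub>R (exp (\<theta> * y g - s * l g) * indicator {g. l g < t} g))"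
      by (intro sum.cong refl) (simp add: below_def exp_add[symmetric] algebra_simps)
    also have "\<dots> = E (\<lambda>g. exp (\<theta> * y g - s * l g) * indicator {g. l g < t} g)"
      by (rule E_below[symmetric]) simp
    also have "\<dots> \<le> E (\<lambda>g. exp (\<theta> * y g - s * l g))"
      using int by (intro integral_mono') (auto split: split_indicator)
    finally show ?thesis using E_le by simp
  qed
  also have "(\<Sum>r\<in>below R t. exp (\<theta> * y r - (h + s) * l r)) \<le> residual_sum"
  proof -
    have "(\<Sum>r\<in>below R t. exp (\<theta> * y r - (h + s) * l r)) \<le> (\<Sum>r\<in>below R t. exp (- (h - \<epsilon>) * l r))"
    proof (intro sum_mono)
      fix r assume "r \<in> below R t"
      then have r: "r \<in> P" using R_subset by (auto simp: below_def)
      have "\<theta> * y r \<le> \<bar>\<theta>\<bar> * (C * l r)"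
        using mult_left_mono[OF y_le[OF r], of "\<bar>\<theta>\<bar>"] abs_ge_self[of "\<theta> * y r"] by (simp add: abs_mult)
      also have "\<dots> \<le> \<epsilon> * l r"
        using mult_right_mono[OF \<theta> l_nonneg[OF r]] by (simp add: mult.assoc)
      finally have "\<theta> * y r - (h + s) * l r \<le> - (h - \<epsilon>) * l r"
        using mult_nonneg_nonneg[OF s l_nonneg[OF r]] by (simp add: algebra_simps)
      then show "exp (\<theta> * y r - (h + s) * l r) \<le> exp (- (h - \<epsilon>) * l r)" by simp
    qed
    also have "\<dots> \<le> residual_sum" by (intro sum_R_le) (auto simp: below_def)
    finally show ?thesis .
  qed
  finally have "W t \<le> residual_sum + (1 - q) * W t"
    using W_nonneg by (simp add: mult_right_mono)
  then have "W t * q \<le> residual_sum" by (simp add: algebra_simps)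
  then show ?thesis using q by (simp add: W_def pos_le_divide_eq)
qed

text \<open>Chernoff's bound with both signs of \<open>\<theta>\<close>, based on the weighted sums
  that are bounded uniformly in \<open>t\<close>. The length charge reappears as the factor
  \<open>exp (\<kappa> * \<theta>\<^sup>2 * t)\<close>, which stays bounded for
  \<open>\<theta>\<close> of order \<open>1 / sqrt t\<close>.\<close>

lemma tail_bound:
  obtains \<kappa> \<theta>0 A where "0 < \<kappa>" "0 < \<theta>0" "0 \<le> A"
    "\<And>\<theta> t K. 0 < \<theta> \<Longrightarrow> \<theta> \<le> \<theta>0 \<Longrightarrow>
      exp (- h * t) * real (card {p \<in> below P t. K \<le> \<bar>y p\<bar>}) \<le> A / \<theta>\<^sup>2 * exp (\<kappa> * \<theta>\<^sup>2 * t - \<theta> * K)"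
proof -
  obtain \<kappa> \<theta>0 where \<kappa>: "0 < \<kappa>" "0 < \<theta>0" "\<theta>0 * C \<le> \<epsilon> / 2"
    "\<And>\<theta>. \<bar>\<theta>\<bar> \<le> \<theta>0 \<Longrightarrow> integrable (measure_pmf D) (\<lambda>g. exp (\<theta> * y g - \<kappa> * \<theta>\<^sup>2 * l g))"
    "\<And>\<theta>. \<bar>\<theta>\<bar> \<le> \<theta>0 \<Longrightarrow> E (\<lambda>g. exp (\<theta> * y g - \<kappa> * \<theta>\<^sup>2 * l g)) \<le> 1 - \<kappa> * \<theta>\<^sup>2 * m / 2"
    using tilted_weight_bound[OF y_le_L y_centered C_nonneg] by blast
  \<comment> \<open>Two signs of \<open>\<theta>\<close>, each contributing
    \<open>residual_sum / (s * m / 2)\<close> with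
    \<open>s = \<kappa> * \<theta>\<^sup>2\<close>.\<close>
  define A where "A = 4 * residual_sum / (\<kappa> * m)"
  have A: "0 \<le> A" using residual_sum_nonneg \<kappa> m_pos by (simp add: A_def)
  have "exp (- h * t) * real (card {p \<in> below P t. K \<le> \<bar>y p\<bar>}) \<le> A / \<theta>\<^sup>2 * exp (\<kappa> * \<theta>\<^sup>2 * t - \<theta> * K)"
    if \<theta>: "0 < \<theta>" "\<theta> \<le> \<theta>0" for \<theta> t K
  proof -
    define s where "s = \<kappa> * \<theta>\<^sup>2"
    have s: "0 < s" using \<kappa> \<theta> by (simp add: s_def)
    have W: "(\<Sum>p\<in>below P t. exp (\<theta>' * y p - (h + s) * l p)) \<le> residual_sum / (s * m / 2)"
      if "\<theta>' = \<theta> \<or> \<theta>' = - \<theta>" for \<theta>'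
    proof (rule weighted_sum_bound)
      have abs: "\<bar>\<theta>'\<bar> = \<theta>" "\<theta>'\<^sup>2 = \<theta>\<^sup>2" using that \<theta> by auto
      have "\<theta> * C \<le> \<theta>0 * C" using \<theta> C_nonneg by (intro mult_right_mono) auto
      then show "\<bar>\<theta>'\<bar> * C \<le> \<epsilon>" unfolding abs(1) using \<kappa>(3) eps_pos by linarith
      show "integrable (measure_pmf D) (\<lambda>g. exp (\<theta>' * y g - s * l g))"
        using \<kappa>(4)[of \<theta>'] abs \<theta> by (simp add: s_def)
      show "E (\<lambda>g. exp (\<theta>' * y g - s * l g)) \<le> 1 - s * m / 2"
        using \<kappa>(5)[of \<theta>'] abs \<theta> by (simp add: s_def)
    qed (use s m_pos in auto)
    have "exp (- h * t) * real (card {p \<in> below P t. K \<le> \<bar>y p\<bar>})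
        = (\<Sum>p\<in>{p \<in> below P t. K \<le> \<bar>y p\<bar>}. exp (- h * t))" by simp
    also have "\<dots> \<le> (\<Sum>p\<in>{p \<in> below P t. K \<le> \<bar>y p\<bar>}.
        exp (s * t - \<theta> * K) * (exp (\<theta> * y p - (h + s) * l p) + exp (- \<theta> * y p - (h + s) * l p)))"
    proof (intro sum_mono)
      fix p assume p: "p \<in> {p \<in> below P t. K \<le> \<bar>y p\<bar>}"
      then have lp: "l p \<le> t" and K: "K \<le> \<bar>y p\<bar>" by (auto simp: below_def)
      have "(h + s) * l p \<le> (h + s) * t"
        using lp h_pos s by (intro mult_left_mono) auto
      moreover have "\<theta> * K \<le> \<theta> * \<bar>y p\<bar>"
        using K \<theta> by (intro mult_left_mono) auto
      ultimately have "- h * t \<le> (s * t - \<theta> * K) + (\<theta> * \<bar>y p\<bar> - (h + s) * l p)"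
        by (simp add: algebra_simps)
      then have "exp (- h * t) \<le> exp (s * t - \<theta> * K) * exp (\<theta> * \<bar>y p\<bar> - (h + s) * l p)"
        unfolding exp_add[symmetric] by simp
      also have "exp (\<theta> * \<bar>y p\<bar> - (h + s) * l p)
          \<le> exp (\<theta> * y p - (h + s) * l p) + exp (- \<theta> * y p - (h + s) * l p)"
        by (cases "0 \<le> y p") (auto simp: abs_if)
      finally show "exp (- h * t) \<le> exp (s * t - \<theta> * K) *
          (exp (\<theta> * y p - (h + s) * l p) + exp (- \<theta> * y p - (h + s) * l p))"
        by simp
    qed
    also have "\<dots> \<le> (\<Sum>p\<in>below P t.
        exp (s * t - \<theta> * K) * (exp (\<theta> * y p - (h + s) * l p) + exp (- \<theta> * y p - (h + s) * l p)))"
      by (intro sum_mono2) (auto intro: add_nonneg_nonneg)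
    also have "\<dots> = exp (s * t - \<theta> * K) * ((\<Sum>p\<in>below P t. exp (\<theta> * y p - (h + s) * l p))
        + (\<Sum>p\<in>below P t. exp (- \<theta> * y p - (h + s) * l p)))"
      by (simp only: sum_distrib_left[symmetric] sum.distrib)
    also have "\<dots> \<le> exp (s * t - \<theta> * K) * (residual_sum / (s * m / 2) + residual_sum / (s * m / 2))"
      by (intro mult_left_mono add_mono W) auto
    also have "\<dots> = A / \<theta>\<^sup>2 * exp (\<kappa> * \<theta>\<^sup>2 * t - \<theta> * K)"
      by (simp add: A_def s_def mult_ac)
    finally show ?thesis .
  qed
  from that[OF \<kappa>(1,2) A this] show thesis by blast
qed

end

lemma norm_cis_minus_one: "norm (cis x - 1) \<le> \<bar>x\<bar>"
  using iexp_approx1[of x 0] by (simp add: cis_conv_exp)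

section \<open>The random walk formed by independent loops\<close>

context renewal begin

text \<open>The law of the concatenation of \<open>n\<close> independent random loops, kept as a law
  on paths because both length and cost are read off from it.\<close>

primrec walk :: "nat \<Rightarrow> 'a list pmf" where
  "walk 0 = return_pmf []"
| "walk (Suc n) = bind_pmf D (\<lambda>g. map_pmf ((@) g) (walk n))"

abbreviation EW :: "nat \<Rightarrow> ('a list \<Rightarrow> 'b::{banach,second_countable_topology}) \<Rightarrow> 'b" where
  "EW n \<equiv> measure_pmf.expectation (walk n)"

lemma EW_Suc_complex:
  fixes \<phi> :: "'a list \<Rightarrow> complex"
  assumes "\<And>p. norm (\<phi> p) \<le> B"
  shows "EW (Suc n) \<phi> = E (\<lambda>g. EW n (\<lambda>p. \<phi> (g @ p)))"
  by (simp add: expectation_bind_pmf_bounded_complex[of \<phi> B, OF assms])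

lemma EW_Suc_real:
  fixes \<phi> :: "'a list \<Rightarrow> real"
  assumes "\<And>p. \<bar>\<phi> p\<bar> \<le> B"
  shows "EW (Suc n) \<phi> = E (\<lambda>g. EW n (\<lambda>p. \<phi> (g @ p)))"
  by (simp add: expectation_bind_pmf_bounded_real[of \<phi> B, OF assms])

lemma pmf_integrable_bounded:
  fixes \<phi> :: "'c \<Rightarrow> 'b::{banach,second_countable_topology}"
  assumes "\<And>p. norm (\<phi> p) \<le> B"
  shows "integrable (measure_pmf q) \<phi>"
  by (rule measure_pmf.integrable_const_bound[where B = B]) (use assms in auto)

lemma nn_walk_exp:
  "(\<integral>\<^sup>+p. ennreal (exp (\<theta> * l p)) \<partial>measure_pmf (walk n))
    = (\<integral>\<^sup>+g. ennreal (exp (\<theta> * l g)) \<partial>measure_pmf D) ^ n"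
proof (induction n)
  case (Suc n)
  have "(\<integral>\<^sup>+p. ennreal (exp (\<theta> * l p)) \<partial>measure_pmf (walk (Suc n)))
      = (\<integral>\<^sup>+g. \<integral>\<^sup>+p. ennreal (exp (\<theta> * l g)) * ennreal (exp (\<theta> * l p)) \<partial>measure_pmf (walk n) \<partial>measure_pmf D)"
    by (simp add: l_append distrib_left exp_add ennreal_mult')
  also have "\<dots> = (\<integral>\<^sup>+g. ennreal (exp (\<theta> * l g)) \<partial>measure_pmf D)
      * (\<integral>\<^sup>+p. ennreal (exp (\<theta> * l p)) \<partial>measure_pmf (walk n))"
    by (simp add: nn_integral_cmult nn_integral_multc)
  finally show ?case using Suc by simp
qed simp

text \<open>Chosen such that \<open>\<bar>l g - m\<bar> \<le> length_dev_const * l g\<close> for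
  every loop, the form in which \<open>centered_exp_moment\<close> accepts the centred
  length.\<close>

definition length_dev_const :: real where "length_dev_const = 1 + m / l0"
definition length_exp_const :: real where "length_exp_const = 4 * length_dev_const\<^sup>2 / \<epsilon>\<^sup>2 * exp_moment"

lemma length_dev_const_pos: "0 < length_dev_const"
  using m_pos l0_pos by (simp add: length_dev_const_def add_pos_pos)

lemma length_exp_const_nonneg: "0 \<le> length_exp_const"
  using exp_moment_nonneg by (simp add: length_exp_const_def)

lemma exp_length_moment:
  assumes "\<bar>\<theta>\<bar> * length_dev_const \<le> \<epsilon> / 2"
  shows "(\<integral>\<^sup>+g. ennreal (exp (\<theta> * l g)) \<partial>measure_pmf D) \<le> ennreal (exp (\<theta> * m + length_exp_const * \<theta>\<^sup>2))"
proof -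
  have bound: "\<bar>l g - m\<bar> \<le> length_dev_const * l g" if "g \<in> L" for g
  proof -
    have "m \<le> m / l0 * l g"
      using mult_left_mono[OF l0_le[OF that], of "m / l0"] m_pos l0_pos by simp
    then show ?thesis
      using l_pos_L[OF that] m_pos by (simp add: length_dev_const_def distrib_right abs_le_iff)
  qed
  have "E (\<lambda>g. l g - m) = 0"
    using l_integrable by (simp add: m_def)
  from centered_exp_moment[OF bound this less_imp_le[OF length_dev_const_pos] assms]
  have le: "E (\<lambda>g. exp (\<theta> * (l g - m))) \<le> 1 + length_exp_const * \<theta>\<^sup>2"
    by (simp add: length_exp_const_def)
  have "1 \<le> length_dev_const" using m_pos l0_pos by (simp add: length_dev_const_def)
  then have "\<bar>\<theta>\<bar> * 1 \<le> \<bar>\<theta>\<bar> * length_dev_const" by (intro mult_left_mono) auto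
  then have th: "\<bar>\<theta>\<bar> \<le> \<epsilon>" using assms eps_pos by linarith
  have int: "integrable (measure_pmf D) (\<lambda>g. exp (\<theta> * l g))"
  proof (rule exp_bound_integrable)
    fix g assume "g \<in> L"
    then show "\<bar>\<theta> * l g\<bar> \<le> \<epsilon> * l g"
      unfolding abs_mult using l_pos_L[of g] th by (simp add: mult_right_mono)
  qed
  have "exp (\<theta> * l g) = exp (\<theta> * m) * exp (\<theta> * (l g - m))" for g
    unfolding exp_add[symmetric] by (simp add: algebra_simps)
  then have "E (\<lambda>g. exp (\<theta> * l g)) = exp (\<theta> * m) * E (\<lambda>g. exp (\<theta> * (l g - m)))"
    by simp
  also have "\<dots> \<le> exp (\<theta> * m) * exp (length_exp_const * \<theta>\<^sup>2)"
  proof (rule mult_left_mono)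
    have "1 + length_exp_const * \<theta>\<^sup>2 \<le> exp (length_exp_const * \<theta>\<^sup>2)" by (rule exp_ge_add_one_self)
    with le show "E (\<lambda>g. exp (\<theta> * (l g - m))) \<le> exp (length_exp_const * \<theta>\<^sup>2)" by linarith
  qed simp
  also have "\<dots> = exp (\<theta> * m + length_exp_const * \<theta>\<^sup>2)" by (simp add: exp_add)
  finally show ?thesis
    using nn_integral_eq_integral[OF int] by (simp add: ennreal_leI)
qed

text \<open>Markov's inequality for the exponential moment; \<open>\<theta>\<close> may have either
  sign, so that both tails are covered.\<close>

lemma walk_concentration:
  assumes "\<bar>\<theta>\<bar> * length_dev_const \<le> \<epsilon> / 2"
  shows "measure_pmf.prob (walk n) {p. a \<le> \<theta> * (l p - real n * m)} \<le> exp (real n * (length_exp_const * \<theta>\<^sup>2) - a)"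
proof -
  have "emeasure (measure_pmf (walk n)) {p. a \<le> \<theta> * (l p - real n * m)}
      = (\<integral>\<^sup>+p. indicator {p. a \<le> \<theta> * (l p - real n * m)} p \<partial>measure_pmf (walk n))"
    by simp
  also have "\<dots> \<le> (\<integral>\<^sup>+p. ennreal (exp (- (\<theta> * real n * m) - a)) * ennreal (exp (\<theta> * l p)) \<partial>measure_pmf (walk n))"
  proof (rule nn_integral_mono)
    fix p
    have "1 \<le> exp (- (\<theta> * real n * m) - a) * exp (\<theta> * l p)" if "a \<le> \<theta> * (l p - real n * m)"
      unfolding exp_add[symmetric] one_le_exp_iff using that by (simp add: algebra_simps)
    then show "indicator {p. a \<le> \<theta> * (l p - real n * m)} p
        \<le> ennreal (exp (- (\<theta> * real n * m) - a)) * ennreal (exp (\<theta> * l p))"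
      by (auto simp: ennreal_mult'[symmetric] split: split_indicator)
  qed
  also have "\<dots> = ennreal (exp (- (\<theta> * real n * m) - a)) * (\<integral>\<^sup>+g. ennreal (exp (\<theta> * l g)) \<partial>measure_pmf D) ^ n"
    by (simp add: nn_integral_cmult nn_walk_exp)
  also have "\<dots> \<le> ennreal (exp (- (\<theta> * real n * m) - a)) * ennreal (exp (\<theta> * m + length_exp_const * \<theta>\<^sup>2)) ^ n"
    by (intro mult_left_mono power_mono exp_length_moment assms) auto
  also have "\<dots> = ennreal (exp (- (\<theta> * real n * m) - a) * exp (\<theta> * m + length_exp_const * \<theta>\<^sup>2) ^ n)"
    by (simp add: ennreal_power ennreal_mult'[symmetric])
  also have "exp (- (\<theta> * real n * m) - a) * exp (\<theta> * m + length_exp_const * \<theta>\<^sup>2) ^ n = exp (real n * (length_exp_const * \<theta>\<^sup>2) - a)"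
    unfolding exp_of_nat_mult[symmetric] exp_add[symmetric] by (simp add: algebra_simps)
  finally show ?thesis
    by (simp add: measure_pmf.emeasure_eq_measure)
qed

lemma walk_bad:
  assumes "0 \<le> \<theta>" "\<theta> * length_dev_const \<le> \<epsilon> / 2"
  shows "measure_pmf.prob (walk n) {p. a \<le> \<theta> * \<bar>l p - real n * m\<bar>} \<le> 2 * exp (real n * (length_exp_const * \<theta>\<^sup>2) - a)"
proof -
  have "measure_pmf.prob (walk n) {p. a \<le> \<theta> * \<bar>l p - real n * m\<bar>}
      \<le> measure_pmf.prob (walk n) ({p. a \<le> \<theta> * (l p - real n * m)} \<union> {p. a \<le> (- \<theta>) * (l p - real n * m)})"
    by (intro measure_pmf.finite_measure_mono) (auto simp: abs_if algebra_simps split: if_splits)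
  also have "\<dots> \<le> measure_pmf.prob (walk n) {p. a \<le> \<theta> * (l p - real n * m)}
      + measure_pmf.prob (walk n) {p. a \<le> (- \<theta>) * (l p - real n * m)}"
    by (intro measure_Un_le) auto
  also have "\<dots> \<le> exp (real n * (length_exp_const * \<theta>\<^sup>2) - a) + exp (real n * (length_exp_const * (- \<theta>)\<^sup>2) - a)"
    by (intro add_mono walk_concentration) (use assms in auto)
  finally show ?thesis by simp
qed

lemma EW_le_good_bad:
  fixes \<psi> :: "'a list \<Rightarrow> real"
  assumes "\<And>p. 0 \<le> \<psi> p" "\<And>p. \<psi> p \<le> B" "\<And>p. p \<notin> X \<Longrightarrow> \<psi> p \<le> b" "0 \<le> b" "0 \<le> B"
  shows "EW n \<psi> \<le> b + B * measure_pmf.prob (walk n) X"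
proof -
  have "EW n \<psi> \<le> EW n (\<lambda>p. b + B * indicator X p)"
  proof (rule integral_mono)
    show "integrable (measure_pmf (walk n)) \<psi>"
      by (rule pmf_integrable_bounded[where B = B]) (use assms in simp)
    show "integrable (measure_pmf (walk n)) (\<lambda>p. b + B * indicator X p)"
      by (rule pmf_integrable_bounded[where B = "b + B"]) (use assms in \<open>auto split: split_indicator\<close>)
    show "\<psi> p \<le> b + B * indicator X p" for p
      using assms(2)[of p] assms(3)[of p] assms(4,5) by (cases "p \<in> X") auto
  qed
  also have "\<dots> = b + B * measure_pmf.prob (walk n) X"
  proof -
    have "integrable (measure_pmf (walk n)) (indicator X :: _ \<Rightarrow> real)"
      by (rule pmf_integrable_bounded[where B = 1]) (auto split: split_indicator)
    then show ?thesis by simp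
  qed
  finally show ?thesis .
qed

lemma wsum_norm_le:
  fixes f :: "'a list \<Rightarrow> 'b::real_normed_vector"
  assumes "\<And>p. norm (f p) \<le> 1"
  shows "norm (wsum A f t) \<le> wsum A (\<lambda>_. 1::real) t"
  unfolding wsum_def norm_scaleR abs_exp_cancel real_scaleR_def
  by (intro mult_left_mono order_trans[OF norm_sum] sum_mono assms) auto

lemma G_infinity_le: "G_infinity \<le> G_bound"
  by (rule tendsto_upperbound[OF G_tendsto]) (auto simp: G_le)

end

section \<open>Characteristic functions of the cost\<close>

context renewal_cost begin

text \<open>For \<open>t > 0\<close>, \<open>M \<theta> t / G t\<close> is the characteristic
  function of the cost under the uniform distribution on the paths below \<open>t\<close>.\<close>

definition M :: "real \<Rightarrow> real \<Rightarrow> complex" where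
  "M \<theta> = wsum P (\<lambda>p. cis (\<theta> * y p))"

lemma M_renewal:
  "M \<theta> t = wsum R (\<lambda>p. cis (\<theta> * y p)) t + E (\<lambda>g. cis (\<theta> * y g) * M \<theta> (t - l g))"
  unfolding M_def by (rule wsum_renewal) (simp add: y_append distrib_left cis_mult)

lemma norm_M_le: "norm (M \<theta> t) \<le> G t"
  unfolding M_def G_def by (rule wsum_norm_le) simp

lemma norm_M_le_G_bound: "norm (M \<theta> t) \<le> G_bound"
  using norm_M_le G_le by (rule order_trans)

lemma walk_char: "EW n (\<lambda>p. cis (\<theta> * y p)) = E (\<lambda>g. cis (\<theta> * y g)) ^ n"
proof (induction n)
  case 0
  have "y [] = 0" using y_append[of "[]" "[]"] by simp
  then show ?case by simp
next
  case (Suc n)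
  have "EW (Suc n) (\<lambda>p. cis (\<theta> * y p)) = E (\<lambda>g. EW n (\<lambda>p. cis (\<theta> * y (g @ p))))"
    by (rule EW_Suc_complex[where B = 1]) simp
  also have "\<dots> = E (\<lambda>g. cis (\<theta> * y g) * EW n (\<lambda>p. cis (\<theta> * y p)))"
    by (simp add: y_append distrib_left flip: cis_mult)
  finally show ?case using Suc by simp
qed

text \<open>Each use of the renewal equation leaves behind a sum over \<open>R\<close>, which in
  norm is at most the same sum with all phases replaced by 1. The error accumulated in
  \<open>n\<close> uses is therefore at most that of \<open>G\<close>, and the latter is the
  difference on the right, small as long as \<open>G\<close> is near its limit.\<close>

lemma M_iterate:
  "norm (M \<theta> t - EW n (\<lambda>p. cis (\<theta> * y p) * M \<theta> (t - l p))) \<le> G t - EW n (\<lambda>p. G (t - l p))"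
proof (induction n arbitrary: t)
  case 0
  have "y [] = 0" using y_append[of "[]" "[]"] by simp
  then show ?case by simp
next
  case (Suc n)
  define Z where "Z s = EW n (\<lambda>p. cis (\<theta> * y p) * M \<theta> (s - l p))" for s
  define V where "V s = EW n (\<lambda>p. G (s - l p))" for s
  have Z_le: "norm (Z s) \<le> G_bound" for s
    unfolding Z_def
  proof (rule order_trans[OF integral_norm_bound], rule measure_pmf.integral_le_const)
    show "integrable (measure_pmf (walk n)) (\<lambda>p. norm (cis (\<theta> * y p) * M \<theta> (s - l p)))"
      by (rule pmf_integrable_bounded[where B = G_bound]) (simp add: norm_mult norm_M_le_G_bound)
  qed (simp add: norm_mult norm_M_le_G_bound)
  have V_le: "\<bar>V s\<bar> \<le> G_bound" for s
    unfolding V_def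
  proof (rule order_trans[OF integral_abs_bound], rule measure_pmf.integral_le_const)
    show "integrable (measure_pmf (walk n)) (\<lambda>p. \<bar>G (s - l p)\<bar>)"
      by (rule pmf_integrable_bounded[where B = G_bound]) (simp add: G_abs_le)
  qed (simp add: G_abs_le)
  have "EW (Suc n) (\<lambda>p. cis (\<theta> * y p) * M \<theta> (t - l p))
      = E (\<lambda>g. EW n (\<lambda>p. cis (\<theta> * y (g @ p)) * M \<theta> (t - l (g @ p))))"
    by (rule EW_Suc_complex[where B = G_bound]) (simp add: norm_mult norm_M_le_G_bound)
  also have "(\<lambda>g. EW n (\<lambda>p. cis (\<theta> * y (g @ p)) * M \<theta> (t - l (g @ p))))
      = (\<lambda>g. cis (\<theta> * y g) * Z (t - l g))"
  proof
    fix g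
    have "(\<lambda>p. cis (\<theta> * y (g @ p)) * M \<theta> (t - l (g @ p)))
        = (\<lambda>p. cis (\<theta> * y g) * (cis (\<theta> * y p) * M \<theta> (t - l g - l p)))"
      by (simp add: y_append l_append distrib_left cis_mult[symmetric] diff_diff_eq mult.assoc)
    then show "EW n (\<lambda>p. cis (\<theta> * y (g @ p)) * M \<theta> (t - l (g @ p))) = cis (\<theta> * y g) * Z (t - l g)"
      unfolding Z_def by (simp only: integral_mult_right_zero)
  qed
  finally have Zs: "EW (Suc n) (\<lambda>p. cis (\<theta> * y p) * M \<theta> (t - l p)) = E (\<lambda>g. cis (\<theta> * y g) * Z (t - l g))" .
  have "EW (Suc n) (\<lambda>p. G (t - l p)) = E (\<lambda>g. EW n (\<lambda>p. G (t - l (g @ p))))"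
    by (rule EW_Suc_real[where B = G_bound]) (simp add: G_abs_le)
  also have "\<dots> = E (\<lambda>g. V (t - l g))"
    by (simp add: V_def l_append diff_diff_eq)
  finally have Vs: "EW (Suc n) (\<lambda>p. G (t - l p)) = E (\<lambda>g. V (t - l g))" .
  have int1: "integrable (measure_pmf D) (\<lambda>g. cis (\<theta> * y g) * M \<theta> (t - l g))"
    by (rule E_bounded_integrable[where B = G_bound]) (simp add: norm_mult norm_M_le_G_bound)
  have int2: "integrable (measure_pmf D) (\<lambda>g. cis (\<theta> * y g) * Z (t - l g))"
    by (rule E_bounded_integrable[where B = G_bound]) (simp add: norm_mult Z_le)
  have int3: "integrable (measure_pmf D) (\<lambda>g. G (t - l g))"
    by (rule E_bounded_integrable[where B = G_bound]) (simp add: G_abs_le)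
  have int4: "integrable (measure_pmf D) (\<lambda>g. V (t - l g))"
    by (rule E_bounded_integrable[where B = G_bound]) (simp add: V_le)
  have "M \<theta> t - E (\<lambda>g. cis (\<theta> * y g) * Z (t - l g))
      = wsum R (\<lambda>p. cis (\<theta> * y p)) t + (E (\<lambda>g. cis (\<theta> * y g) * M \<theta> (t - l g)) - E (\<lambda>g. cis (\<theta> * y g) * Z (t - l g)))"
    using M_renewal[of \<theta> t] by simp
  also have "E (\<lambda>g. cis (\<theta> * y g) * M \<theta> (t - l g)) - E (\<lambda>g. cis (\<theta> * y g) * Z (t - l g))
      = E (\<lambda>g. cis (\<theta> * y g) * (M \<theta> (t - l g) - Z (t - l g)))"
    using int1 int2 by (simp add: right_diff_distrib)
  finally have "norm (M \<theta> t - E (\<lambda>g. cis (\<theta> * y g) * Z (t - l g)))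
      \<le> norm (wsum R (\<lambda>p. cis (\<theta> * y p)) t) + norm (E (\<lambda>g. cis (\<theta> * y g) * (M \<theta> (t - l g) - Z (t - l g))))"
    by (simp add: norm_triangle_ineq)
  also have "norm (wsum R (\<lambda>p. cis (\<theta> * y p)) t) \<le> wsum R (\<lambda>_. 1) t"
    by (rule wsum_norm_le) simp
  also have "norm (E (\<lambda>g. cis (\<theta> * y g) * (M \<theta> (t - l g) - Z (t - l g)))) \<le> E (\<lambda>g. G (t - l g) - V (t - l g))"
  proof (rule order_trans[OF integral_norm_bound], rule integral_mono)
    have "integrable (measure_pmf D) (\<lambda>g. cis (\<theta> * y g) * (M \<theta> (t - l g) - Z (t - l g)))"
      using Bochner_Integration.integrable_diff[OF int1 int2] by (simp add: right_diff_distrib)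
    then show "integrable (measure_pmf D) (\<lambda>g. norm (cis (\<theta> * y g) * (M \<theta> (t - l g) - Z (t - l g))))"
      by (rule integrable_norm)
    show "integrable (measure_pmf D) (\<lambda>g. G (t - l g) - V (t - l g))"
      using int3 int4 by (rule Bochner_Integration.integrable_diff)
    show "norm (cis (\<theta> * y g) * (M \<theta> (t - l g) - Z (t - l g))) \<le> G (t - l g) - V (t - l g)" for g
      using Suc[of "t - l g"] by (simp add: norm_mult Z_def V_def)
  qed
  also have "E (\<lambda>g. G (t - l g) - V (t - l g)) = E (\<lambda>g. G (t - l g)) - E (\<lambda>g. V (t - l g))"
    using int3 int4 by simp
  also have "wsum R (\<lambda>_. 1) t + (E (\<lambda>g. G (t - l g)) - E (\<lambda>g. V (t - l g))) = G t - E (\<lambda>g. V (t - l g))"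
    using G_renewal[of t] by simp
  finally show ?case
    unfolding Zs Vs by simp
qed

text \<open>Phases of paths with cost below \<open>K\<close> differ from 1 by at most
  \<open>\<bar>\<theta>\<bar> * K\<close>, all others by at most 2.\<close>

lemma M_deviation:
  assumes "0 \<le> K"
  shows "norm (M \<theta> t - of_real (G t))
    \<le> \<bar>\<theta>\<bar> * K * G_bound + 2 * (exp (- h * t) * real (card {p \<in> below P t. K \<le> \<bar>y p\<bar>}))"
proof -
  have "M \<theta> t - of_real (G t) = exp (- h * t) *\<^sub>R (\<Sum>p\<in>below P t. cis (\<theta> * y p) - 1)"
    unfolding M_def wsum_def G_eq sum_subtractf scaleR_diff_right by (simp add: scaleR_conv_of_real)
  then have "norm (M \<theta> t - of_real (G t)) \<le> exp (- h * t) * (\<Sum>p\<in>below P t. norm (cis (\<theta> * y p) - 1))"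
    by (simp add: norm_sum)
  also have "\<dots> \<le> exp (- h * t) * (\<Sum>p\<in>below P t. \<bar>\<theta>\<bar> * K + 2 * indicator {p. K \<le> \<bar>y p\<bar>} p)"
  proof (intro mult_left_mono sum_mono)
    fix p
    show "norm (cis (\<theta> * y p) - 1) \<le> \<bar>\<theta>\<bar> * K + 2 * indicator {p. K \<le> \<bar>y p\<bar>} p"
    proof (cases "K \<le> \<bar>y p\<bar>")
      case True
      have "norm (cis (\<theta> * y p) - 1) \<le> 2"
        using norm_triangle_ineq4[of "cis (\<theta> * y p)" 1] by simp
      then show ?thesis using True assms by (simp add: add_increasing)
    next
      case False
      have "norm (cis (\<theta> * y p) - 1) \<le> \<bar>\<theta>\<bar> * \<bar>y p\<bar>"
        using norm_cis_minus_one[of "\<theta> * y p"] by (simp add: abs_mult)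
      also have "\<dots> \<le> \<bar>\<theta>\<bar> * K" using False by (intro mult_left_mono) auto
      finally show ?thesis using False by simp
    qed
  qed simp
  also have "\<dots> = \<bar>\<theta>\<bar> * K * G t + 2 * (exp (- h * t) * (\<Sum>p\<in>below P t. indicator {p. K \<le> \<bar>y p\<bar>} p))"
    by (simp add: sum.distrib G_eq sum_distrib_left[symmetric] algebra_simps)
  also have "(\<Sum>p\<in>below P t. indicator {p. K \<le> \<bar>y p\<bar>} p) = real (card {p \<in> below P t. K \<le> \<bar>y p\<bar>})"
    by (simp add: indicator_def sum.If_cases Int_def)
  also have "\<bar>\<theta>\<bar> * K * G t \<le> \<bar>\<theta>\<bar> * K * G_bound"
    using assms by (intro mult_left_mono G_le) auto
  finally show ?thesis by simp
qed

definition \<sigma>2 :: real where "\<sigma>2 = E (\<lambda>g. (y g)\<^sup>2)"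
definition cube_moment :: real where "cube_moment = E (\<lambda>g. \<bar>y g\<bar> ^ 3)"

lemma y_power_integrable: "integrable (measure_pmf D) (\<lambda>g. \<bar>y g\<bar> ^ k)"
proof (rule integrable_D_bound[where w = "\<lambda>g. C ^ k * l g ^ k"])
  show "integrable (measure_pmf D) (\<lambda>g. C ^ k * l g ^ k)"
    by (intro integrable_mult_right power_moment_integrable)
  show "\<bar>\<bar>y g\<bar> ^ k\<bar> \<le> C ^ k * l g ^ k" if "g \<in> L" for g
    using power_mono[OF y_le_L[OF that], of k] by (simp add: power_mult_distrib)
qed

lemma \<sigma>2_nonneg: "0 \<le> \<sigma>2"
  unfolding \<sigma>2_def by (rule Bochner_Integration.integral_nonneg) simp

lemma char_expansion:
  "norm (E (\<lambda>g. cis (u * y g)) - of_real (1 - u\<^sup>2 * \<sigma>2 / 2)) \<le> \<bar>u\<bar> ^ 3 * cube_moment / 6"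
proof -
  have y_int: "integrable (measure_pmf D) y"
    by (rule linear_integrable[OF y_le_L])
  have y2_int: "integrable (measure_pmf D) (\<lambda>g. (y g)\<^sup>2)"
    using y_power_integrable[of 2] by simp
  have c_int: "integrable (measure_pmf D) (\<lambda>g. cis (u * y g))"
    by (rule pmf_integrable_bounded[where B = 1]) simp
  define q where "q g = 1 + \<i> * complex_of_real (u * y g) - complex_of_real (u\<^sup>2 * (y g)\<^sup>2 / 2)" for g
  have q_int: "integrable (measure_pmf D) q"
    unfolding q_def using y_int y2_int
    by (intro Bochner_Integration.integrable_diff Bochner_Integration.integrable_add
        integrable_mult_right integrable_of_real integrable_divide) auto
  have "E q = 1 + \<i> * complex_of_real (u * E y) - complex_of_real (u\<^sup>2 * E (\<lambda>g. (y g)\<^sup>2) / 2)"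
    unfolding q_def using y_int y2_int
    by (subst Bochner_Integration.integral_diff) (auto simp del: of_real_mult of_real_divide of_real_power)
  then have Eq: "E q = of_real (1 - u\<^sup>2 * \<sigma>2 / 2)"
    by (simp add: y_centered \<sigma>2_def)
  have "norm (E (\<lambda>g. cis (u * y g)) - E q) = norm (E (\<lambda>g. cis (u * y g) - q g))"
    using c_int q_int by simp
  also have "\<dots> \<le> E (\<lambda>g. norm (cis (u * y g) - q g))"
    by (rule integral_norm_bound)
  also have "\<dots> \<le> E (\<lambda>g. \<bar>u\<bar> ^ 3 / 6 * \<bar>y g\<bar> ^ 3)"
  proof (rule integral_mono)
    show "integrable (measure_pmf D) (\<lambda>g. norm (cis (u * y g) - q g))"
      by (intro integrable_norm Bochner_Integration.integrable_diff c_int q_int)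
    show "integrable (measure_pmf D) (\<lambda>g. \<bar>u\<bar> ^ 3 / 6 * \<bar>y g\<bar> ^ 3)"
      by (intro integrable_mult_right y_power_integrable)
    fix g
    have "(\<Sum>k\<le>2. (\<i> * complex_of_real (u * y g)) ^ k / fact k) = q g"
      by (simp add: q_def numeral_2_eq_2 power_mult_distrib)
    then have "norm (cis (u * y g) - q g) \<le> \<bar>u * y g\<bar> ^ 3 / fact 3"
      using iexp_approx1[of "u * y g" 2] by (simp only: cis_conv_exp eval_nat_numeral)
    then show "norm (cis (u * y g) - q g) \<le> \<bar>u\<bar> ^ 3 / 6 * \<bar>y g\<bar> ^ 3"
      by (simp add: abs_mult power_mult_distrib fact_numeral)
  qed
  finally show ?thesis by (simp add: Eq cube_moment_def)
qed

text \<open>At \<open>\<tau> / sqrt T\<close> the characteristic function of one loop agrees with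
  the Gaussian factor up to order \<open>T powr (-3/2)\<close>. As both have modulus at most 1,
  raising them to the power \<open>n T\<close> multiplies the error by at most \<open>n T\<close>,
  which is of order \<open>T\<close>.\<close>

lemma char_power_limit:
  fixes n :: "real \<Rightarrow> nat"
  assumes n: "((\<lambda>T. real (n T) / T) \<longlongrightarrow> 1 / m) at_top"
  shows "((\<lambda>T. E (\<lambda>g. cis (\<tau> / sqrt T * y g)) ^ n T) \<longlongrightarrow> of_real (exp (- (\<tau>\<^sup>2 * \<sigma>2 / (2 * m))))) at_top"
proof -
  define \<phi> where "\<phi> u = E (\<lambda>g. cis (u * y g))" for u
  define u where "u T = \<tau> / sqrt T" for T
  define b where "b T = exp (- ((u T)\<^sup>2 * \<sigma>2 / 2))" for T
  have \<phi>_le: "norm (\<phi> v) \<le> 1" for v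
    unfolding \<phi>_def
    by (rule order_trans[OF integral_norm_bound]) simp
  have close: "norm (\<phi> v - of_real (exp (- (v\<^sup>2 * \<sigma>2 / 2)))) \<le> \<bar>v\<bar> ^ 3 * cube_moment / 6 + v ^ 4 * \<sigma>2\<^sup>2 / 8" for v
  proof -
    have nn: "0 \<le> v\<^sup>2 * \<sigma>2 / 2" using \<sigma>2_nonneg by simp
    have "\<bar>(1 - v\<^sup>2 * \<sigma>2 / 2) - exp (- (v\<^sup>2 * \<sigma>2 / 2))\<bar> \<le> (v\<^sup>2 * \<sigma>2 / 2)\<^sup>2 / 2"
      using exp_minus_quadratic[OF nn] exp_ge_add_one_self[of "- (v\<^sup>2 * \<sigma>2 / 2)"] by simp
    then have "norm (complex_of_real (1 - v\<^sup>2 * \<sigma>2 / 2) - of_real (exp (- (v\<^sup>2 * \<sigma>2 / 2)))) \<le> v ^ 4 * \<sigma>2\<^sup>2 / 8"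
      unfolding of_real_diff[symmetric] norm_of_real
      by (simp add: power_mult_distrib power_divide flip: power_mult)
    with char_expansion[of v] show ?thesis
      unfolding \<phi>_def by (meson add_mono norm_diff_triangle_le order_refl)
  qed
  have u2: "eventually (\<lambda>T. (u T)\<^sup>2 = \<tau>\<^sup>2 / T) at_top"
    using eventually_gt_at_top[of 0] by eventually_elim (simp add: u_def power_divide)
  have diff0: "((\<lambda>T. \<phi> (u T) ^ n T - of_real (b T) ^ n T) \<longlongrightarrow> 0) at_top"
  proof (rule Lim_null_comparison)
    show "\<forall>\<^sub>F T in at_top. norm (\<phi> (u T) ^ n T - of_real (b T) ^ n T)
        \<le> real (n T) / T * (\<bar>\<tau>\<bar> ^ 3 * cube_moment / 6 * (1 / sqrt T) + \<tau> ^ 4 * \<sigma>2\<^sup>2 / 8 * (1 / T))"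
      using eventually_gt_at_top[of 0]
    proof eventually_elim
      case (elim T)
      have "norm (\<phi> (u T) ^ n T - of_real (b T) ^ n T) \<le> real (n T) * norm (\<phi> (u T) - of_real (b T))"
        by (rule norm_power_diff) (use \<phi>_le \<sigma>2_nonneg in \<open>auto simp: b_def\<close>)
      also have "\<dots> \<le> real (n T) * (\<bar>u T\<bar> ^ 3 * cube_moment / 6 + u T ^ 4 * \<sigma>2\<^sup>2 / 8)"
        unfolding b_def by (intro mult_left_mono close) simp
      also have "\<bar>u T\<bar> ^ 3 = \<bar>\<tau>\<bar> ^ 3 * (1 / sqrt T) / T"
      proof -
        have "sqrt T ^ 3 = T * sqrt T" using elim by (simp add: power3_eq_cube)
        then show ?thesis using elim by (simp add: u_def power_divide)
      qed
      also have "u T ^ 4 = \<tau> ^ 4 * (1 / T) / T"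
      proof -
        have "sqrt T ^ 4 = (sqrt T ^ 2) ^ 2" by (simp flip: power_mult)
        then have "sqrt T ^ 4 = T * T" using elim by (simp add: power2_eq_square)
        then show ?thesis by (simp add: u_def power_divide)
      qed
      finally show ?case by (simp add: algebra_simps add_divide_distrib)
    qed
    have "((\<lambda>T. 1 / sqrt T) \<longlongrightarrow> 0) at_top" by real_asymp
    moreover have "((\<lambda>T::real. 1 / T) \<longlongrightarrow> 0) at_top" by real_asymp
    ultimately have "((\<lambda>T. real (n T) / T * (\<bar>\<tau>\<bar> ^ 3 * cube_moment / 6 * (1 / sqrt T) + \<tau> ^ 4 * \<sigma>2\<^sup>2 / 8 * (1 / T)))
        \<longlongrightarrow> 1 / m * (\<bar>\<tau>\<bar> ^ 3 * cube_moment / 6 * 0 + \<tau> ^ 4 * \<sigma>2\<^sup>2 / 8 * 0)) at_top"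
      by (intro tendsto_intros n)
    then show "((\<lambda>T. real (n T) / T * (\<bar>\<tau>\<bar> ^ 3 * cube_moment / 6 * (1 / sqrt T) + \<tau> ^ 4 * \<sigma>2\<^sup>2 / 8 * (1 / T))) \<longlongrightarrow> 0) at_top"
      by simp
  qed
  have "((\<lambda>T. exp (- (\<tau>\<^sup>2 * \<sigma>2 / 2 * (real (n T) / T)))) \<longlongrightarrow> exp (- (\<tau>\<^sup>2 * \<sigma>2 / 2 * (1 / m)))) at_top"
    by (intro tendsto_intros n)
  then have "((\<lambda>T. exp (- (\<tau>\<^sup>2 * \<sigma>2 / 2 * (real (n T) / T)))) \<longlongrightarrow> exp (- (\<tau>\<^sup>2 * \<sigma>2 / (2 * m)))) at_top"
    by simp
  moreover have "eventually (\<lambda>T. exp (- (\<tau>\<^sup>2 * \<sigma>2 / 2 * (real (n T) / T))) = b T ^ n T) at_top"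
    using u2 by eventually_elim (simp add: b_def exp_of_nat_mult[symmetric] algebra_simps)
  ultimately have "((\<lambda>T. b T ^ n T) \<longlongrightarrow> exp (- (\<tau>\<^sup>2 * \<sigma>2 / (2 * m)))) at_top"
    by (rule Lim_transform_eventually)
  then have "((\<lambda>T. complex_of_real (b T ^ n T)) \<longlongrightarrow> of_real (exp (- (\<tau>\<^sup>2 * \<sigma>2 / (2 * m))))) at_top"
    by (rule tendsto_of_real)
  from tendsto_add[OF diff0 this] show ?thesis
    by (simp add: \<phi>_def u_def)
qed

text \<open>The first \<open>n T\<close> loops use up all of the length \<open>T\<close> but a remainder of order
  \<open>T\<^bsup>3/5\<^esup>\<close>: this exceeds the fluctuations of their total length, which are of order \<open>T\<^bsup>1/2\<^esup>\<close>, while the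
  cost collected along the remainder is only of order \<open>T\<^bsup>3/10\<^esup>\<close>.\<close>

theorem M_limit:
  "((\<lambda>T. M (\<tau> / sqrt T) T) \<longlongrightarrow> of_real (G_infinity * exp (- (\<tau>\<^sup>2 * \<sigma>2 / (2 * m))))) at_top"
proof -
  obtain \<kappa> \<theta>0 A where \<kappa>: "0 < \<kappa>" and \<theta>0: "0 < \<theta>0" and A: "0 \<le> A"
    and tail: "\<And>\<theta> t K. 0 < \<theta> \<Longrightarrow> \<theta> \<le> \<theta>0 \<Longrightarrow>
      exp (- h * t) * real (card {p \<in> below P t. K \<le> \<bar>y p\<bar>}) \<le> A / \<theta>\<^sup>2 * exp (\<kappa> * \<theta>\<^sup>2 * t - \<theta> * K)"
    using tail_bound by blast
  define a :: "real \<Rightarrow> real" where "a T = T powr (3/5)" for T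
  \<comment> \<open>On average \<open>n T\<close> loops stay about \<open>2 * a T\<close> below
    \<open>T\<close>; fluctuations of at most \<open>a T / 2\<close> and the rounding then leave a
    remainder between \<open>a T\<close> and \<open>3 * a T\<close>.\<close>
  define n where "n T = nat \<lfloor>(T - 2 * a T) / m\<rfloor>" for T
  \<comment> \<open>Lies between the order \<open>T powr (3/10)\<close> of the cost of the remainder
    and \<open>sqrt T\<close>: larger costs are negligible, while
    \<open>\<tau> / sqrt T * K T\<close> still tends to 0.\<close>
  define K :: "real \<Rightarrow> real" where "K T = T powr (9/20)" for T
  define e2 where "e2 T = \<bar>\<tau> / sqrt T\<bar> * K T * G_bound + 2 * (A * (T powr (3/5) * exp (3 * \<kappa> - T powr (3/20))))" for T
  \<comment> \<open>For \<open>T > 0\<close> these are the deviations of the total loop length by at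
    least \<open>a T / 2\<close>, written with the Chernoff parameter
    \<open>T powr (-1/2)\<close>.\<close>
  define bad where "bad T = {p. T powr (1/10) / 2 \<le> T powr (-1/2) * \<bar>l p - real (n T) * m\<bar>}" for T
  define e3 where "e3 T = 2 * exp (length_exp_const / m - T powr (1/10) / 2)" for T :: real
  have ev_n: "eventually (\<lambda>T. 0 < T \<and> m \<le> a T / 2 \<and> 2 * a T < T) at_top"
  proof -
    have "filterlim (\<lambda>T::real. T powr (3/5) / 2) at_top at_top" by real_asymp
    then have "eventually (\<lambda>T. m \<le> T powr (3/5) / 2) at_top" by (simp add: filterlim_at_top)
    moreover have "eventually (\<lambda>T::real. 2 * T powr (3/5) < T) at_top" by real_asymp
    ultimately show ?thesis
      using eventually_gt_at_top[of 0] unfolding a_def by eventually_elim auto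
  qed
  have n_bounds: "T - 2 * a T - m < real (n T) * m \<and> real (n T) * m \<le> T - 2 * a T"
    if "2 * a T < T" for T
  proof -
    have "0 \<le> (T - 2 * a T) / m" using that m_pos by simp
    then have "real (n T) = of_int \<lfloor>(T - 2 * a T) / m\<rfloor>" by (simp add: n_def)
    then have "real (n T) \<le> (T - 2 * a T) / m" "(T - 2 * a T) / m < real (n T) + 1" by linarith+
    then show ?thesis
      using m_pos by (simp add: pos_le_divide_eq pos_divide_less_eq algebra_simps)
  qed
  have n_lim: "((\<lambda>T. real (n T) / T) \<longlongrightarrow> 1 / m) at_top"
  proof (rule tendsto_sandwich)
    show "\<forall>\<^sub>F T in at_top. (1 - 2 * a T / T - m / T) / m \<le> real (n T) / T"
      using ev_n
    proof eventually_elim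
      case (elim T)
      then have "T - 2 * a T - m \<le> real (n T) * m" using n_bounds[of T] by auto
      then have "(T - 2 * a T - m) / T \<le> real (n T) * m / T"
        using elim by (intro divide_right_mono) auto
      then have "1 - 2 * a T / T - m / T \<le> real (n T) / T * m"
        using elim by (simp add: diff_divide_distrib)
      then show ?case using m_pos by (simp add: pos_divide_le_eq)
    qed
    show "\<forall>\<^sub>F T in at_top. real (n T) / T \<le> 1 / m"
      using ev_n
    proof eventually_elim
      case (elim T)
      then have "real (n T) * m \<le> T" using n_bounds[of T] by (auto simp: a_def)
      then show ?case using elim m_pos by (simp add: field_simps)
    qed
    have "((\<lambda>T::real. 2 * T powr (3/5) / T) \<longlongrightarrow> 0) at_top" by real_asymp
    moreover have "((\<lambda>T. m / T) \<longlongrightarrow> 0) at_top"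
      by (rule tendsto_divide_0[OF tendsto_const]) (simp add: filterlim_at_top_imp_at_infinity filterlim_ident)
    ultimately have "((\<lambda>T. (1 - 2 * a T / T - m / T) / m) \<longlongrightarrow> (1 - 0 - 0) / m) at_top"
      unfolding a_def using m_pos by (intro tendsto_intros) auto
    then show "((\<lambda>T. (1 - 2 * a T / T - m / T) / m) \<longlongrightarrow> 1 / m) at_top" by simp
  qed auto
  have char_lim: "((\<lambda>T. G_infinity * EW (n T) (\<lambda>p. cis (\<tau> / sqrt T * y p)))
      \<longlongrightarrow> of_real G_infinity * of_real (exp (- (\<tau>\<^sup>2 * \<sigma>2 / (2 * m))))) at_top"
    unfolding walk_char by (intro tendsto_mult tendsto_const char_power_limit n_lim)
  have e2_lim: "(e2 \<longlongrightarrow> 0) at_top"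
  proof -
    have 1: "((\<lambda>T::real. T powr (9/20) / sqrt T) \<longlongrightarrow> 0) at_top" by real_asymp
    have 2: "((\<lambda>T::real. T powr (3/5) * exp (3 * \<kappa> - T powr (3/20))) \<longlongrightarrow> 0) at_top"
      using \<kappa> by real_asymp
    have "((\<lambda>T. \<bar>\<tau>\<bar> * G_bound * (T powr (9/20) / sqrt T)
        + 2 * (A * (T powr (3/5) * exp (3 * \<kappa> - T powr (3/20))))) \<longlongrightarrow> \<bar>\<tau>\<bar> * G_bound * 0 + 2 * (A * 0)) at_top"
      by (intro tendsto_intros 1 2)
    moreover have "eventually (\<lambda>T. \<bar>\<tau>\<bar> * G_bound * (T powr (9/20) / sqrt T)
        + 2 * (A * (T powr (3/5) * exp (3 * \<kappa> - T powr (3/20)))) = e2 T) at_top"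
      using eventually_gt_at_top[of 0] by eventually_elim (simp add: e2_def K_def abs_divide mult_ac)
    ultimately have "(e2 \<longlongrightarrow> \<bar>\<tau>\<bar> * G_bound * 0 + 2 * (A * 0)) at_top"
      by (rule Lim_transform_eventually)
    then show ?thesis by simp
  qed
  have e3_lim: "(e3 \<longlongrightarrow> 0) at_top"
  proof -
    have "((\<lambda>T::real. exp (- (T powr (1/10) / 2))) \<longlongrightarrow> 0) at_top" by real_asymp
    from tendsto_mult_right_zero[OF this, of "2 * exp (length_exp_const / m)"]
    have "((\<lambda>T. 2 * exp (length_exp_const / m) * exp (- (T powr (1/10) / 2))) \<longlongrightarrow> 0) at_top" .
    moreover have "(\<lambda>T. 2 * exp (length_exp_const / m) * exp (- (T powr (1/10) / 2))) = e3"
      by (rule ext) (simp only: e3_def mult.assoc exp_add[symmetric] add_uminus_conv_diff)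
    ultimately show ?thesis by simp
  qed
  have ev_small: "eventually (\<lambda>T. T powr (-3/10) \<le> \<theta>0) at_top"
  proof -
    have "((\<lambda>T::real. T powr (-3/10)) \<longlongrightarrow> 0) at_top" by real_asymp
    from order_tendstoD(2)[OF this \<theta>0] show ?thesis by eventually_elim simp
  qed
  have ev_small2: "eventually (\<lambda>T. T powr (-1/2) * length_dev_const \<le> \<epsilon> / 2) at_top"
  proof -
    have "((\<lambda>T::real. T powr (-1/2)) \<longlongrightarrow> 0) at_top" by real_asymp
    from order_tendstoD(2)[OF tendsto_mult_left_zero[OF this, of length_dev_const], of "\<epsilon> / 2"] eps_pos
    have "eventually (\<lambda>T. T powr (-1/2) * length_dev_const < \<epsilon> / 2) at_top" by simp
    then show ?thesis by eventually_elim simp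
  qed
  have ev_bad: "eventually (\<lambda>T. measure_pmf.prob (walk (n T)) (bad T) \<le> e3 T) at_top"
    using ev_small2 ev_n
  proof eventually_elim
    case (elim T)
    have "measure_pmf.prob (walk (n T)) (bad T)
        \<le> 2 * exp (real (n T) * (length_exp_const * (T powr (-1/2))\<^sup>2) - T powr (1/10) / 2)"
      unfolding bad_def by (rule walk_bad) (use elim in auto)
    also have "\<dots> \<le> e3 T"
    proof -
      have "(T powr (-1/2))\<^sup>2 = 1 / T"
        using elim by (simp add: power2_eq_square powr_add[symmetric] powr_minus_divide)
      moreover have "real (n T) / T \<le> 1 / m"
      proof -
        have "real (n T) * m \<le> T" using n_bounds[of T] elim by (auto simp: a_def)
        then show ?thesis using elim m_pos by (simp add: field_simps)
      qed
      then have "length_exp_const * (real (n T) / T) \<le> length_exp_const * (1 / m)"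
        using length_exp_const_nonneg by (rule mult_left_mono)
      ultimately show ?thesis by (simp add: e3_def mult_ac)
    qed
    finally show ?case .
  qed
  have main: "eventually (\<lambda>T. norm (M (\<tau> / sqrt T) T - G_infinity * EW (n T) (\<lambda>p. cis (\<tau> / sqrt T * y p)))
      \<le> \<bar>G T - G_infinity\<bar> + (2 * e + e2 T) + 4 * G_bound * e3 T) at_top" if e: "0 < e" for e
  proof -
    have "eventually (\<lambda>t. \<bar>G t - G_infinity\<bar> < e) at_top"
      using tendstoD[OF G_tendsto e] by (simp add: dist_real_def)
    then obtain t0 where t0: "\<And>t. t0 \<le> t \<Longrightarrow> \<bar>G t - G_infinity\<bar> < e"
      by (auto simp: eventually_at_top_linorder)
    have "filterlim a at_top at_top"
      unfolding a_def by real_asymp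
    then have "eventually (\<lambda>T. t0 \<le> a T) at_top" by (simp add: filterlim_at_top)
    then show ?thesis
      using ev_n ev_small ev_bad
    proof eventually_elim
      case (elim T)
      define \<theta> where "\<theta> = \<tau> / sqrt T"
      have T: "0 < T" "m \<le> a T / 2" "2 * a T < T" using elim by auto
      have K_nonneg: "0 \<le> K T" by (simp add: K_def)
      have good: "a T \<le> T - l p" "T - l p \<le> 3 * a T" if "p \<notin> bad T" for p
      proof -
        have "T powr (-1/2) * \<bar>l p - real (n T) * m\<bar> < T powr (1/10) / 2"
          using that by (simp add: bad_def)
        then have "T powr (1/2) * (T powr (-1/2) * \<bar>l p - real (n T) * m\<bar>) \<le> T powr (1/2) * (T powr (1/10) / 2)"
          by (intro mult_left_mono) auto
        moreover have "T powr (1/2) * T powr (-1/2) = 1" "T powr (1/2) * T powr (1/10) = a T"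
          using T by (simp_all add: a_def powr_add[symmetric])
        ultimately have "\<bar>l p - real (n T) * m\<bar> \<le> a T / 2"
          by (simp add: mult.assoc[symmetric])
        then show "a T \<le> T - l p" "T - l p \<le> 3 * a T"
          using n_bounds[OF T(3)] T(2) by linarith+
      qed
      have close: "norm (M \<theta> (T - l p) - of_real (G (T - l p))) \<le> e2 T" if "p \<notin> bad T" for p
      proof -
        \<comment> \<open>The Chernoff parameter is matched to the length of the remainder:
          \<open>b\<^sup>2 * a T = 1\<close> keeps the quadratic term bounded, while
          \<open>b * K T\<close> tends to infinity.\<close>
        define b where "b = T powr (-3/10)"
        have b: "0 < b" "b \<le> \<theta>0" using T elim by (auto simp: b_def)
        have b2: "b\<^sup>2 = T powr (- (3/5))"
          by (simp add: b_def power2_eq_square powr_add[symmetric])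
        have bK: "b * K T = T powr (3/20)"
          by (simp add: b_def K_def powr_add[symmetric])
        have b2a: "b\<^sup>2 * a T = 1"
          using T by (simp add: b2 a_def powr_add[symmetric])
        have "\<kappa> * b\<^sup>2 * (T - l p) \<le> \<kappa> * b\<^sup>2 * (3 * a T)"
          using good(2)[OF that] \<kappa> by (intro mult_left_mono) auto
        also have "\<dots> = 3 * \<kappa> * (b\<^sup>2 * a T)" by simp
        finally have le: "\<kappa> * b\<^sup>2 * (T - l p) \<le> 3 * \<kappa>" by (simp add: b2a)
        have "norm (M \<theta> (T - l p) - of_real (G (T - l p)))
            \<le> \<bar>\<theta>\<bar> * K T * G_bound + 2 * (exp (- h * (T - l p)) * real (card {q \<in> below P (T - l p). K T \<le> \<bar>y q\<bar>}))"
          by (rule M_deviation[OF K_nonneg])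
        also have "exp (- h * (T - l p)) * real (card {q \<in> below P (T - l p). K T \<le> \<bar>y q\<bar>})
            \<le> A / b\<^sup>2 * exp (\<kappa> * b\<^sup>2 * (T - l p) - b * K T)"
          by (rule tail[OF b])
        also have "\<dots> \<le> A / b\<^sup>2 * exp (3 * \<kappa> - T powr (3/20))"
        proof (rule mult_left_mono)
          show "exp (\<kappa> * b\<^sup>2 * (T - l p) - b * K T) \<le> exp (3 * \<kappa> - T powr (3/20))"
            unfolding exp_le_cancel_iff bK using le by linarith
        qed (use A in simp)
        also have "A / b\<^sup>2 = A * T powr (3/5)"
          unfolding b2 by (simp only: powr_minus_divide) simp
        finally show ?thesis by (simp add: e2_def \<theta>_def mult.assoc)
      qed
      have e2_nonneg: "0 \<le> e2 T"
        using K_nonneg G_bound_nonneg A by (simp add: e2_def)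
      have G_infinity_bd: "0 \<le> G_infinity" "G_infinity \<le> G_bound" using G_infinity_pos G_infinity_le by auto
      have bound1: "EW (n T) (\<lambda>p. \<bar>G (T - l p) - G_infinity\<bar>) \<le> e + 2 * G_bound * measure_pmf.prob (walk (n T)) (bad T)"
      proof (rule EW_le_good_bad)
        show "\<bar>G (T - l p) - G_infinity\<bar> \<le> 2 * G_bound" for p
          using G_nonneg[of "T - l p"] G_le[of "T - l p"] G_infinity_bd by linarith
        show "\<bar>G (T - l p) - G_infinity\<bar> \<le> e" if "p \<notin> bad T" for p
          using t0[of "T - l p"] good(1)[OF that] elim(1) by linarith
      qed (use e G_bound_nonneg in auto)
      have bound2: "EW (n T) (\<lambda>p. norm (M \<theta> (T - l p) - of_real G_infinity))
          \<le> (e + e2 T) + 2 * G_bound * measure_pmf.prob (walk (n T)) (bad T)"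
      proof (rule EW_le_good_bad)
        show "norm (M \<theta> (T - l p) - of_real G_infinity) \<le> 2 * G_bound" for p
          using norm_triangle_ineq4[of "M \<theta> (T - l p)" "of_real G_infinity"] norm_M_le_G_bound[of \<theta> "T - l p"] G_infinity_bd
          by simp
        show "norm (M \<theta> (T - l p) - of_real G_infinity) \<le> e + e2 T" if "p \<notin> bad T" for p
        proof -
          have "norm (complex_of_real (G (T - l p)) - of_real G_infinity) = \<bar>G (T - l p) - G_infinity\<bar>"
            by (metis norm_of_real of_real_diff)
          then have "norm (complex_of_real (G (T - l p)) - of_real G_infinity) \<le> e"
            using t0[of "T - l p"] good(1)[OF that] elim(1) by linarith
          with close[OF that] show ?thesis
            by (metis add.commute norm_diff_triangle_le)
        qed
      qed (use e e2_nonneg G_bound_nonneg in auto)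
      have intM: "integrable (measure_pmf (walk (n T))) (\<lambda>p. cis (\<theta> * y p) * M \<theta> (T - l p))"
        by (rule pmf_integrable_bounded[where B = G_bound]) (simp add: norm_mult norm_M_le_G_bound)
      have intc: "integrable (measure_pmf (walk (n T))) (\<lambda>p. cis (\<theta> * y p) * of_real G_infinity)"
        by (rule pmf_integrable_bounded[where B = G_infinity]) (use G_infinity_bd in \<open>simp add: norm_mult\<close>)
      have intG: "integrable (measure_pmf (walk (n T))) (\<lambda>p. G (T - l p))"
        by (rule pmf_integrable_bounded[where B = G_bound]) (simp add: G_abs_le)
      have "norm (EW (n T) (\<lambda>p. cis (\<theta> * y p) * M \<theta> (T - l p)) - EW (n T) (\<lambda>p. cis (\<theta> * y p) * of_real G_infinity))
          \<le> EW (n T) (\<lambda>p. norm (cis (\<theta> * y p) * M \<theta> (T - l p) - cis (\<theta> * y p) * of_real G_infinity))"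
        unfolding Bochner_Integration.integral_diff[OF intM intc, symmetric] by (rule integral_norm_bound)
      also have "\<dots> = EW (n T) (\<lambda>p. norm (M \<theta> (T - l p) - of_real G_infinity))"
        by (simp add: norm_mult flip: right_diff_distrib)
      finally have 1: "norm (EW (n T) (\<lambda>p. cis (\<theta> * y p) * M \<theta> (T - l p)) - G_infinity * EW (n T) (\<lambda>p. cis (\<theta> * y p)))
          \<le> EW (n T) (\<lambda>p. norm (M \<theta> (T - l p) - of_real G_infinity))"
        by (simp add: mult.commute)
      have "\<bar>EW (n T) (\<lambda>p. G (T - l p)) - G_infinity\<bar> = \<bar>EW (n T) (\<lambda>p. G (T - l p) - G_infinity)\<bar>"
        using intG by simp
      also have "\<dots> \<le> EW (n T) (\<lambda>p. \<bar>G (T - l p) - G_infinity\<bar>)"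
        by (rule integral_abs_bound)
      finally have 2: "G T - EW (n T) (\<lambda>p. G (T - l p)) \<le> \<bar>G T - G_infinity\<bar> + EW (n T) (\<lambda>p. \<bar>G (T - l p) - G_infinity\<bar>)"
        by linarith
      \<comment> \<open>Two errors add up: the sums left behind by the iteration, and the
        replacement of \<open>M\<close> on the remainder by \<open>G_infinity\<close>.\<close>
      have "norm (M \<theta> T - G_infinity * EW (n T) (\<lambda>p. cis (\<theta> * y p)))
          \<le> (G T - EW (n T) (\<lambda>p. G (T - l p))) + EW (n T) (\<lambda>p. norm (M \<theta> (T - l p) - of_real G_infinity))"
        using M_iterate[of \<theta> T "n T"] 1 by (rule norm_diff_triangle_le)
      also have "\<dots> \<le> \<bar>G T - G_infinity\<bar> + (2 * e + e2 T) + 4 * G_bound * measure_pmf.prob (walk (n T)) (bad T)"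
        using 2 bound1 bound2 by linarith
      also have "\<dots> \<le> \<bar>G T - G_infinity\<bar> + (2 * e + e2 T) + 4 * G_bound * e3 T"
        using elim G_bound_nonneg by (intro add_left_mono mult_left_mono) auto
      finally show ?case by (simp add: \<theta>_def)
    qed
  qed
  have rest: "((\<lambda>T. \<bar>G T - G_infinity\<bar> + e2 T + 4 * G_bound * e3 T) \<longlongrightarrow> \<bar>G_infinity - G_infinity\<bar> + 0 + 4 * G_bound * 0) at_top"
    by (intro tendsto_intros G_tendsto e2_lim e3_lim)
  have diff0: "((\<lambda>T. M (\<tau> / sqrt T) T - G_infinity * EW (n T) (\<lambda>p. cis (\<tau> / sqrt T * y p))) \<longlongrightarrow> 0) at_top"
  proof (rule tendstoI)
    fix r :: real assume r: "0 < r"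
    then have "eventually (\<lambda>T. \<bar>G T - G_infinity\<bar> + e2 T + 4 * G_bound * e3 T < r / 2) at_top"
      using order_tendstoD(2)[OF rest, of "r / 2"] by simp
    moreover have "0 < r / 4" using r by simp
    ultimately show "\<forall>\<^sub>F T in at_top.
        dist (M (\<tau> / sqrt T) T - G_infinity * EW (n T) (\<lambda>p. cis (\<tau> / sqrt T * y p))) 0 < r"
      using main[of "r / 4"] by (elim eventually_elim2[rotated]) (auto simp: dist_norm)
  qed
  from tendsto_add[OF diff0 char_lim] show ?thesis by simp
qed

end

section \<open>Averages over the paths of bounded length\<close>

context renewal begin

definition avg :: "('a list \<Rightarrow> 'b::real_vector) \<Rightarrow> real \<Rightarrow> 'b" where
  "avg f T = (1 / real (card (below P T))) *\<^sub>R (\<Sum>p\<in>below P T. f p)"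

lemma card_below_pos: "0 < T \<Longrightarrow> 0 < card (below P T)"
  by (subst card_gt_0_iff) (auto simp: below_def intro!: exI[of _ "[]"])

lemma avg_norm_le:
  fixes f :: "'a list \<Rightarrow> 'b::real_normed_vector"
  assumes "\<And>p. p \<in> below P T \<Longrightarrow> norm (f p) \<le> g p"
  shows "norm (avg f T) \<le> avg g T"
  unfolding avg_def norm_scaleR real_scaleR_def abs_divide abs_one abs_of_nat
  by (intro mult_left_mono order_trans[OF norm_sum] sum_mono assms) auto

lemma avg_diff: "avg (\<lambda>p. f p - g p) T = avg f T - avg g T"
  by (simp add: avg_def sum_subtractf scaleR_diff_right)

lemma avg_split_bound:
  assumes "0 < T" and X: "\<And>p. p \<in> below P T \<Longrightarrow> p \<notin> X \<Longrightarrow> f p \<le> a"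
    and "\<And>p. p \<in> below P T \<Longrightarrow> f p \<le> b" and "0 \<le> a" "0 \<le> b"
  shows "avg f T \<le> a + b * (real (card {p \<in> below P T. p \<in> X}) / real (card (below P T)))"
proof -
  have pos: "0 < real (card (below P T))" using card_below_pos[OF assms(1)] by simp
  have "(\<Sum>p\<in>below P T. f p) \<le> (\<Sum>p\<in>below P T. a + b * indicator X p)"
  proof (rule sum_mono)
    fix p assume p: "p \<in> below P T"
    show "f p \<le> a + b * indicator X p"
      using X[OF p] assms(3)[OF p] assms(4,5) by (cases "p \<in> X") auto
  qed
  also have "\<dots> = real (card (below P T)) * a + b * real (card {p \<in> below P T. p \<in> X})"
  proof -
    have "(\<Sum>p\<in>below P T. indicator X p) = real (card {p \<in> below P T. p \<in> X})"
      by (simp add: indicator_def sum.If_cases Int_def)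
    then show ?thesis by (simp add: sum.distrib sum_distrib_left[symmetric])
  qed
  finally have "(\<Sum>p\<in>below P T. f p) / real (card (below P T))
      \<le> (real (card (below P T)) * a + b * real (card {p \<in> below P T. p \<in> X})) / real (card (below P T))"
    using pos by (intro divide_right_mono) auto
  moreover have "below P T \<noteq> {}" using pos by force
  ultimately show ?thesis
    using pos by (simp add: avg_def add_divide_distrib)
qed

lemma card_ratio:
  assumes "0 < T"
  shows "real (card B) / real (card (below P T)) = exp (- h * T) * real (card B) / G T"
  by (simp add: G_eq)

text \<open>Paths that end well before \<open>T\<close>. Exponential growth makes them a vanishing
  proportion, and for all others the gap of at most \<open>T powr (1/4)\<close> is negligible
  against \<open>sqrt T\<close>.\<close>

definition early :: "real \<Rightarrow> 'a list set" where
  "early T = {p. l p < T - T powr (1/4)}"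

lemma early_ratio:
  "((\<lambda>T. real (card {p \<in> below P T. p \<in> early T}) / real (card (below P T))) \<longlongrightarrow> 0) at_top"
proof (rule Lim_null_comparison)
  have "eventually (\<lambda>T. 0 < G T) at_top"
    by (rule order_tendstoD(1)[OF G_tendsto G_infinity_pos])
  then show "\<forall>\<^sub>F T in at_top. norm (real (card {p \<in> below P T. p \<in> early T}) / real (card (below P T)))
      \<le> exp (- (h * T powr (1/4))) * G_bound / G T"
    using eventually_gt_at_top[of 0]
  proof eventually_elim
    case (elim T)
    have "{p \<in> below P T. p \<in> early T} \<subseteq> below P (T - T powr (1/4))"
      by (auto simp: below_def early_def)
    then have "exp (- h * T) * real (card {p \<in> below P T. p \<in> early T})
        \<le> exp (- h * T) * real (card (below P (T - T powr (1/4))))"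
      by (intro mult_left_mono of_nat_mono card_mono) auto
    also have "\<dots> = exp (- (h * T powr (1/4))) * G (T - T powr (1/4))"
    proof -
      have "exp (- h * T) = exp (- (h * T powr (1/4))) * exp (- h * (T - T powr (1/4)))"
        unfolding exp_add[symmetric] by (simp add: algebra_simps)
      then show ?thesis by (simp only: G_eq mult.assoc)
    qed
    also have "\<dots> \<le> exp (- (h * T powr (1/4))) * G_bound"
      by (intro mult_left_mono G_le) simp
    finally have "exp (- h * T) * real (card {p \<in> below P T. p \<in> early T}) / G T
        \<le> exp (- (h * T powr (1/4))) * G_bound / G T"
      using elim(1) by (intro divide_right_mono) auto
    then show ?case
      unfolding card_ratio[OF elim(2), symmetric] by simp
  qed
  have "((\<lambda>T. exp (- (h * T powr (1/4)))) \<longlongrightarrow> 0) at_top"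
    using h_pos by real_asymp
  then have "((\<lambda>T. exp (- (h * T powr (1/4))) * G_bound / G T) \<longlongrightarrow> 0 * G_bound / G_infinity) at_top"
    using G_infinity_pos by (intro tendsto_intros G_tendsto) auto
  then show "((\<lambda>T. exp (- (h * T powr (1/4))) * G_bound / G T) \<longlongrightarrow> 0) at_top" by simp
qed

end

context renewal_cost begin

text \<open>The level \<open>T powr (3/4)\<close> lies above the scale \<open>sqrt T\<close> of the
  fluctuations, where Chernoff's bound is effective, and below \<open>T\<close>, as the law of large
  numbers asks for.\<close>

lemma tail_ratio:
  "((\<lambda>T. real (card {p \<in> below P T. p \<in> {p. T powr (3/4) \<le> \<bar>y p\<bar>}}) / real (card (below P T))) \<longlongrightarrow> 0) at_top"
proof -
  obtain \<kappa> \<theta>0 A where \<kappa>: "0 < \<kappa>" and \<theta>0: "0 < \<theta>0" and A: "0 \<le> A"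
    and tail: "\<And>\<theta> t K. 0 < \<theta> \<Longrightarrow> \<theta> \<le> \<theta>0 \<Longrightarrow>
      exp (- h * t) * real (card {p \<in> below P t. K \<le> \<bar>y p\<bar>}) \<le> A / \<theta>\<^sup>2 * exp (\<kappa> * \<theta>\<^sup>2 * t - \<theta> * K)"
    using tail_bound by blast
  have "((\<lambda>T::real. T powr (-1/2)) \<longlongrightarrow> 0) at_top" by real_asymp
  from order_tendstoD(2)[OF this \<theta>0] have ev1: "eventually (\<lambda>T. T powr (-1/2) < \<theta>0) at_top" .
  have ev2: "eventually (\<lambda>T. 0 < G T) at_top"
    by (rule order_tendstoD(1)[OF G_tendsto G_infinity_pos])
  show ?thesis
  proof (rule Lim_null_comparison)
    show "\<forall>\<^sub>F T in at_top. norm (real (card {p \<in> below P T. p \<in> {p. T powr (3/4) \<le> \<bar>y p\<bar>}}) / real (card (below P T)))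
        \<le> A * (T * exp (\<kappa> - T powr (1/4))) / G T"
      using ev1 ev2 eventually_gt_at_top[of 0]
    proof eventually_elim
      case (elim T)
      define b where "b = T powr (-1/2)"
      have b: "0 < b" "b \<le> \<theta>0" using elim by (auto simp: b_def)
      have b2: "b\<^sup>2 = 1 / T"
        using elim by (simp add: b_def power2_eq_square powr_add[symmetric] powr_minus_divide)
      have bK: "b * T powr (3/4) = T powr (1/4)"
        by (simp add: b_def powr_add[symmetric])
      have "exp (- h * T) * real (card {p \<in> below P T. T powr (3/4) \<le> \<bar>y p\<bar>})
          \<le> A / b\<^sup>2 * exp (\<kappa> * b\<^sup>2 * T - b * T powr (3/4))"
        by (rule tail[OF b])
      also have "\<dots> = A * (T * exp (\<kappa> - T powr (1/4)))"
        using elim by (simp add: b2 bK)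
      finally show ?case
        unfolding card_ratio[OF elim(3)] using elim(2) by (simp add: divide_right_mono)
    qed
    have "((\<lambda>T. T * exp (\<kappa> - T powr (1/4))) \<longlongrightarrow> 0) at_top"
      using \<kappa> by real_asymp
    then have "((\<lambda>T. A * (T * exp (\<kappa> - T powr (1/4))) / G T) \<longlongrightarrow> A * 0 / G_infinity) at_top"
      using G_infinity_pos by (intro tendsto_intros G_tendsto) auto
    then show "((\<lambda>T. A * (T * exp (\<kappa> - T powr (1/4))) / G T) \<longlongrightarrow> 0) at_top" by simp
  qed
qed

lemma avg_char_limit:
  "((\<lambda>T. avg (\<lambda>p. cis (y p / sqrt T)) T) \<longlongrightarrow> of_real (exp (- (\<sigma>2 / (2 * m))))) at_top"
proof -
  have "((\<lambda>T. M (1 / sqrt T) T / of_real (G T)) \<longlongrightarrow> of_real (G_infinity * exp (- (1\<^sup>2 * \<sigma>2 / (2 * m)))) / of_real G_infinity) at_top"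
    using G_infinity_pos by (intro tendsto_divide M_limit tendsto_of_real G_tendsto) auto
  moreover have "eventually (\<lambda>T. M (1 / sqrt T) T / of_real (G T) = avg (\<lambda>p. cis (y p / sqrt T)) T) at_top"
    by (intro always_eventually allI) (simp add: M_def wsum_def avg_def G_eq scaleR_conv_of_real)
  ultimately show ?thesis
    using G_infinity_pos by (auto dest: Lim_transform_eventually)
qed

end

section \<open>Vector-valued costs\<close>

locale renewal_vector = renewal +
  fixes w :: "'a list \<Rightarrow> 'b::euclidean_space" and C :: real
  assumes w_append: "w (p @ q) = w p + w q"
    and w_le: "p \<in> P \<Longrightarrow> norm (w p) \<le> C * l p"
    and C_nonneg: "0 \<le> C"
begin

text \<open>Mean cost of a loop per unit of mean length, as in the renewal reward theorem; it will
  turn out to be the vector of asymptotic averages.\<close>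

definition drift :: 'b where
  "drift = (1 / m) *\<^sub>R E w"

definition z :: "'a list \<Rightarrow> 'b" where
  "z p = w p - l p *\<^sub>R drift"

lemma w_integrable: "integrable (measure_pmf D) w"
proof (rule Bochner_Integration.integrable_bound)
  show "integrable (measure_pmf D) (\<lambda>g. C * l g)" using l_integrable by simp
  have "norm (w g) \<le> norm (C * l g)" if "g \<in> L" for g
    using w_le[of g] L_subset that by force
  then show "AE g in measure_pmf D. norm (w g) \<le> norm (C * l g)" by (simp add: AE_D)
qed simp

lemma z_le: "p \<in> P \<Longrightarrow> norm (z p) \<le> (C + norm drift) * l p"
proof -
  assume p: "p \<in> P"
  have "norm (z p) \<le> norm (w p) + l p * norm drift"
    unfolding z_def using norm_triangle_ineq4[of "w p" "l p *\<^sub>R drift"] l_nonneg[OF p] by simp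
  with w_le[OF p] show "norm (z p) \<le> (C + norm drift) * l p"
    by (simp add: distrib_right mult.commute[of "norm drift"])
qed

lemma z_cost: "renewal_cost L R P l h \<epsilon> l0 (\<lambda>p. t \<bullet> z p) (norm t * (C + norm drift))"
proof unfold_locales
  show "t \<bullet> z (p @ q) = t \<bullet> z p + t \<bullet> z q" for p q
    by (simp add: z_def w_append l_append scaleR_left_distrib inner_diff_right inner_add_right)
  show "\<bar>t \<bullet> z p\<bar> \<le> norm t * (C + norm drift) * l p" if "p \<in> P" for p
    using Cauchy_Schwarz_ineq2[of t "z p"] mult_left_mono[OF z_le[OF that], of "norm t"]
    by (simp add: mult.assoc)
  show "0 \<le> norm t * (C + norm drift)" using C_nonneg by simp
  have "E (\<lambda>g. t \<bullet> z g) = t \<bullet> E w - m * (t \<bullet> drift)"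
    unfolding z_def inner_diff_right using w_integrable l_integrable
    by (subst Bochner_Integration.integral_diff) (auto simp: m_def)
  also have "\<dots> = 0" using m_pos by (simp add: drift_def)
  finally show "E (\<lambda>g. t \<bullet> z g) = 0" .
qed

text \<open>\<open>w p\<close> differs from \<open>T *\<^sub>R drift\<close> by the centred cost
  \<open>z p\<close> and by \<open>(T - l p) *\<^sub>R drift\<close>. Divided by \<open>T\<close>,
  both are small outside sets of vanishing proportion and bounded on all paths below
  \<open>T\<close>, so their averages vanish in the limit.\<close>

lemma drift_limit:
  "((\<lambda>T. avg (\<lambda>p. (1 / T) *\<^sub>R w p) T) \<longlongrightarrow> drift) at_top"
proof (subst tendsto_componentwise_iff, intro ballI)
  fix b :: 'b assume "b \<in> Basis"
  interpret y: renewal_cost L R P l h \<epsilon> l0 "\<lambda>p. b \<bullet> z p" "norm b * (C + norm drift)"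
    by (rule z_cost)
  define CC where "CC = norm b * (C + norm drift)"
  define r1 where "r1 T = real (card {p \<in> below P T. p \<in> {p. T powr (3/4) \<le> \<bar>b \<bullet> z p\<bar>}}) / real (card (below P T))" for T
  define r2 where "r2 T = real (card {p \<in> below P T. p \<in> early T}) / real (card (below P T))" for T
  have "((\<lambda>T. avg (\<lambda>p. (1 / T) *\<^sub>R w p) T \<bullet> b - drift \<bullet> b) \<longlongrightarrow> 0) at_top"
  proof (rule Lim_null_comparison)
    show "\<forall>\<^sub>F T in at_top. norm (avg (\<lambda>p. (1 / T) *\<^sub>R w p) T \<bullet> b - drift \<bullet> b)
        \<le> (T powr (3/4) / T + CC * r1 T) + (\<bar>b \<bullet> drift\<bar> * (T powr (1/4) / T) + \<bar>b \<bullet> drift\<bar> * r2 T)"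
      using eventually_gt_at_top[of 0]
    proof eventually_elim
      case (elim T)
      have N: "0 < real (card (below P T))" using card_below_pos[OF elim] by simp
      have "avg (\<lambda>p. (1 / T) *\<^sub>R w p) T \<bullet> b - drift \<bullet> b = avg (\<lambda>p. (b \<bullet> z p - (T - l p) * (b \<bullet> drift)) / T) T"
      proof -
        have "drift \<bullet> b = avg (\<lambda>p. b \<bullet> drift) T"
          using N by (auto simp: avg_def inner_commute)
        moreover have "avg (\<lambda>p. (1 / T) *\<^sub>R w p) T \<bullet> b = avg (\<lambda>p. (b \<bullet> w p) / T) T"
          by (simp add: avg_def inner_commute[of _ b] inner_sum_right)
        ultimately have "avg (\<lambda>p. (1 / T) *\<^sub>R w p) T \<bullet> b - drift \<bullet> b = avg (\<lambda>p. b \<bullet> w p / T - b \<bullet> drift) T"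
          by (simp only: avg_diff)
        also have "(\<lambda>p. b \<bullet> w p / T - b \<bullet> drift) = (\<lambda>p. (b \<bullet> z p - (T - l p) * (b \<bullet> drift)) / T)"
          using elim by (auto simp: z_def inner_diff_right field_simps)
        finally show ?thesis .
      qed
      also have "norm \<dots> \<le> avg (\<lambda>p. \<bar>b \<bullet> z p\<bar> / T + \<bar>b \<bullet> drift\<bar> * ((T - l p) / T)) T"
      proof (rule avg_norm_le)
        fix p assume "p \<in> below P T"
        then have "0 \<le> T - l p" by (simp add: below_def)
        then have "\<bar>b \<bullet> z p - (T - l p) * (b \<bullet> drift)\<bar> \<le> \<bar>b \<bullet> z p\<bar> + (T - l p) * \<bar>b \<bullet> drift\<bar>"
          using abs_triangle_ineq4[of "b \<bullet> z p" "(T - l p) * (b \<bullet> drift)"] by (simp add: abs_mult)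
        then show "norm ((b \<bullet> z p - (T - l p) * (b \<bullet> drift)) / T) \<le> \<bar>b \<bullet> z p\<bar> / T + \<bar>b \<bullet> drift\<bar> * ((T - l p) / T)"
          using elim by (simp add: divide_right_mono add_divide_distrib[symmetric] mult.commute)
      qed
      also have "\<dots> = avg (\<lambda>p. \<bar>b \<bullet> z p\<bar> / T) T + avg (\<lambda>p. \<bar>b \<bullet> drift\<bar> * ((T - l p) / T)) T"
        by (simp add: avg_def sum.distrib distrib_left)
      also have "avg (\<lambda>p. \<bar>b \<bullet> z p\<bar> / T) T \<le> T powr (3/4) / T + CC * r1 T"
        unfolding r1_def
      proof (rule avg_split_bound[OF elim])
        show "\<bar>b \<bullet> z p\<bar> / T \<le> T powr (3/4) / T" if "p \<notin> {p. T powr (3/4) \<le> \<bar>b \<bullet> z p\<bar>}" for p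
          using that elim by (intro divide_right_mono) auto
        show "\<bar>b \<bullet> z p\<bar> / T \<le> CC" if p: "p \<in> below P T" for p
        proof -
          have "\<bar>b \<bullet> z p\<bar> \<le> CC * l p" using y.y_le[of p] p by (simp add: below_def CC_def)
          also have "\<dots> \<le> CC * T"
            using p y.C_nonneg unfolding CC_def[symmetric] by (intro mult_left_mono) (auto simp: below_def)
          finally show ?thesis using elim by (simp add: pos_divide_le_eq)
        qed
      qed (use elim y.C_nonneg in \<open>auto simp: CC_def\<close>)
      also have "avg (\<lambda>p. \<bar>b \<bullet> drift\<bar> * ((T - l p) / T)) T \<le> \<bar>b \<bullet> drift\<bar> * (T powr (1/4) / T) + \<bar>b \<bullet> drift\<bar> * r2 T"
        unfolding r2_def
      proof (rule avg_split_bound[OF elim])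
        show "\<bar>b \<bullet> drift\<bar> * ((T - l p) / T) \<le> \<bar>b \<bullet> drift\<bar> * (T powr (1/4) / T)" if "p \<notin> early T" for p
          using that elim by (intro mult_left_mono divide_right_mono) (auto simp: early_def)
        show "\<bar>b \<bullet> drift\<bar> * ((T - l p) / T) \<le> \<bar>b \<bullet> drift\<bar>" if "p \<in> below P T" for p
          using l_nonneg[of p] that elim by (intro mult_right_le_one_le) (auto simp: below_def)
      qed (use elim in auto)
      finally show ?case by simp
    qed
    have "((\<lambda>T::real. T powr (3/4) / T) \<longlongrightarrow> 0) at_top" by real_asymp
    moreover have "((\<lambda>T::real. T powr (1/4) / T) \<longlongrightarrow> 0) at_top" by real_asymp
    moreover have "(r1 \<longlongrightarrow> 0) at_top" unfolding r1_def by (rule y.tail_ratio)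
    moreover have "(r2 \<longlongrightarrow> 0) at_top" unfolding r2_def by (rule early_ratio)
    ultimately have "((\<lambda>T. (T powr (3/4) / T + CC * r1 T) + (\<bar>b \<bullet> drift\<bar> * (T powr (1/4) / T) + \<bar>b \<bullet> drift\<bar> * r2 T))
        \<longlongrightarrow> (0 + CC * 0) + (\<bar>b \<bullet> drift\<bar> * 0 + \<bar>b \<bullet> drift\<bar> * 0)) at_top"
      by (intro tendsto_add tendsto_mult tendsto_const)
    then show "((\<lambda>T. (T powr (3/4) / T + CC * r1 T) + (\<bar>b \<bullet> drift\<bar> * (T powr (1/4) / T) + \<bar>b \<bullet> drift\<bar> * r2 T))
        \<longlongrightarrow> 0) at_top" by simp
  qed
  then show "((\<lambda>T. avg (\<lambda>p. (1 / T) *\<^sub>R w p) T \<bullet> b) \<longlongrightarrow> drift \<bullet> b) at_top"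
    by (simp add: LIM_zero_iff)
qed

text \<open>Centring at \<open>T\<close> is exchanged for centring at \<open>l p\<close>. This
  changes a phase by at most \<open>\<bar>t \<bullet> drift\<bar> * (T - l p) / sqrt T\<close>,
  which is small except on early paths.\<close>

lemma char_limit:
  "((\<lambda>T. avg (\<lambda>p. cis (t \<bullet> ((1 / sqrt T) *\<^sub>R (w p - T *\<^sub>R drift)))) T)
    \<longlongrightarrow> of_real (exp (- (E (\<lambda>g. (t \<bullet> z g)\<^sup>2) / (2 * m))))) at_top"
proof -
  interpret y: renewal_cost L R P l h \<epsilon> l0 "\<lambda>p. t \<bullet> z p" "norm t * (C + norm drift)"
    by (rule z_cost)
  define r2 where "r2 T = real (card {p \<in> below P T. p \<in> early T}) / real (card (below P T))" for T
  have "((\<lambda>T. avg (\<lambda>p. cis (t \<bullet> ((1 / sqrt T) *\<^sub>R (w p - T *\<^sub>R drift)))) T - avg (\<lambda>p. cis (t \<bullet> z p / sqrt T)) T)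
      \<longlongrightarrow> 0) at_top"
  proof (rule Lim_null_comparison)
    show "\<forall>\<^sub>F T in at_top. norm (avg (\<lambda>p. cis (t \<bullet> ((1 / sqrt T) *\<^sub>R (w p - T *\<^sub>R drift)))) T - avg (\<lambda>p. cis (t \<bullet> z p / sqrt T)) T)
        \<le> \<bar>t \<bullet> drift\<bar> * (T powr (1/4) / sqrt T) + 2 * r2 T"
      using eventually_gt_at_top[of 0]
    proof eventually_elim
      case (elim T)
      define f where "f p = norm (cis (t \<bullet> ((1 / sqrt T) *\<^sub>R (w p - T *\<^sub>R drift))) - cis (t \<bullet> z p / sqrt T))" for p
      have f_eq: "f p = norm (cis (- ((T - l p) / sqrt T * (t \<bullet> drift))) - 1)" for p
      proof -
        have "t \<bullet> ((1 / sqrt T) *\<^sub>R (w p - T *\<^sub>R drift)) = t \<bullet> z p / sqrt T + - ((T - l p) / sqrt T * (t \<bullet> drift))"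
          using elim by (simp add: z_def inner_diff_right field_simps)
        then have "cis (t \<bullet> ((1 / sqrt T) *\<^sub>R (w p - T *\<^sub>R drift))) - cis (t \<bullet> z p / sqrt T)
            = cis (t \<bullet> z p / sqrt T) * (cis (- ((T - l p) / sqrt T * (t \<bullet> drift))) - 1)"
          by (simp only: cis_mult[symmetric] right_diff_distrib mult_1_right)
        then show ?thesis by (simp add: f_def norm_mult)
      qed
      have "norm (avg (\<lambda>p. cis (t \<bullet> ((1 / sqrt T) *\<^sub>R (w p - T *\<^sub>R drift)))) T - avg (\<lambda>p. cis (t \<bullet> z p / sqrt T)) T)
          \<le> avg f T"
        unfolding avg_diff[symmetric] by (rule avg_norm_le) (simp add: f_def)
      also have "\<dots> \<le> \<bar>t \<bullet> drift\<bar> * (T powr (1/4) / sqrt T) + 2 * r2 T"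
        unfolding r2_def
      proof (rule avg_split_bound[OF elim])
        show "f p \<le> \<bar>t \<bullet> drift\<bar> * (T powr (1/4) / sqrt T)" if p: "p \<in> below P T" "p \<notin> early T" for p
        proof -
          have "f p \<le> \<bar>- ((T - l p) / sqrt T * (t \<bullet> drift))\<bar>"
            unfolding f_eq by (rule norm_cis_minus_one)
          also have "\<dots> = \<bar>t \<bullet> drift\<bar> * ((T - l p) / sqrt T)"
            using p elim by (simp add: abs_mult below_def mult.commute)
          also have "\<dots> \<le> \<bar>t \<bullet> drift\<bar> * (T powr (1/4) / sqrt T)"
            using p elim by (intro mult_left_mono divide_right_mono) (auto simp: early_def)
          finally show ?thesis .
        qed
        show "f p \<le> 2" for p
          unfolding f_eq using norm_triangle_ineq4[of "cis (- ((T - l p) / sqrt T * (t \<bullet> drift)))" 1] by simp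
      qed (use elim in auto)
      finally show ?case .
    qed
    have "((\<lambda>T::real. T powr (1/4) / sqrt T) \<longlongrightarrow> 0) at_top" by real_asymp
    moreover have "(r2 \<longlongrightarrow> 0) at_top" unfolding r2_def by (rule early_ratio)
    ultimately have "((\<lambda>T. \<bar>t \<bullet> drift\<bar> * (T powr (1/4) / sqrt T) + 2 * r2 T) \<longlongrightarrow> \<bar>t \<bullet> drift\<bar> * 0 + 2 * 0) at_top"
      by (intro tendsto_add tendsto_mult tendsto_const)
    then show "((\<lambda>T. \<bar>t \<bullet> drift\<bar> * (T powr (1/4) / sqrt T) + 2 * r2 T) \<longlongrightarrow> 0) at_top" by simp
  qed
  from tendsto_add[OF this y.avg_char_limit] show ?thesis
    by (simp add: y.\<sigma>2_def)
qed

lemma z_product_integrable: "integrable (measure_pmf D) (\<lambda>g. (s \<bullet> z g) * (t \<bullet> z g))"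
proof (rule integrable_D_bound)
  interpret s: renewal_cost L R P l h \<epsilon> l0 "\<lambda>p. s \<bullet> z p" "norm s * (C + norm drift)"
    by (rule z_cost)
  interpret t: renewal_cost L R P l h \<epsilon> l0 "\<lambda>p. t \<bullet> z p" "norm t * (C + norm drift)"
    by (rule z_cost)
  show "integrable (measure_pmf D) (\<lambda>g. \<bar>s \<bullet> z g\<bar> ^ 2 + \<bar>t \<bullet> z g\<bar> ^ 2)"
    by (intro Bochner_Integration.integrable_add s.y_power_integrable t.y_power_integrable)
  show "\<bar>(s \<bullet> z g) * (t \<bullet> z g)\<bar> \<le> \<bar>s \<bullet> z g\<bar> ^ 2 + \<bar>t \<bullet> z g\<bar> ^ 2" for g
  proof -
    have "0 \<le> (\<bar>s \<bullet> z g\<bar> - \<bar>t \<bullet> z g\<bar>)\<^sup>2" by simp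
    then have "2 * (\<bar>s \<bullet> z g\<bar> * \<bar>t \<bullet> z g\<bar>) \<le> \<bar>s \<bullet> z g\<bar> ^ 2 + \<bar>t \<bullet> z g\<bar> ^ 2"
      by (simp add: power2_diff)
    moreover have "0 \<le> \<bar>s \<bullet> z g\<bar> * \<bar>t \<bullet> z g\<bar>" by simp
    ultimately show ?thesis unfolding abs_mult by linarith
  qed
qed

text \<open>Every element of \<open>L\<close> has positive probability, so a vanishing second moment
  is a statement about all loops.\<close>

lemma variance_zero_iff: "E (\<lambda>g. (t \<bullet> z g)\<^sup>2) = 0 \<longleftrightarrow> (\<forall>g\<in>L. t \<bullet> z g = 0)"
proof -
  have "integrable (measure_pmf D) (\<lambda>g. (t \<bullet> z g)\<^sup>2)"
    using z_product_integrable[of t t] by (simp add: power2_eq_square)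
  then have "E (\<lambda>g. (t \<bullet> z g)\<^sup>2) = 0 \<longleftrightarrow> (AE g in measure_pmf D. (t \<bullet> z g)\<^sup>2 = 0)"
    by (rule integral_nonneg_eq_0_iff_AE) simp
  then show ?thesis by (simp add: AE_D)
qed

end

section \<open>First-return loops in a directed graph\<close>

lemma nn_sum_indicator:
  "(\<integral>\<^sup>+x. f x \<partial>count_space A) = (\<integral>\<^sup>+x. f x * indicator A x \<partial>count_space UNIV)"
  by (rule nn_integral_count_space_indicator) simp

lemma nn_sum_mono_set:
  assumes "A \<subseteq> B"
  shows "(\<integral>\<^sup>+x. f x \<partial>count_space A) \<le> (\<integral>\<^sup>+x. f x \<partial>count_space B)"
  unfolding nn_sum_indicator[where A = A] nn_sum_indicator[where A = B]
  by (intro nn_integral_mono mult_left_mono) (use assms in \<open>auto split: split_indicator\<close>)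

text \<open>The principle behind all estimates that extend or shorten paths: an injective recoding
  that loses at most a factor \<open>c\<close> in weight.\<close>

lemma nn_sum_inj:
  assumes inj: "inj_on \<phi> A" and sub: "\<phi> ` A \<subseteq> B"
    and le: "\<And>x. x \<in> A \<Longrightarrow> f x \<le> c * g (\<phi> x)"
  shows "(\<integral>\<^sup>+x. f x \<partial>count_space A) \<le> c * (\<integral>\<^sup>+x. g x \<partial>count_space B)"
proof -
  have "(\<integral>\<^sup>+x. f x \<partial>count_space A) \<le> (\<integral>\<^sup>+x. c * g (\<phi> x) \<partial>count_space A)"
    by (intro nn_integral_mono) (use le in auto)
  also have "\<dots> = c * (\<integral>\<^sup>+x. g (\<phi> x) \<partial>count_space A)"
    by (rule nn_integral_cmult) simp
  also have "(\<integral>\<^sup>+x. g (\<phi> x) \<partial>count_space A) = (\<integral>\<^sup>+x. g x \<partial>count_space (\<phi> ` A))"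
    by (rule nn_integral_bij_count_space) (use inj in \<open>auto simp: bij_betw_def\<close>)
  also have "\<dots> \<le> (\<integral>\<^sup>+x. g x \<partial>count_space B)"
    by (rule nn_sum_mono_set[OF sub])
  finally show ?thesis
    by (simp add: mult_left_mono)
qed

lemma nn_sum_Sigma:
  fixes f :: "'a \<times> 'b \<Rightarrow> ennreal"
  shows "(\<integral>\<^sup>+x. \<integral>\<^sup>+y. f (x, y) \<partial>count_space (B x) \<partial>count_space A) = (\<integral>\<^sup>+z. f z \<partial>count_space (Sigma A B))"
proof -
  have "(\<integral>\<^sup>+x. \<integral>\<^sup>+y. f (x, y) \<partial>count_space (B x) \<partial>count_space A)
      = (\<integral>\<^sup>+x. \<integral>\<^sup>+y. f (x, y) * indicator (Sigma A B) (x, y) \<partial>count_space UNIV \<partial>count_space UNIV)"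
    unfolding nn_sum_indicator[where A = A] nn_sum_indicator[where A = "B _"]
    by (intro nn_integral_cong) (auto split: split_indicator intro!: nn_integral_cong)
  also have "\<dots> = (\<integral>\<^sup>+z. f z * indicator (Sigma A B) z \<partial>count_space UNIV)"
    by (rule nn_integral_fst_count_space)
  finally show ?thesis by (simp add: nn_sum_indicator[where A = "Sigma A B"])
qed

lemma nn_sum_insert:
  assumes "a \<notin> A"
  shows "(\<integral>\<^sup>+x. f x \<partial>count_space (insert a A)) = f a + (\<integral>\<^sup>+x. f x \<partial>count_space A)"
proof -
  have "(\<integral>\<^sup>+x. f x \<partial>count_space (insert a A))
      = (\<integral>\<^sup>+x. f x * indicator {a} x + f x * indicator A x \<partial>count_space UNIV)"
    unfolding nn_sum_indicator[where A = "insert a A"]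
    by (intro nn_integral_cong) (use assms in \<open>auto split: split_indicator\<close>)
  also have "\<dots> = (\<integral>\<^sup>+x. f x * indicator {a} x \<partial>count_space UNIV) + (\<integral>\<^sup>+x. f x * indicator A x \<partial>count_space UNIV)"
    by (rule nn_integral_add) auto
  also have "(\<integral>\<^sup>+x. f x * indicator {a} x \<partial>count_space UNIV) = f a"
    by (subst nn_integral_indicator_singleton) auto
  finally show ?thesis by (simp add: nn_sum_indicator[where A = A])
qed

section \<open>Connectivity and the factorisation of paths at the base vertex\<close>

locale based_digraph = length_digraph G len
  for G :: "('v, 'e) pre_digraph" and len :: "'e \<Rightarrow> real" +
  fixes v :: 'v
  assumes v_verts: "v \<in> verts G"
begin

lemma path_sum_len_nonneg: "awalk u p w \<Longrightarrow> 0 \<le> path_sum len p"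
  by (induction p arbitrary: u) (auto simp: awalk_Cons_iff intro!: add_nonneg_nonneg less_imp_le[OF len_pos])

definition avoid :: "'v \<Rightarrow> 'e list set" where
  "avoid u = {p. (\<exists>w. awalk u p w) \<and> v \<notin> head G ` set p}"

definition first_loops :: "'e list set" where
  "first_loops = {g. awalk v g v \<and> g \<noteq> [] \<and> v \<notin> head G ` set (butlast g)}"

definition paths :: "'e list set" where
  "paths = {p. \<exists>w. awalk v p w}"

text \<open>With a single edge, all closed paths would have lengths in the multiples of
  \<open>len e\<close>, contrary to (G3). A second edge makes it possible to apply (G2) to distinct
  edges.\<close>

lemma another_arc:
  assumes "e \<in> arcs G"
  obtains e' where "e' \<in> arcs G" "e' \<noteq> e"
proof -
  have False if only: "\<forall>e'\<in>arcs G. e' = e"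
  proof -
    have sum: "path_sum len p = len e * real (length p)" if "set p \<subseteq> {e}" for p
      using that by (induction p) (auto simp: algebra_simps)
    have "{path_sum len p | p. closed_w p} \<subseteq> {len e * real k | k. True}"
    proof
      fix x assume "x \<in> {path_sum len p | p. closed_w p}"
      then obtain p u where "x = path_sum len p" "awalk u p u" by (auto simp: closed_w_def)
      moreover from this have "set p \<subseteq> {e}" using only by (auto simp: awalk_def)
      ultimately show "x \<in> {len e * real k | k. True}" using sum by auto
    qed
    with G3 len_pos[OF assms] show False by blast
  qed
  then show thesis using that by blast
qed

text \<open>Removing the first and the last edge from the path in (G2) leaves a connection of
  uniformly bounded length. The edges have to be distinct, as otherwise that path may consist of the
  one edge alone.\<close>

lemma connect:
  obtains C where "0 < C" "\<And>e e'. e \<in> arcs G \<Longrightarrow> e' \<in> arcs G \<Longrightarrow> e \<noteq> e' \<Longrightarrow>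
    \<exists>q. awalk (head G e) q (tail G e') \<and> path_sum len q < C"
proof -
  obtain C where C: "0 < C" "\<And>e e'. e \<in> arcs G \<Longrightarrow> e' \<in> arcs G \<Longrightarrow> \<exists>u p w.
      awalk u p w \<and> p \<noteq> [] \<and> hd p = e \<and> last p = e' \<and> path_sum len p < C + len e + len e'"
    using G2 by blast
  have "\<exists>q. awalk (head G e) q (tail G e') \<and> path_sum len q < C"
    if e: "e \<in> arcs G" "e' \<in> arcs G" "e \<noteq> e'" for e e'
  proof -
    obtain u p w where p: "awalk u p w" "p \<noteq> []" "hd p = e" "last p = e'"
      "path_sum len p < C + len e + len e'"
      using C(2)[OF e(1,2)] by blast
    obtain p' where p': "p = e # p'" using p by (cases p) auto
    with p e have "p' \<noteq> []" "last p' = e'" by (auto split: if_splits)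
    then obtain q where "p' = q @ [e']" by (metis append_butlast_last_id)
    with p p' have "awalk (head G e) q (tail G e')" "path_sum len q < C"
      by (auto simp: awalk_Cons_iff)
    then show ?thesis by blast
  qed
  with C(1) that show thesis by blast
qed

text \<open>If only an outgoing edge is at hand, a connection from another edge \<open>e'\<close> to
  it ends at \<open>x\<close>, either with an edge of its own or, when it is empty, with
  \<open>e'\<close>.\<close>

lemma in_arc:
  assumes "x \<in> verts G"
  obtains e where "e \<in> arcs G" "head G e = x"
proof -
  obtain e where e: "e \<in> arcs G" "tail G e = x \<or> head G e = x" using incident[OF assms] by blast
  show thesis
  proof (cases "head G e = x")
    case True
    then show thesis using that e by blast
  next
    case False
    obtain e' where e': "e' \<in> arcs G" "e' \<noteq> e" using another_arc[OF e(1)] .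
    obtain q where q: "awalk (head G e') q x"
      using connect e e' False by metis
    show thesis
    proof (cases q rule: rev_cases)
      case Nil
      then show thesis using q e' that by (auto simp: awalk_Nil_iff)
    next
      case (snoc q' f)
      then show thesis using q that[of f] by (auto simp: awalk_Cons_iff awalk_Nil_iff)
    qed
  qed
qed

lemma out_arc:
  assumes "x \<in> verts G"
  obtains e where "e \<in> arcs G" "tail G e = x"
proof -
  obtain e where e: "e \<in> arcs G" "tail G e = x \<or> head G e = x" using incident[OF assms] by blast
  show thesis
  proof (cases "tail G e = x")
    case True
    then show thesis using that e by blast
  next
    case False
    obtain e' where e': "e' \<in> arcs G" "e' \<noteq> e" using another_arc[OF e(1)] .
    obtain q where q: "awalk x q (tail G e')"
      using connect e e' False by metis
    show thesis
    proof (cases q)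
      case Nil
      then show thesis using q e' that by (auto simp: awalk_Nil_iff)
    next
      case (Cons f q')
      then show thesis using q that[of f] by (auto simp: awalk_Cons_iff)
    qed
  qed
qed

lemma walk_exists:
  assumes "x \<in> verts G" "z \<in> verts G"
  obtains q where "awalk x q z" "q \<noteq> []"
proof -
  obtain f where f: "f \<in> arcs G" "tail G f = x" using out_arc[OF assms(1)] .
  obtain e where e: "e \<in> arcs G" "head G e = z" using in_arc[OF assms(2)] .
  show thesis
  proof (cases "f = e")
    case True
    then have "awalk x [f] z" using e f assms by (auto simp: awalk_Cons_iff awalk_Nil_iff)
    then show thesis using that by blast
  next
    case False
    obtain q where "awalk (head G f) q (tail G e)"
      using connect f e False by metis
    then have "awalk x (f # q @ [e]) z"
      using e f assms by (auto simp: awalk_Cons_iff awalk_Nil_iff)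
    then show thesis using that by blast
  qed
qed

lemma first_passage_prefix:
  assumes "awalk x q v" "q \<noteq> []"
  obtains q1 q2 where "q = q1 @ q2" "awalk x q1 v" "q1 \<noteq> []" "v \<notin> head G ` set (butlast q1)" "awalk v q2 v"
proof -
  have "\<exists>e\<in>set q. head G e = v"
    using assms by (cases q rule: rev_cases) (auto simp: awalk_Cons_iff awalk_Nil_iff)
  then obtain ys e zs where s: "q = ys @ e # zs" "head G e = v" "\<forall>e\<in>set ys. head G e \<noteq> v"
    using split_list_first_prop[of q "\<lambda>e. head G e = v"] by blast
  have w: "awalk x (ys @ [e]) v" "awalk v zs v"
    using assms(1) s v_verts by (auto simp: awalk_Cons_iff awalk_Nil_iff)
  show thesis
    by (rule that[of "ys @ [e]" zs]) (use s w in auto)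
qed

lemma avoiding_walk_to:
  assumes "x \<in> verts G" "x \<noteq> v"
  obtains q where "awalk v q x" "v \<notin> head G ` set q"
proof -
  obtain q where q: "awalk v q x" using walk_exists[OF v_verts assms(1)] .
  show thesis
  proof (cases "\<exists>e\<in>set q. head G e = v")
    case False
    then show thesis using that q by blast
  next
    case True
    then obtain ys e zs where "q = ys @ e # zs" "head G e = v" "\<forall>e\<in>set zs. head G e \<noteq> v"
      using split_list_last_prop[of q "\<lambda>e. head G e = v"] by blast
    then have "awalk v zs x" "v \<notin> head G ` set zs"
      using q by (auto simp: awalk_Cons_iff)
    then show thesis using that by blast
  qed
qed

text \<open>An edge into \<open>x\<close> is connected to a fixed edge \<open>e0\<close> into
  \<open>v\<close>, and (G2) bounds the connection independently of \<open>x\<close>. Stopping at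
  the first visit to \<open>v\<close> preserves the bound.\<close>

lemma bounded_return:
  obtains B where "\<And>x. x \<in> verts G \<Longrightarrow>
    \<exists>q. awalk x q v \<and> q \<noteq> [] \<and> v \<notin> head G ` set (butlast q) \<and> path_sum len q \<le> B"
proof -
  obtain C where C: "\<And>e e'. e \<in> arcs G \<Longrightarrow> e' \<in> arcs G \<Longrightarrow> e \<noteq> e' \<Longrightarrow>
      \<exists>q. awalk (head G e) q (tail G e') \<and> path_sum len q < C"
    using connect by metis
  obtain e0 where e0: "e0 \<in> arcs G" "head G e0 = v" using in_arc[OF v_verts] .
  \<comment> \<open>Covers the case that the edge chosen into \<open>x\<close> is \<open>e0\<close>
    itself, where \<open>x = v\<close>.\<close>
  obtain c where c: "awalk v c v" "c \<noteq> []" using walk_exists[OF v_verts v_verts] .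
  define B where "B = max (C + len e0) (path_sum len c)"
  have "\<exists>q. awalk x q v \<and> q \<noteq> [] \<and> path_sum len q \<le> B" if x: "x \<in> verts G" for x
  proof -
    obtain e where e: "e \<in> arcs G" "head G e = x" using in_arc[OF x] .
    show ?thesis
    proof (cases "e = e0")
      case True
      then have "awalk x c v" using e e0 c by simp
      then show ?thesis using c by (intro exI[of _ c]) (auto simp: B_def)
    next
      case False
      then obtain q where q: "awalk x q (tail G e0)" "path_sum len q < C"
        using C[OF e(1) e0(1)] e by blast
      then have "awalk x (q @ [e0]) v"
        using e0 v_verts by (auto simp: awalk_Cons_iff awalk_Nil_iff)
      then show ?thesis using q by (intro exI[of _ "q @ [e0]"]) (auto simp: B_def)
    qed
  qed
  then have "\<exists>q. awalk x q v \<and> q \<noteq> [] \<and> v \<notin> head G ` set (butlast q) \<and> path_sum len q \<le> B"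
    if x: "x \<in> verts G" for x
  proof -
    from \<open>\<And>x. x \<in> verts G \<Longrightarrow> \<exists>q. awalk x q v \<and> q \<noteq> [] \<and> path_sum len q \<le> B\<close>[OF x]
    obtain q where q: "awalk x q v" "q \<noteq> []" "path_sum len q \<le> B" by blast
    obtain q1 q2 where "q = q1 @ q2" "awalk x q1 v" "q1 \<noteq> []" "v \<notin> head G ` set (butlast q1)" "awalk v q2 v"
      using first_passage_prefix[OF q(1,2)] .
    moreover from this have "path_sum len q1 \<le> B"
      using q(3) path_sum_len_nonneg[of v q2 v] by simp
    ultimately show ?thesis by blast
  qed
  then show thesis using that by blast
qed

text \<open>A closed path \<open>c\<close> at any vertex is inserted into a closed path
  \<open>q @ r\<close> through \<open>v\<close>, and \<open>f c\<close> is the difference of the two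
  values at \<open>v\<close>. Closed paths at \<open>v\<close> are concatenations of first-return
  loops. Used with a lattice for lengths and with \<open>{0}\<close> for centred costs.\<close>

lemma closed_induct:
  fixes f :: "'e list \<Rightarrow> real" and S :: "real set"
  assumes f: "\<And>p q. f (p @ q) = f p + f q"
    and S: "0 \<in> S" "\<And>x y. x \<in> S \<Longrightarrow> y \<in> S \<Longrightarrow> x + y \<in> S" "\<And>x y. x \<in> S \<Longrightarrow> y \<in> S \<Longrightarrow> x - y \<in> S"
    and L: "\<And>g. g \<in> first_loops \<Longrightarrow> f g \<in> S"
    and c: "closed_w c"
  shows "f c \<in> S"
proof -
  have at_v: "f p \<in> S" if "awalk v p v" for p
    using that
  proof (induction p rule: length_induct)
    case (1 p)
    show ?case
    proof (cases "p = []")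
      case True
      then show ?thesis using f[of "[]" "[]"] S(1) by simp
    next
      case False
      obtain q1 q2 where q: "p = q1 @ q2" "awalk v q1 v" "q1 \<noteq> []" "v \<notin> head G ` set (butlast q1)" "awalk v q2 v"
        using first_passage_prefix[OF 1(2) False] .
      then have "f q1 \<in> S" by (intro L) (auto simp: first_loops_def)
      moreover have "f q2 \<in> S" using 1 q by auto
      ultimately show ?thesis using q f S by simp
    qed
  qed
  obtain u where u: "awalk u c u" using c by (auto simp: closed_w_def)
  then have "u \<in> verts G" by auto
  obtain q where q: "awalk v q u" using walk_exists[OF v_verts \<open>u \<in> verts G\<close>] .
  obtain r where r: "awalk u r v" using walk_exists[OF \<open>u \<in> verts G\<close> v_verts] .
  have "awalk v (q @ c @ r) v" "awalk v (q @ r) v"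
    using q r u by (auto intro: awalk_appendI)
  then have "f (q @ c @ r) - f (q @ r) \<in> S"
    by (intro S at_v)
  then show ?thesis by (simp add: f)
qed

lemma first_loop_nonlattice: "\<not> (\<exists>d>0. \<forall>g\<in>first_loops. \<exists>k::int. path_sum len g = d * of_int k)"
proof
  assume "\<exists>d>0. \<forall>g\<in>first_loops. \<exists>k::int. path_sum len g = d * of_int k"
  then obtain d where d: "0 < d" "\<And>g. g \<in> first_loops \<Longrightarrow> \<exists>k::int. path_sum len g = d * of_int k" by blast
  define S where "S = range (\<lambda>k::int. d * of_int k)"
  have "{path_sum len p | p. closed_w p} \<subseteq> {d * real k | k. True}"
  proof
    fix x assume "x \<in> {path_sum len p | p. closed_w p}"
    then obtain p where p: "x = path_sum len p" "closed_w p" by blast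
    have "path_sum len p \<in> S"
    proof (rule closed_induct[OF _ _ _ _ _ p(2)])
      show "0 \<in> S" by (auto simp: S_def intro: image_eqI[where x = 0])
      show "x + z \<in> S" if "x \<in> S" "z \<in> S" for x z
        using that unfolding S_def by (auto simp flip: distrib_left of_int_add)
      show "x - z \<in> S" if "x \<in> S" "z \<in> S" for x z
        using that unfolding S_def by (auto simp flip: right_diff_distrib of_int_diff)
      show "path_sum len g \<in> S" if "g \<in> first_loops" for g
        using d(2)[OF that] by (auto simp: S_def)
    qed simp
    then obtain k :: int where k: "x = d * of_int k" using p by (auto simp: S_def)
    \<comment> \<open>The subgroup argument yields integer multiples of \<open>d\<close>, whereas
      (G3) speaks of natural ones.\<close>
    have "0 \<le> x" using p path_sum_len_nonneg by (auto simp: closed_w_def)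
    then have "0 \<le> k" using k d(1) by (simp add: zero_le_mult_iff)
    then have "x = d * real (nat k)" using k by simp
    then show "x \<in> {d * real k | k. True}" by blast
  qed
  with G3 d(1) show False by blast
qed

lemma paths_decomp: "paths = avoid v \<union> (\<lambda>(g, p). g @ p) ` (first_loops \<times> paths)"
proof (intro equalityI subsetI)
  fix p assume "p \<in> paths"
  then obtain w where w: "awalk v p w" by (auto simp: paths_def)
  show "p \<in> avoid v \<union> (\<lambda>(g, p). g @ p) ` (first_loops \<times> paths)"
  proof (cases "\<exists>e\<in>set p. head G e = v")
    case False
    then show ?thesis using w by (auto simp: avoid_def)
  next
    case True
    then obtain ys e zs where s: "p = ys @ e # zs" "head G e = v" "\<forall>e\<in>set ys. head G e \<noteq> v"
      using split_list_first_prop[of p "\<lambda>e. head G e = v"] by blast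
    then have "awalk v (ys @ [e]) v" "awalk v zs w"
      using w v_verts by (auto simp: awalk_Cons_iff awalk_Nil_iff)
    then have "ys @ [e] \<in> first_loops" "zs \<in> paths"
      using s by (auto simp: first_loops_def paths_def)
    then show ?thesis using s by (intro UnI2 image_eqI[where x = "(ys @ [e], zs)"]) auto
  qed
next
  fix p assume "p \<in> avoid v \<union> (\<lambda>(g, p). g @ p) ` (first_loops \<times> paths)"
  then show "p \<in> paths" by (auto simp: avoid_def first_loops_def paths_def intro: awalk_appendI)
qed

lemma first_loop_last: "g \<in> first_loops \<Longrightarrow> g = butlast g @ [last g] \<and> head G (last g) = v"
  by (cases g rule: rev_cases) (auto simp: first_loops_def awalk_Cons_iff awalk_Nil_iff)

lemma avoid_first_loops_disjoint: "avoid v \<inter> (\<lambda>(g, p). g @ p) ` (first_loops \<times> paths) = {}"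
proof -
  have False if "g @ p \<in> avoid v" "g \<in> first_loops" for g p
  proof -
    have "last g \<in> set g" using that(2) by (auto simp: first_loops_def)
    then show False using first_loop_last[OF that(2)] that(1) by (auto simp: avoid_def)
  qed
  then show ?thesis by auto
qed

text \<open>A first-return loop enters \<open>v\<close> with its last edge only. Hence the loops
  form a prefix code, which makes the factorisation of paths unique.\<close>

lemma first_loop_not_prefix:
  assumes "g \<in> first_loops" "g @ us \<in> first_loops"
  shows "us = []"
proof (rule ccontr)
  assume "us \<noteq> []"
  then have "butlast (g @ us) = g @ butlast us" by (simp add: butlast_append)
  moreover have "last g \<in> set g" using assms(1) by (auto simp: first_loops_def)
  ultimately show False
    using assms(2) first_loop_last[OF assms(1)] by (auto simp: first_loops_def)
qed

lemma first_loop_inj: "inj_on (\<lambda>(g, p). g @ p) (first_loops \<times> paths)"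
proof (rule inj_onI, clarify)
  fix g p g' p' assume g: "g \<in> first_loops" "g' \<in> first_loops" and eq: "g @ p = g' @ p'"
  then obtain us where "g = g' @ us \<and> us @ p = p' \<or> g @ us = g' \<and> p = us @ p'"
    using append_eq_append_conv2[of g p g' p'] by blast
  then show "g = g' \<and> p = p'" using first_loop_not_prefix g by force
qed

section \<open>Exponential weights and finiteness properties\<close>

definition wt :: "real \<Rightarrow> 'e list \<Rightarrow> ennreal" where
  "wt s p = ennreal (exp (- s * path_sum len p))"

lemma wt_Nil [simp]: "wt s [] = 1"
  by (simp add: wt_def)

lemma wt_append: "wt s (p @ q) = wt s p * wt s q"
  by (simp add: wt_def ennreal_mult'[symmetric] exp_add[symmetric] algebra_simps)

lemma wt_Cons: "wt s (e # p) = ennreal (exp (- s * len e)) * wt s p"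
  by (simp add: wt_def ennreal_mult'[symmetric] exp_add[symmetric] algebra_simps)

definition arc_sum :: "real \<Rightarrow> ennreal" where
  "arc_sum s = (\<integral>\<^sup>+e. ennreal (exp (- s * len e)) \<partial>count_space (arcs G))"

lemma arc_sum_finite: "0 < s \<Longrightarrow> arc_sum s < \<infinity>"
proof -
  assume "0 < s"
  then have "(\<lambda>e. exp (- s * len e)) summable_on arcs G" by (rule G1)
  then have "Infinite_Sum.abs_summable_on (\<lambda>e. exp (- s * len e)) (arcs G)"
    by simp
  then have "integrable (count_space (arcs G)) (\<lambda>e. exp (- s * len e))"
    unfolding abs_summable_equivalent abs_summable_on_def .
  then show ?thesis
    unfolding integrable_iff_bounded arc_sum_def by simp
qed

text \<open>Markov's inequality for the series in (G1) at \<open>\<sigma> = 1\<close>: each of these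
  edges has weight at least \<open>exp (- T)\<close>.\<close>

lemma finite_short_arcs: "finite {e \<in> arcs G. len e \<le> T}"
proof -
  have "emeasure (count_space (arcs G)) {e \<in> arcs G. 1 \<le> ennreal (exp T) * ennreal (exp (- 1 * len e))}
      \<le> ennreal (exp T) * (\<integral>\<^sup>+e. ennreal (exp (- 1 * len e)) * indicator (arcs G) e \<partial>count_space (arcs G))"
    using nn_integral_Markov_inequality[of "\<lambda>e. ennreal (exp (- 1 * len e))" "arcs G" "count_space (arcs G)" "ennreal (exp T)"]
    by simp
  also have "(\<integral>\<^sup>+e. ennreal (exp (- 1 * len e)) * indicator (arcs G) e \<partial>count_space (arcs G)) = arc_sum 1"
    unfolding arc_sum_def by (intro nn_integral_cong) auto
  also have "ennreal (exp T) * arc_sum 1 < \<infinity>"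
    using arc_sum_finite[of 1] by (simp add: ennreal_mult_less_top)
  finally have "finite {e \<in> arcs G. 1 \<le> ennreal (exp T) * ennreal (exp (- 1 * len e))}"
    by (subst (asm) emeasure_count_space) (auto split: if_splits)
  then show ?thesis
    by (rule finite_subset[rotated])
       (auto simp: ennreal_mult'[symmetric] exp_add[symmetric] simp flip: ennreal_1)
qed

lemma min_len:
  obtains l0 where "0 < l0" "\<And>e. e \<in> arcs G \<Longrightarrow> l0 \<le> len e"
proof -
  obtain e1 where e1: "e1 \<in> arcs G" using in_arc[OF v_verts] by blast
  define S where "S = len ` {e \<in> arcs G. len e \<le> len e1}"
  have S: "finite S" "S \<noteq> {}" using finite_short_arcs e1 by (auto simp: S_def)
  have "0 < Min S" using Min_in[OF S] len_pos by (auto simp: S_def)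
  moreover have "Min S \<le> len e" if "e \<in> arcs G" for e
  proof (cases "len e \<le> len e1")
    case True
    then show ?thesis using that S by (intro Min_le) (auto simp: S_def)
  next
    case False
    have "Min S \<le> len e1" using e1 S by (intro Min_le) (auto simp: S_def)
    then show ?thesis using False by simp
  qed
  ultimately show thesis using that by blast
qed

lemma path_length_le:
  assumes "awalk u p w" "\<And>e. e \<in> arcs G \<Longrightarrow> l0 \<le> len e"
  shows "l0 * real (length p) \<le> path_sum len p"
  using assms by (induction p arbitrary: u) (force simp: awalk_Cons_iff algebra_simps)+

text \<open>Words of bounded length over the finite alphabet of short edges.\<close>

lemma finite_paths_below: "finite {p \<in> paths. path_sum len p < T}"
proof -
  obtain l0 where l0: "0 < l0" "\<And>e. e \<in> arcs G \<Longrightarrow> l0 \<le> len e" using min_len by blast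
  have "{p \<in> paths. path_sum len p < T}
      \<subseteq> {p. set p \<subseteq> {e \<in> arcs G. len e \<le> T} \<and> length p \<le> nat \<lceil>T / l0\<rceil>}"
  proof
    fix p assume "p \<in> {p \<in> paths. path_sum len p < T}"
    then obtain w where w: "awalk v p w" and T: "path_sum len p < T" by (auto simp: paths_def)
    have "len e \<le> path_sum len p" if e: "e \<in> set p" for e
    proof -
      obtain ys zs where "p = ys @ e # zs" using split_list[OF e] by blast
      then obtain x where "awalk v ys x" "awalk x (e # zs) w" using w by auto
      then have "0 \<le> path_sum len ys" "0 \<le> path_sum len zs"
        using path_sum_len_nonneg by (auto simp: awalk_Cons_iff)
      then show ?thesis using \<open>p = ys @ e # zs\<close> by simp
    qed
    moreover have "set p \<subseteq> arcs G" using w by (simp add: awalk_def)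
    ultimately have "set p \<subseteq> {e \<in> arcs G. len e \<le> T}" using T by force
    moreover have "l0 * real (length p) < T" using path_length_le[OF w l0(2)] T by linarith
    then have "real (length p) < T / l0" using l0(1) by (simp add: pos_less_divide_eq mult.commute)
    then have "length p \<le> nat \<lceil>T / l0\<rceil>" by linarith
    ultimately show "p \<in> {p. set p \<subseteq> {e \<in> arcs G. len e \<le> T} \<and> length p \<le> nat \<lceil>T / l0\<rceil>}" by simp
  qed
  then show ?thesis
    by (rule finite_subset) (rule finite_lists_length_le[OF finite_short_arcs])
qed

end

lemma exp_weight_convex:
  fixes x :: real
  assumes "0 \<le> \<theta>" "\<theta> \<le> 1"
  shows "exp (- ((1 - \<theta>) * a + \<theta> * b) * x) \<le> (1 - \<theta>) * exp (- a * x) + \<theta> * exp (- b * x)"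
proof -
  have "- ((1 - \<theta>) * a + \<theta> * b) * x = (1 - \<theta>) *\<^sub>R (- a * x) + \<theta> *\<^sub>R (- b * x)"
    by (simp add: algebra_simps)
  then show ?thesis
    using convex_onD[OF exp_convex assms, of "- a * x" "- b * x"] by simp
qed

section \<open>Generating functions of first-return loops and of avoiding paths\<close>

context based_digraph begin

definition Q :: "real \<Rightarrow> 'v \<Rightarrow> ennreal" where
  "Q s u = (\<integral>\<^sup>+p. wt s p \<partial>count_space (avoid u))"

definition F :: "real \<Rightarrow> ennreal" where
  "F s = (\<integral>\<^sup>+g. wt s g \<partial>count_space first_loops)"

definition out :: "'v \<Rightarrow> 'e set" where
  "out u = {e \<in> arcs G. tail G e = u \<and> head G e \<noteq> v}"

abbreviation w1 :: "real \<Rightarrow> 'e \<Rightarrow> ennreal" where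
  "w1 s e \<equiv> ennreal (exp (- s * len e))"

lemma avoid_eq:
  assumes "u \<in> verts G"
  shows "avoid u = insert [] ((\<lambda>(e, p). e # p) ` Sigma (out u) (\<lambda>e. avoid (head G e)))"
proof (intro equalityI subsetI)
  fix p assume "p \<in> avoid u"
  then obtain w where w: "awalk u p w" "v \<notin> head G ` set p" by (auto simp: avoid_def)
  show "p \<in> insert [] ((\<lambda>(e, p). e # p) ` Sigma (out u) (\<lambda>e. avoid (head G e)))"
  proof (cases p)
    case (Cons e q)
    then have "e \<in> out u" "q \<in> avoid (head G e)"
      using w by (auto simp: awalk_Cons_iff out_def avoid_def)
    then show ?thesis using Cons by (intro insertI2 image_eqI[where x = "(e, q)"]) auto
  qed simp
next
  fix p assume "p \<in> insert [] ((\<lambda>(e, p). e # p) ` Sigma (out u) (\<lambda>e. avoid (head G e)))"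
  then show "p \<in> avoid u"
    using assms by (auto simp: awalk_Cons_iff awalk_Nil_iff out_def avoid_def)
qed

lemma avoid_sum:
  assumes "u \<in> verts G"
  shows "(\<integral>\<^sup>+p. f p \<partial>count_space (avoid u))
    = f [] + (\<integral>\<^sup>+e. \<integral>\<^sup>+p. f (e # p) \<partial>count_space (avoid (head G e)) \<partial>count_space (out u))"
proof -
  let ?S = "Sigma (out u) (\<lambda>e. avoid (head G e))"
  have "(\<integral>\<^sup>+p. f p \<partial>count_space (avoid u)) = f [] + (\<integral>\<^sup>+p. f p \<partial>count_space ((\<lambda>(e, p). e # p) ` ?S))"
    unfolding avoid_eq[OF assms] by (rule nn_sum_insert) auto
  also have "(\<integral>\<^sup>+p. f p \<partial>count_space ((\<lambda>(e, p). e # p) ` ?S))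
      = (\<integral>\<^sup>+z. f ((\<lambda>(e, p). e # p) z) \<partial>count_space ?S)"
    by (rule nn_integral_bij_count_space[symmetric]) (auto simp: bij_betw_def inj_on_def)
  also have "\<dots> = (\<integral>\<^sup>+e. \<integral>\<^sup>+p. f (e # p) \<partial>count_space (avoid (head G e)) \<partial>count_space (out u))"
    by (simp add: nn_sum_Sigma[symmetric])
  finally show ?thesis .
qed

lemma Q_rec:
  assumes "u \<in> verts G"
  shows "Q s u = 1 + (\<integral>\<^sup>+e. w1 s e * Q s (head G e) \<partial>count_space (out u))"
  unfolding Q_def avoid_sum[OF assms] wt_Cons by (simp add: nn_integral_cmult)

lemma head_out: "e \<in> out u \<Longrightarrow> head G e \<in> verts G"
  by (simp add: out_def)

text \<open>\<open>Q s\<close> is the least nonnegative solution of its recursion: the sums over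
  paths of at most \<open>n\<close> edges stay below \<open>f\<close> by induction, and monotone
  convergence covers all paths. Bounds for \<open>Q\<close> are obtained by exhibiting a suitable
  \<open>f\<close>.\<close>

lemma Q_le_supersolution:
  assumes f: "\<And>u. u \<in> verts G \<Longrightarrow> 1 + (\<integral>\<^sup>+e. w1 s e * f (head G e) \<partial>count_space (out u)) \<le> f u"
    and u: "u \<in> verts G"
  shows "Q s u \<le> f u"
proof -
  define S where "S n u = (\<integral>\<^sup>+p. wt s p * indicator {p. length p \<le> n} p \<partial>count_space (avoid u))" for n u
  have S_le: "S n u \<le> f u" if "u \<in> verts G" for n u
    using that
  proof (induction n arbitrary: u)
    case 0
    have "S 0 u = 1"
      unfolding S_def avoid_sum[OF 0] by simp
    also have "\<dots> \<le> f u" using f[OF 0] by (rule order_trans[rotated]) simp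
    finally show ?case .
  next
    case (Suc n)
    have "S (Suc n) u = 1 + (\<integral>\<^sup>+e. w1 s e * S n (head G e) \<partial>count_space (out u))"
      unfolding S_def avoid_sum[OF Suc.prems] wt_Cons mult.assoc
      by (simp add: nn_integral_cmult indicator_def)
    also have "\<dots> \<le> 1 + (\<integral>\<^sup>+e. w1 s e * f (head G e) \<partial>count_space (out u))"
      by (intro add_left_mono nn_integral_mono mult_left_mono Suc.IH) (auto simp: head_out)
    also have "\<dots> \<le> f u" by (rule f[OF Suc.prems])
    finally show ?case .
  qed
  have sup: "(SUP n. wt s p * indicator {p. length p \<le> n} p) = wt s p" for p
  proof (rule antisym)
    show "(SUP n. wt s p * indicator {p. length p \<le> n} p) \<le> wt s p"
      by (rule SUP_least) (auto split: split_indicator)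
    show "wt s p \<le> (SUP n. wt s p * indicator {p. length p \<le> n} p)"
      by (rule SUP_upper2[of "length p"]) auto
  qed
  have "Q s u = (\<integral>\<^sup>+p. (SUP n. wt s p * indicator {p. length p \<le> n} p) \<partial>count_space (avoid u))"
    unfolding Q_def sup ..
  also have "\<dots> = (SUP n. S n u)"
    unfolding S_def
  proof (rule nn_integral_monotone_convergence_SUP)
    show "incseq (\<lambda>n p. wt s p * indicator {p. length p \<le> n} p)"
      by (auto intro!: monoI le_funI mult_left_mono split: split_indicator)
  qed simp
  also have "\<dots> \<le> f u" by (intro SUP_least S_le u)
  finally show ?thesis .
qed

text \<open>A path that avoids \<open>v\<close> extends to a first-return loop by a number of edges that is bounded; each
  loop is obtained from at most one path for every length of the extension.\<close>

lemma Q_base_finite: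
  assumes s: "0 < s" and F: "F s < \<infinity>"
  shows "Q s v < \<infinity>"
proof -
  obtain B where B: "\<And>x. x \<in> verts G \<Longrightarrow>
      \<exists>q. awalk x q v \<and> q \<noteq> [] \<and> v \<notin> head G ` set (butlast q) \<and> path_sum len q \<le> B"
    using bounded_return by blast
  define \<beta> where "\<beta> x = (SOME q. awalk x q v \<and> q \<noteq> [] \<and> v \<notin> head G ` set (butlast q) \<and> path_sum len q \<le> B)" for x
  have \<beta>: "awalk x (\<beta> x) v" "\<beta> x \<noteq> []" "v \<notin> head G ` set (butlast (\<beta> x))" "path_sum len (\<beta> x) \<le> B"
    if "x \<in> verts G" for x
    using someI_ex[OF B[OF that]] unfolding \<beta>_def by blast+
  obtain l0 where l0: "0 < l0" "\<And>e. e \<in> arcs G \<Longrightarrow> l0 \<le> len e" using min_len by blast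
  define N where "N = nat \<lceil>B / l0\<rceil>"
  define ext where "ext p = \<beta> (awlast v p)" for p
  have walk: "awalk v p (awlast v p)" "awlast v p \<in> verts G" if "p \<in> avoid v" for p
    using that by (auto simp: avoid_def)
  have ext_len: "length (ext p) \<le> N" if "p \<in> avoid v" for p
  proof -
    have "l0 * real (length (ext p)) \<le> B"
      using path_length_le[OF \<beta>(1)[OF walk(2)[OF that]] l0(2)] \<beta>(4)[OF walk(2)[OF that]]
      unfolding ext_def by linarith
    then have "real (length (ext p)) \<le> B / l0" using l0(1) by (simp add: pos_le_divide_eq mult.commute)
    then show ?thesis unfolding N_def by linarith
  qed
  have ext_first_loop: "p @ ext p \<in> first_loops" if "p \<in> avoid v" for p
    using walk[OF that] \<beta>[OF walk(2)[OF that]] that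
    by (auto simp: first_loops_def ext_def avoid_def butlast_append intro: awalk_appendI)
  have wt_le: "wt s p \<le> ennreal (exp (s * B)) * wt s (p @ ext p)" if "p \<in> avoid v" for p
  proof -
    have "s * path_sum len (ext p) \<le> s * B"
      using \<beta>(4)[OF walk(2)[OF that]] s by (simp add: ext_def)
    then show ?thesis
      by (simp add: wt_def ennreal_mult'[symmetric] exp_add[symmetric] algebra_simps)
  qed
  have part: "(\<integral>\<^sup>+p. wt s p \<partial>count_space {p \<in> avoid v. length (ext p) = j}) \<le> ennreal (exp (s * B)) * F s" for j
    unfolding F_def
  proof (rule nn_sum_inj)
    show "inj_on (\<lambda>p. p @ ext p) {p \<in> avoid v. length (ext p) = j}"
      by (rule inj_onI) (auto simp: append_eq_append_conv)
  qed (use ext_first_loop wt_le in auto)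
  have "Q s v = (\<integral>\<^sup>+p. (\<Sum>j\<le>N. wt s p * indicator {p. length (ext p) = j} p) \<partial>count_space (avoid v))"
    unfolding Q_def
  proof (rule nn_integral_cong)
    fix p assume "p \<in> space (count_space (avoid v))"
    then have "length (ext p) \<le> N" by (intro ext_len) simp
    have "(\<Sum>j\<le>N. wt s p * indicator {p. length (ext p) = j} p)
        = (\<Sum>j\<le>N. if j = length (ext p) then wt s p else 0)"
      by (intro sum.cong) (auto simp: indicator_def)
    also have "\<dots> = wt s p" using \<open>length (ext p) \<le> N\<close> by simp
    finally show "wt s p = (\<Sum>j\<le>N. wt s p * indicator {p. length (ext p) = j} p)" ..
  qed
  also have "\<dots> = (\<Sum>j\<le>N. \<integral>\<^sup>+p. wt s p * indicator {p. length (ext p) = j} p \<partial>count_space (avoid v))"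
    by (rule nn_integral_sum) simp
  also have "\<dots> = (\<Sum>j\<le>N. \<integral>\<^sup>+p. wt s p \<partial>count_space {p \<in> avoid v. length (ext p) = j})"
    unfolding nn_sum_indicator[where A = "avoid v"] nn_sum_indicator[where A = "{p \<in> avoid v. _ p}"]
    by (intro sum.cong refl nn_integral_cong) (auto split: split_indicator)
  also have "\<dots> \<le> (\<Sum>j\<le>N. ennreal (exp (s * B)) * F s)"
    by (intro sum_mono part)
  also have "\<dots> < \<infinity>"
    using F by (simp add: ennreal_mult_less_top of_nat_less_top)
  finally show ?thesis .
qed

text \<open>A fixed path from \<open>v\<close> to \<open>u\<close> that does not return to
  \<open>v\<close>, put in front, embeds the paths counted by \<open>Q s u\<close> in those counted
  by \<open>Q s v\<close>.\<close>

lemma Q_finite: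
  assumes Q: "Q s v < \<infinity>" and u: "u \<in> verts G"
  shows "Q s u < \<infinity>"
proof (cases "u = v")
  case False
  obtain q where q: "awalk v q u" "v \<notin> head G ` set q" using avoiding_walk_to[OF u False] .
  have "Q s u \<le> ennreal (exp (s * path_sum len q)) * Q s v"
    unfolding Q_def
  proof (rule nn_sum_inj[where \<phi> = "\<lambda>p. q @ p"])
    show "(\<lambda>p. q @ p) ` avoid u \<subseteq> avoid v"
      using q by (auto simp: avoid_def intro: awalk_appendI)
    show "wt s p \<le> ennreal (exp (s * path_sum len q)) * wt s (q @ p)" for p
      by (simp add: wt_def ennreal_mult'[symmetric] exp_add[symmetric] algebra_simps)
  qed (simp add: inj_on_def)
  also have "\<dots> < \<infinity>" using Q by (simp add: ennreal_mult_less_top)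
  finally show ?thesis .
qed (use Q in simp)

text \<open>The edges outside a finite set have total weight at most \<open>1 / 2\<close>, so a path can afford to use them
  until it meets one of the finitely many others.\<close>

lemma Q_bounded:
  assumes s: "0 < s" and Q: "Q s v < \<infinity>"
  obtains M where "1 \<le> M" "\<And>u. u \<in> verts G \<Longrightarrow> Q s u \<le> ennreal M"
proof -
  obtain r where r: "0 \<le> r" "arc_sum (s / 2) = ennreal r"
    using arc_sum_finite[of "s / 2"] s by (cases "arc_sum (s / 2)") auto
  \<comment> \<open>An edge longer than \<open>T\<close> has at \<open>s\<close> at most
    \<open>exp (- (s / 2) * T)\<close> times its weight at \<open>s / 2\<close>, and the latter
    weights sum to \<open>r\<close>.\<close>
  define T where "T = 2 / s * ln (2 * (r + 1))"
  have "s / 2 * T = ln (2 * (r + 1))" using s by (simp add: T_def)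
  then have "exp (- (s / 2) * T) = inverse (2 * (r + 1))"
    using r(1) by (simp add: exp_minus)
  moreover have "inverse (2 * (r + 1)) * r \<le> 1 / 2"
    using r(1) by (simp add: field_simps)
  ultimately have eT: "exp (- (s / 2) * T) * r \<le> 1 / 2"
    by (simp only:)
  define E0 where "E0 = {e \<in> arcs G. len e \<le> T}"
  have E0: "finite E0" unfolding E0_def by (rule finite_short_arcs)
  have tail: "(\<integral>\<^sup>+e. w1 s e * indicator (- E0) e \<partial>count_space (arcs G)) \<le> ennreal (1 / 2)"
  proof -
    have "(\<integral>\<^sup>+e. w1 s e * indicator (- E0) e \<partial>count_space (arcs G))
        \<le> (\<integral>\<^sup>+e. ennreal (exp (- (s / 2) * T)) * w1 (s / 2) e \<partial>count_space (arcs G))"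
    proof (rule nn_integral_mono)
      fix e assume e: "e \<in> space (count_space (arcs G))"
      show "w1 s e * indicator (- E0) e \<le> ennreal (exp (- (s / 2) * T)) * w1 (s / 2) e"
      proof (cases "e \<in> E0")
        case False
        then have "T < len e" using e by (auto simp: E0_def)
        then have "s / 2 * T \<le> s / 2 * len e" using s by (intro mult_left_mono) auto
        then have "- s * len e \<le> - (s / 2) * T + - (s / 2) * len e" by (simp add: field_simps)
        then show ?thesis
          using False by (simp add: ennreal_mult'[symmetric] exp_add[symmetric])
      qed simp
    qed
    also have "\<dots> = ennreal (exp (- (s / 2) * T)) * ennreal r"
      unfolding r(2)[symmetric] arc_sum_def by (rule nn_integral_cmult) simp
    also have "\<dots> \<le> ennreal (1 / 2)"
      unfolding ennreal_mult'[OF exp_ge_zero, symmetric] using eT by (rule ennreal_leI)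
    finally show ?thesis .
  qed
  have "(\<Sum>e\<in>E0. w1 s e * Q s (head G e)) < \<infinity>"
    using E0 Q_finite[OF Q] by (auto simp: E0_def ennreal_mult_less_top)
  then obtain a where a: "0 \<le> a" "(\<Sum>e\<in>E0. w1 s e * Q s (head G e)) = ennreal a"
    by (cases "\<Sum>e\<in>E0. w1 s e * Q s (head G e)") auto
  \<comment> \<open>The solution of \<open>M = 1 + a + M / 2\<close>, where \<open>a\<close> bounds
    the contribution of the edges in \<open>E0\<close>.\<close>
  define M where "M = 2 * (1 + a)"
  have M: "1 \<le> M" using a(1) by (simp add: M_def)
  \<comment> \<open>The truncation of \<open>Q s\<close> at \<open>M\<close> is itself a
    supersolution. The minimum with \<open>Q s\<close> is what allows the edges in \<open>E0\<close>
    to be bounded by \<open>a\<close>.\<close>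
  have "Q s u \<le> min (Q s u) (ennreal M)" if "u \<in> verts G" for u
    using that
  proof (rule Q_le_supersolution[rotated])
    fix u assume u: "u \<in> verts G"
    have "1 + (\<integral>\<^sup>+e. w1 s e * min (Q s (head G e)) (ennreal M) \<partial>count_space (out u)) \<le> Q s u"
      unfolding Q_rec[OF u] by (intro add_left_mono nn_integral_mono mult_left_mono) auto
    moreover have "1 + (\<integral>\<^sup>+e. w1 s e * min (Q s (head G e)) (ennreal M) \<partial>count_space (out u)) \<le> ennreal M"
    proof -
      have "(\<integral>\<^sup>+e. w1 s e * min (Q s (head G e)) (ennreal M) \<partial>count_space (out u))
          \<le> (\<integral>\<^sup>+e. w1 s e * min (Q s (head G e)) (ennreal M) \<partial>count_space (arcs G))"
        by (rule nn_sum_mono_set) (auto simp: out_def)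
      also have "\<dots> \<le> (\<integral>\<^sup>+e. w1 s e * Q s (head G e) * indicator E0 e
          + ennreal M * (w1 s e * indicator (- E0) e) \<partial>count_space (arcs G))"
      proof (rule nn_integral_mono)
        fix e
        have "w1 s e * min (Q s (head G e)) (ennreal M) \<le> w1 s e * Q s (head G e)"
          "w1 s e * min (Q s (head G e)) (ennreal M) \<le> w1 s e * ennreal M"
          by (intro mult_left_mono; simp)+
        then show "w1 s e * min (Q s (head G e)) (ennreal M)
            \<le> w1 s e * Q s (head G e) * indicator E0 e + ennreal M * (w1 s e * indicator (- E0) e)"
          by (cases "e \<in> E0") (simp_all add: mult.commute)
      qed
      also have "\<dots> = (\<integral>\<^sup>+e. w1 s e * Q s (head G e) * indicator E0 e \<partial>count_space (arcs G))
          + ennreal M * (\<integral>\<^sup>+e. w1 s e * indicator (- E0) e \<partial>count_space (arcs G))"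
        by (simp add: nn_integral_add nn_integral_cmult)
      also have "(\<integral>\<^sup>+e. w1 s e * Q s (head G e) * indicator E0 e \<partial>count_space (arcs G))
          = (\<integral>\<^sup>+e. w1 s e * Q s (head G e) \<partial>count_space E0)"
        unfolding nn_sum_indicator[where A = "arcs G"] nn_sum_indicator[where A = E0]
        by (intro nn_integral_cong) (auto simp: E0_def split: split_indicator)
      also have "\<dots> = ennreal a"
        using a(2) E0 by (simp add: nn_integral_count_space_finite)
      also have "ennreal M * (\<integral>\<^sup>+e. w1 s e * indicator (- E0) e \<partial>count_space (arcs G)) \<le> ennreal M * ennreal (1 / 2)"
        by (intro mult_left_mono tail) simp
      also have "\<dots> = ennreal (M * (1 / 2))"
        by (rule ennreal_mult'[symmetric]) (use M in simp)
      also have "M * (1 / 2) = 1 + a" by (simp add: M_def)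
      finally have "1 + (\<integral>\<^sup>+e. w1 s e * min (Q s (head G e)) (ennreal M) \<partial>count_space (out u))
          \<le> 1 + (ennreal a + ennreal (1 + a))"
        by (simp add: add_left_mono)
      also have "\<dots> = ennreal (1 + (a + (1 + a)))"
        using a(1) by (simp only: ennreal_plus ennreal_1 add_nonneg_nonneg zero_le_one)
      also have "1 + (a + (1 + a)) = M" by (simp add: M_def)
      finally show ?thesis .
    qed
    ultimately show "1 + (\<integral>\<^sup>+e. w1 s e * min (Q s (head G e)) (ennreal M) \<partial>count_space (out u)) \<le> min (Q s u) (ennreal M)"
      by simp
  qed
  then have "Q s u \<le> ennreal M" if "u \<in> verts G" for u
    using that by (metis min.bounded_iff)
  with M that show thesis by blast
qed

text \<open>Since the series over the edges also converges at \<open>s / 2\<close>, a bounded solution of the equation for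
  \<open>Q s\<close> is stable under a small decrease of \<open>s\<close>.\<close>

lemma Q_finite_open:
  assumes s: "0 < s" and Q: "Q s v < \<infinity>"
  obtains s' where "0 < s'" "s' < s" "Q s' v < \<infinity>"
proof -
  obtain M where M: "1 \<le> M" "\<And>u. u \<in> verts G \<Longrightarrow> Q s u \<le> ennreal M"
    using Q_bounded[OF s Q] by blast
  obtain r where r: "0 \<le> r" "arc_sum (s / 2) = ennreal r"
    using arc_sum_finite[of "s / 2"] s by (cases "arc_sum (s / 2)") auto
  \<comment> \<open>So small that the additional edge weight, at most
    \<open>2 * M * \<theta> * r\<close>, is absorbed by the spare unit in \<open>2 * Q s u\<close>:
    doubling the recursion also doubles its constant term 1.\<close>
  define \<theta> where "\<theta> = 1 / (1 + 2 * M * r)"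
  have pos: "0 \<le> 2 * M * r" using M(1) r(1) by simp
  have \<theta>: "0 < \<theta>" "\<theta> \<le> 1" using pos by (simp_all add: \<theta>_def)
  have \<theta>M: "2 * M * \<theta> * r \<le> 1"
    using pos by (simp add: \<theta>_def pos_divide_le_eq)
  define s' where "s' = (1 - \<theta>) * s + \<theta> * (s / 2)"
  have s'_eq: "s' = s - \<theta> * s / 2" by (simp add: s'_def algebra_simps)
  have "\<theta> * s \<le> 1 * s" using \<theta> s by (intro mult_right_mono) auto
  then have s': "0 < s'" "s' < s"
    using s \<theta> by (simp_all add: s'_eq)
  \<comment> \<open>Convexity in the exponent, with \<open>s'\<close> lying between
    \<open>s / 2\<close> and \<open>s\<close>.\<close>
  have w: "w1 s' e \<le> w1 s e + ennreal \<theta> * w1 (s / 2) e" for e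
  proof -
    have "exp (- s' * len e) \<le> (1 - \<theta>) * exp (- s * len e) + \<theta> * exp (- (s / 2) * len e)"
      unfolding s'_def by (rule exp_weight_convex) (use \<theta> in auto)
    also have "\<dots> \<le> exp (- s * len e) + \<theta> * exp (- (s / 2) * len e)"
      using \<theta> by (simp add: left_diff_distrib)
    finally have "ennreal (exp (- s' * len e)) \<le> ennreal (exp (- s * len e) + \<theta> * exp (- (s / 2) * len e))"
      by (rule ennreal_leI)
    then show ?thesis using \<theta> by (simp add: ennreal_mult')
  qed
  have "Q s' v \<le> 2 * Q s v"
  proof (rule Q_le_supersolution[where f = "\<lambda>u. 2 * Q s u", OF _ v_verts])
    fix u assume u: "u \<in> verts G"
    have "(\<integral>\<^sup>+e. w1 s' e * (2 * Q s (head G e)) \<partial>count_space (out u))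
        \<le> (\<integral>\<^sup>+e. 2 * (w1 s e * Q s (head G e)) + ennreal (2 * M * \<theta>) * w1 (s / 2) e \<partial>count_space (out u))"
    proof (rule nn_integral_mono)
      fix e assume "e \<in> space (count_space (out u))"
      then have Qe: "Q s (head G e) \<le> ennreal M" by (intro M(2)) (simp add: head_out)
      have "w1 s' e * (2 * Q s (head G e)) \<le> (w1 s e + ennreal \<theta> * w1 (s / 2) e) * (2 * Q s (head G e))"
        by (intro mult_right_mono w) simp
      also have "\<dots> = 2 * (w1 s e * Q s (head G e)) + (ennreal \<theta> * w1 (s / 2) e) * (2 * Q s (head G e))"
        by (simp add: algebra_simps)
      also have "(ennreal \<theta> * w1 (s / 2) e) * (2 * Q s (head G e)) \<le> (ennreal \<theta> * w1 (s / 2) e) * (2 * ennreal M)"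
        by (intro mult_left_mono Qe) auto
      also have "(ennreal \<theta> * w1 (s / 2) e) * (2 * ennreal M) = ennreal (2 * M * \<theta>) * w1 (s / 2) e"
        using M(1) \<theta> by (simp add: ennreal_mult ennreal_mult' mult_ac)
      finally show "w1 s' e * (2 * Q s (head G e)) \<le> 2 * (w1 s e * Q s (head G e)) + ennreal (2 * M * \<theta>) * w1 (s / 2) e"
        by (simp add: add_left_mono)
    qed
    also have "\<dots> = 2 * (\<integral>\<^sup>+e. w1 s e * Q s (head G e) \<partial>count_space (out u))
        + ennreal (2 * M * \<theta>) * (\<integral>\<^sup>+e. w1 (s / 2) e \<partial>count_space (out u))"
      by (simp add: nn_integral_add nn_integral_cmult)
    also have "ennreal (2 * M * \<theta>) * (\<integral>\<^sup>+e. w1 (s / 2) e \<partial>count_space (out u)) \<le> ennreal (2 * M * \<theta>) * arc_sum (s / 2)"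
      unfolding arc_sum_def by (intro mult_left_mono nn_sum_mono_set) (auto simp: out_def)
    also have "\<dots> = ennreal (2 * M * \<theta> * r)"
      using r M(1) \<theta> by (simp add: ennreal_mult')
    also have "\<dots> \<le> ennreal 1"
      using \<theta>M by (rule ennreal_leI)
    finally have "1 + (\<integral>\<^sup>+e. w1 s' e * (2 * Q s (head G e)) \<partial>count_space (out u))
        \<le> 1 + (2 * (\<integral>\<^sup>+e. w1 s e * Q s (head G e) \<partial>count_space (out u)) + 1)"
      by (simp add: add_left_mono)
    also have "\<dots> = 2 * Q s u"
      unfolding Q_rec[OF u] by (simp add: distrib_left add_ac)
    finally show "1 + (\<integral>\<^sup>+e. w1 s' e * (2 * Q s (head G e)) \<partial>count_space (out u)) \<le> 2 * Q s u" .
  qed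
  also have "\<dots> < \<infinity>" using Q by (simp add: ennreal_mult_less_top)
  finally show thesis using that s' by blast
qed

section \<open>Existence and positivity of the growth rate\<close>

lemma F_le: "F s \<le> Q s v * arc_sum s"
proof -
  have "F s \<le> 1 * (\<integral>\<^sup>+z. (\<lambda>(p, e). wt s p * w1 s e) z \<partial>count_space (avoid v \<times> arcs G))"
    unfolding F_def
  \<comment> \<open>A first-return loop is an avoiding path from \<open>v\<close> followed by its
    last edge.\<close>
  proof (rule nn_sum_inj[where \<phi> = "\<lambda>g. (butlast g, last g)"])
    show "inj_on (\<lambda>g. (butlast g, last g)) first_loops"
      by (rule inj_onI) (metis first_loop_last prod.inject)
    show "(\<lambda>g. (butlast g, last g)) ` first_loops \<subseteq> avoid v \<times> arcs G"
    proof clarify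
      fix g assume g: "g \<in> first_loops"
      obtain p e where pe: "g = p @ [e]" using first_loop_last[OF g] by blast
      then show "butlast g \<in> avoid v \<and> last g \<in> arcs G"
        using g by (auto simp: first_loops_def avoid_def awalk_Cons_iff)
    qed
    fix g assume "g \<in> first_loops"
    then have "g = butlast g @ [last g]" using first_loop_last by blast
    then have "wt s g = wt s (butlast g) * wt s [last g]" by (metis wt_append)
    then show "wt s g \<le> 1 * (\<lambda>(p, e). wt s p * w1 s e) (butlast g, last g)"
      by (simp add: wt_Cons)
  qed
  also have "\<dots> = Q s v * arc_sum s"
    by (simp add: nn_sum_Sigma[symmetric] nn_integral_cmult nn_integral_multc Q_def arc_sum_def)
  finally show ?thesis .
qed

text \<open>For large \<open>s\<close> the edge weights sum to at most \<open>1 / 2\<close>. The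
  constant 2 is then a supersolution, and the loops, each an avoiding path with one more edge, have
  total weight at most \<open>2 * (1 / 2)\<close>.\<close>

lemma F_small: obtains s where "0 < s" "F s \<le> 1"
proof -
  obtain l0 where l0: "0 < l0" "\<And>e. e \<in> arcs G \<Longrightarrow> l0 \<le> len e" using min_len by blast
  obtain r where r: "0 \<le> r" "arc_sum 1 = ennreal r"
    using arc_sum_finite[of 1] by (cases "arc_sum 1") auto
  \<comment> \<open>All edges have length at least \<open>l0\<close>, so raising the exponent from 1
    to \<open>s\<close> gains a factor \<open>exp (- (s - 1) * l0)\<close> on each.\<close>
  define s where "s = 1 + ln (2 * (r + 1)) / l0"
  have s: "1 \<le> s" using r(1) l0(1) by (simp add: s_def)
  have "exp (- (s - 1) * l0) = inverse (2 * (r + 1))"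
    using r(1) l0(1) by (simp add: s_def exp_minus)
  moreover have "inverse (2 * (r + 1)) * r \<le> 1 / 2"
    using r(1) by (simp add: field_simps)
  ultimately have er: "exp (- (s - 1) * l0) * r \<le> 1 / 2"
    by (simp only:)
  have "arc_sum s \<le> (\<integral>\<^sup>+e. ennreal (exp (- (s - 1) * l0)) * w1 1 e \<partial>count_space (arcs G))"
    unfolding arc_sum_def
  proof (rule nn_integral_mono)
    fix e assume "e \<in> space (count_space (arcs G))"
    then have "(s - 1) * l0 \<le> (s - 1) * len e" using s l0(2)[of e] by (intro mult_left_mono) auto
    then have "- s * len e \<le> - (s - 1) * l0 + - 1 * len e" by (simp add: algebra_simps)
    then show "w1 s e \<le> ennreal (exp (- (s - 1) * l0)) * w1 1 e"
      by (simp add: ennreal_mult'[symmetric] exp_add[symmetric])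
  qed
  also have "\<dots> = ennreal (exp (- (s - 1) * l0)) * ennreal r"
    unfolding r(2)[symmetric] arc_sum_def by (rule nn_integral_cmult) simp
  also have "\<dots> \<le> ennreal (1 / 2)"
    unfolding ennreal_mult'[OF exp_ge_zero, symmetric] using er by (rule ennreal_leI)
  finally have half: "arc_sum s \<le> ennreal (1 / 2)" .
  have two: "2 * ennreal (1 / 2) = 1"
  proof -
    have "ennreal 2 * ennreal (1 / 2) = ennreal (2 * (1 / 2))"
      by (rule ennreal_mult'[symmetric]) simp
    moreover have "2 * (1 / 2) = (1 :: real)" by simp
    ultimately show ?thesis by (simp only: ennreal_1 ennreal_numeral)
  qed
  have "Q s v \<le> 2"
  proof (rule Q_le_supersolution[where f = "\<lambda>_. 2", OF _ v_verts])
    fix u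
    have "(\<integral>\<^sup>+e. w1 s e * 2 \<partial>count_space (out u)) \<le> (\<integral>\<^sup>+e. w1 s e * 2 \<partial>count_space (arcs G))"
      by (rule nn_sum_mono_set) (auto simp: out_def)
    also have "\<dots> = 2 * arc_sum s"
      by (simp add: nn_integral_cmult arc_sum_def mult.commute)
    also have "\<dots> \<le> 2 * ennreal (1 / 2)" by (intro mult_left_mono half) simp
    also note two
    finally show "1 + (\<integral>\<^sup>+e. w1 s e * 2 \<partial>count_space (out u)) \<le> 2"
      by (metis add_left_mono one_add_one)
  qed
  then have "F s \<le> 2 * ennreal (1 / 2)"
    using F_le[of s] half by (meson mult_mono order_trans zero_le)
  then have "F s \<le> 1" by (simp only: two)
  with s show thesis by (intro that[of s]) auto
qed

lemma first_loop_len_pos: "g \<in> first_loops \<Longrightarrow> 0 < path_sum len g"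
proof -
  assume g: "g \<in> first_loops"
  obtain l0 where l0: "0 < l0" "\<And>e. e \<in> arcs G \<Longrightarrow> l0 \<le> len e" using min_len by blast
  have "0 < l0 * real (length g)" using g l0 by (simp add: first_loops_def)
  also have "\<dots> \<le> path_sum len g"
    using g by (intro path_length_le l0(2)) (auto simp: first_loops_def)
  finally show ?thesis .
qed

text \<open>A single loop would make all loop lengths multiples of its own length.\<close>

lemma two_first_loops: obtains g g' where "g \<in> first_loops" "g' \<in> first_loops" "g \<noteq> g'"
proof -
  have "first_loops \<noteq> {}"
    using first_loop_nonlattice zero_less_one by blast
  then obtain g where g: "g \<in> first_loops" by blast
  have "\<exists>g'\<in>first_loops. g' \<noteq> g"
  proof (rule ccontr)
    assume "\<not> ?thesis"
    then have "\<forall>g'\<in>first_loops. \<exists>k::int. path_sum len g' = path_sum len g * of_int k"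
      by (auto intro!: exI[of _ 1])
    with first_loop_nonlattice first_loop_len_pos[OF g] show False by blast
  qed
  with g that show thesis by blast
qed

text \<open>Two loops of length at most \<open>\<Lambda>\<close> give
  \<open>F s \<ge> 2 * exp (- s * \<Lambda>)\<close>. This is what makes the growth rate
  positive.\<close>

lemma F_one_lower:
  obtains b where "0 < b" "\<And>s. 0 < s \<Longrightarrow> F s \<le> 1 \<Longrightarrow> b \<le> s"
proof -
  obtain g g' where g: "g \<in> first_loops" "g' \<in> first_loops" "g \<noteq> g'" using two_first_loops .
  define \<Lambda> where "\<Lambda> = max (path_sum len g) (path_sum len g')"
  have \<Lambda>: "0 < \<Lambda>" using first_loop_len_pos[OF g(1)] by (simp add: \<Lambda>_def less_max_iff_disj)
  have "ln 2 / \<Lambda> \<le> s" if s: "0 < s" "F s \<le> 1" for s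
  proof -
    have "ennreal (2 * exp (- s * \<Lambda>)) \<le> wt s g + wt s g'"
    proof -
      have "exp (- s * \<Lambda>) \<le> exp (- s * path_sum len g)" "exp (- s * \<Lambda>) \<le> exp (- s * path_sum len g')"
        using s by (simp_all add: \<Lambda>_def)
      then show ?thesis
        unfolding wt_def ennreal_plus[symmetric, OF exp_ge_zero exp_ge_zero] by (intro ennreal_leI) linarith
    qed
    also have "\<dots> = (\<integral>\<^sup>+g. wt s g \<partial>count_space {g, g'})"
      using g(3) by (simp add: nn_integral_count_space_finite)
    also have "\<dots> \<le> F s" unfolding F_def by (rule nn_sum_mono_set) (use g in auto)
    also note s(2)
    finally have "2 * exp (- s * \<Lambda>) \<le> 1" by (simp flip: ennreal_1)
    then have "2 \<le> exp (s * \<Lambda>)" by (simp add: exp_minus field_simps)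
    then have "ln 2 \<le> ln (exp (s * \<Lambda>))"
      by (subst ln_le_cancel_iff) auto
    then have "ln 2 \<le> s * \<Lambda>" by simp
    then show ?thesis using \<Lambda> by (simp add: pos_divide_le_eq)
  qed
  moreover have "0 < ln 2 / \<Lambda>" using \<Lambda> by simp
  ultimately show thesis using that by blast
qed

lemma F_convex:
  assumes "0 \<le> \<theta>" "\<theta> \<le> 1"
  shows "F ((1 - \<theta>) * a + \<theta> * b) \<le> ennreal (1 - \<theta>) * F a + ennreal \<theta> * F b"
proof -
  have "F ((1 - \<theta>) * a + \<theta> * b) \<le> (\<integral>\<^sup>+g. ennreal (1 - \<theta>) * wt a g + ennreal \<theta> * wt b g \<partial>count_space first_loops)"
    unfolding F_def
  proof (rule nn_integral_mono)
    fix g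
    have "ennreal (exp (- ((1 - \<theta>) * a + \<theta> * b) * path_sum len g))
        \<le> ennreal ((1 - \<theta>) * exp (- a * path_sum len g) + \<theta> * exp (- b * path_sum len g))"
      by (intro ennreal_leI exp_weight_convex assms)
    then show "wt ((1 - \<theta>) * a + \<theta> * b) g \<le> ennreal (1 - \<theta>) * wt a g + ennreal \<theta> * wt b g"
      using assms by (simp add: wt_def ennreal_mult')
  qed
  also have "\<dots> = ennreal (1 - \<theta>) * F a + ennreal \<theta> * F b"
    by (simp add: nn_integral_add nn_integral_cmult F_def)
  finally show ?thesis .
qed

lemma F_antimono: "s \<le> s' \<Longrightarrow> F s' \<le> F s"
  unfolding F_def
proof (rule nn_integral_mono)
  fix g assume "s \<le> s'" "g \<in> space (count_space first_loops)"
  then have "- s' * path_sum len g \<le> - s * path_sum len g"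
    using first_loop_len_pos[of g] by (intro mult_right_mono) auto
  then show "wt s' g \<le> wt s g"
    unfolding wt_def by (intro ennreal_leI) (simp only: exp_le_cancel_iff)
qed

text \<open>\<open>h\<close> is the infimum of the exponents at which the loop weights sum to at
  most 1, and Fatou's lemma gives \<open>F h \<le> 1\<close>. Then \<open>Q\<close>, and with it
  \<open>F\<close>, is finite at some \<open>h' < h\<close>. If \<open>F h\<close> were less than 1,
  convexity between \<open>h'\<close> and \<open>h\<close> would produce an exponent below
  \<open>h\<close> at which the sum is still at most 1.\<close>

lemma entropy:
  obtains h h' where "0 < h'" "h' < h" "F h = 1" "F h' < \<infinity>" "Q h' v < \<infinity>"
proof -
  define S where "S = {s. 0 < s \<and> F s \<le> 1}"
  define h where "h = Inf S"
  obtain b where b0: "0 < b" "\<And>s. 0 < s \<Longrightarrow> F s \<le> 1 \<Longrightarrow> b \<le> s"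
    by (rule F_one_lower, rule that)
  have b: "0 < b" "\<And>s. s \<in> S \<Longrightarrow> b \<le> s"
    using b0(1) by (auto simp: S_def intro: b0(2))
  obtain s0 where "0 < s0" "F s0 \<le> 1" by (rule F_small, rule that)
  then have ne: "S \<noteq> {}" unfolding S_def by blast
  have bdd: "bdd_below S" using b(2) by (rule bdd_belowI)
  have "b \<le> h" unfolding h_def using ne b(2) by (rule cInf_greatest)
  then have h_pos: "0 < h" using b(1) by simp
  have le1: "F s \<le> 1" if s: "h < s" for s
  proof -
    obtain t where "t \<in> S" "t < s" using cInf_lessD[OF ne s[unfolded h_def]] by blast
    then show ?thesis using F_antimono[of t s] by (auto simp: S_def)
  qed
  have F_le1: "F h \<le> 1"
  proof -
    have lim: "(\<lambda>n. wt (h + 1 / (real n + 1)) g) \<longlonglongrightarrow> wt h g" for g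
      unfolding wt_def
    proof (intro tendsto_ennrealI tendsto_exp tendsto_mult_right)
      have "(\<lambda>n. - (h + 1 / (real n + 1))) \<longlonglongrightarrow> - (h + 0)"
        using LIMSEQ_inverse_real_of_nat by (intro tendsto_intros) (simp add: inverse_eq_divide add.commute)
      then show "(\<lambda>n. - (h + 1 / (real n + 1))) \<longlonglongrightarrow> - h" by simp
    qed
    have "F h = (\<integral>\<^sup>+g. liminf (\<lambda>n. wt (h + 1 / (real n + 1)) g) \<partial>count_space first_loops)"
      unfolding F_def using lim_imp_Liminf[OF sequentially_bot lim] by simp
    also have "\<dots> \<le> liminf (\<lambda>n. F (h + 1 / (real n + 1)))"
      unfolding F_def by (rule nn_integral_liminf) simp
    also have "\<dots> \<le> 1"
      by (rule Liminf_le) (auto intro!: always_eventually le1)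
    finally show ?thesis .
  qed
  then have "F h < \<infinity>" by (rule le_less_trans) simp
  from Q_finite_open[OF h_pos Q_base_finite[OF h_pos this]]
  obtain h' where h': "0 < h'" "h' < h" "Q h' v < \<infinity>" by blast
  have Fh': "F h' < \<infinity>"
  proof (rule le_less_trans[OF F_le])
    show "Q h' v * arc_sum h' < \<infinity>"
      using h' arc_sum_finite[of h'] by (simp add: ennreal_mult_less_top)
  qed
  have "F h = 1"
  proof (rule ccontr)
    assume "F h \<noteq> 1"
    then have "F h < 1" using F_le1 by simp
    then obtain a where a: "0 \<le> a" "F h = ennreal a" "a < 1"
      by (cases "F h") auto
    obtain c where c: "0 \<le> c" "F h' = ennreal c"
      using Fh' by (cases "F h'") auto
    \<comment> \<open>This weight makes the convexity bound
      \<open>(1 - \<theta>) * a + \<theta> * c\<close> at most 1, and \<open>\<theta> > 0\<close>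
      gives \<open>s < h\<close>.\<close>
    define \<theta> where "\<theta> = (1 - a) / (1 + c)"
    have \<theta>: "0 < \<theta>" "\<theta> \<le> 1" using a c by (auto simp: \<theta>_def)
    define s where "s = (1 - \<theta>) * h + \<theta> * h'"
    have s_eq: "s = h - \<theta> * (h - h')" by (simp add: s_def algebra_simps)
    have "0 < \<theta> * (h - h')" using \<theta> h' by simp
    then have "s < h" by (simp add: s_eq)
    have "\<theta> * (h - h') \<le> 1 * (h - h')" using \<theta> h' by (intro mult_right_mono) auto
    also have "1 * (h - h') < h" using h'(1) by simp
    finally have "0 < s" unfolding s_eq by (simp only: diff_gt_0_iff_gt)
    have "F s \<le> ennreal (1 - \<theta>) * ennreal a + ennreal \<theta> * ennreal c"
      unfolding s_def a(2)[symmetric] c(2)[symmetric] by (rule F_convex) (use \<theta> in auto)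
    also have "\<dots> = ennreal ((1 - \<theta>) * a + \<theta> * c)"
      using \<theta> a c by (simp add: ennreal_mult')
    also have "\<dots> \<le> ennreal 1"
    proof (rule ennreal_leI)
      have "\<theta> * (1 + c) = 1 - a" using c by (simp add: \<theta>_def)
      then have "\<theta> * c = 1 - a - \<theta>" by (simp add: distrib_left)
      moreover have "0 \<le> \<theta> * a" using \<theta> a by simp
      ultimately show "(1 - \<theta>) * a + \<theta> * c \<le> 1"
        using \<theta> by (simp add: left_diff_distrib)
    qed
    finally have "s \<in> S" using \<open>0 < s\<close> by (simp add: S_def)
    then have "h \<le> s" unfolding h_def using bdd by (rule cInf_lower)
    with \<open>s < h\<close> show False by simp
  qed
  with h' Fh' that show thesis by blast
qed

end

section \<open>Gaussian measures and weak convergence\<close>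

lemma borel_measurable_cis_inner [measurable]:
  fixes t :: "'a::euclidean_space"
  shows "(\<lambda>x. cis (t \<bullet> x)) \<in> borel_measurable borel"
  unfolding cis_conv_exp by (intro borel_measurable_continuous_onI continuous_intros)

lemma char_normal_measure:
  assumes "0 \<le> s"
  shows "char (normal_measure 0 s) u = of_real (exp (- (s * u\<^sup>2 / 2)))"
    and "real_distribution (normal_measure 0 s)"
proof -
  have "char (normal_measure 0 s) u = of_real (exp (- (s * u\<^sup>2 / 2))) \<and> real_distribution (normal_measure 0 s)"
  proof (cases "s = 0")
    case True
    have "real_distribution (return borel (0::real))"
      unfolding real_distribution_def real_distribution_axioms_def by (auto intro: prob_space_return)
    then show ?thesis
      using True by (simp add: normal_measure_def char_def integral_return)
  next
    case False
    interpret std: real_distribution std_normal_distribution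
      by (rule real_dist_normal_dist)
    have "distributed std_normal_distribution lborel (\<lambda>x. x) std_normal_density"
      unfolding distributed_def
      by (auto simp: distr_id2 intro!: prob_space_normal_density)
    from std.normal_density_affine[OF this, of "sqrt s" 0]
    have "distributed std_normal_distribution lborel (\<lambda>x. sqrt s * x) (normal_density 0 (sqrt s))"
      using False assms by simp
    then have "distr std_normal_distribution lborel (\<lambda>x. sqrt s * x) = density lborel (normal_density 0 (sqrt s))"
      by (simp add: distributed_def)
    moreover have "distr std_normal_distribution lborel (\<lambda>x. sqrt s * x) = distr std_normal_distribution borel (\<lambda>x. sqrt s * x)"
      by (rule distr_cong) auto
    ultimately have eq: "normal_measure 0 s = distr std_normal_distribution borel (\<lambda>x. sqrt s * x)"
      using False by (simp add: normal_measure_def)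
    have "char (normal_measure 0 s) u = char std_normal_distribution (u * sqrt s)"
      unfolding eq char_def by (subst integral_distr) (auto simp: mult_ac)
    also have "\<dots> = of_real (exp (- (s * u\<^sup>2 / 2)))"
      using assms by (simp add: char_std_normal_distribution power_mult_distrib mult.commute)
    finally show ?thesis
      unfolding eq by (simp add: std.real_distribution_distr)
  qed
  then show "char (normal_measure 0 s) u = of_real (exp (- (s * u\<^sup>2 / 2)))"
    "real_distribution (normal_measure 0 s)" by auto
qed

text \<open>Uniqueness of characteristic functions on the line, applied to each projection; the
  multiples \<open>u *\<^sub>R t\<close> supply the characteristic function of the projection along
  \<open>t\<close>.\<close>

lemma is_gaussianI:
  fixes N :: "(real ^ 'n) measure"
  assumes N: "prob_space N" "sets N = sets borel"
    and S: "\<And>t. 0 \<le> t \<bullet> (S *v t)"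
    and char: "\<And>t. (\<integral>x. cis (t \<bullet> x) \<partial>N) = of_real (exp (- ((t \<bullet> (S *v t)) / 2)))"
  shows "is_gaussian N 0 S"
  unfolding is_gaussian_def
proof (intro conjI allI N)
  interpret N: prob_space N by (rule N)
  fix t :: "real ^ 'n"
  have meas: "(\<lambda>x. t \<bullet> x) \<in> borel_measurable N"
    unfolding measurable_cong_sets[OF N(2) refl] by measurable
  have "distr N borel (\<lambda>x. t \<bullet> x) = normal_measure 0 (t \<bullet> (S *v t))"
  proof (rule Levy_uniqueness)
    show "real_distribution (distr N borel (\<lambda>x. t \<bullet> x))"
      by (rule N.real_distribution_distr[OF meas])
    show "real_distribution (normal_measure 0 (t \<bullet> (S *v t)))"
      by (rule char_normal_measure[OF S])
    show "char (distr N borel (\<lambda>x. t \<bullet> x)) = char (normal_measure 0 (t \<bullet> (S *v t)))"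
    proof
      fix u
      have "char (distr N borel (\<lambda>x. t \<bullet> x)) u = (\<integral>x. cis ((u *\<^sub>R t) \<bullet> x) \<partial>N)"
        unfolding char_def using meas by (subst integral_distr) (auto simp: cis_conv_exp)
      also have "\<dots> = char (normal_measure 0 (t \<bullet> (S *v t))) u"
        unfolding char char_normal_measure(1)[OF S]
        by (simp add: matrix_vector_mult_scaleR power2_eq_square mult_ac)
      finally show "char (distr N borel (\<lambda>x. t \<bullet> x)) u = char (normal_measure 0 (t \<bullet> (S *v t))) u" .
    qed
  qed
  then show "distr N borel (\<lambda>x. t \<bullet> x) = normal_measure (t \<bullet> 0) (t \<bullet> (S *v t))" by simp
qed

lemma gaussian_char:
  assumes "is_gaussian N 0 S" "0 \<le> t \<bullet> (S *v t)"
  shows "(\<integral>x. cis (t \<bullet> x) \<partial>N) = of_real (exp (- ((t \<bullet> (S *v t)) / 2)))"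
proof -
  have sets: "sets N = sets borel" using assms(1) by (simp add: is_gaussian_def)
  have meas: "(\<lambda>x. t \<bullet> x) \<in> borel_measurable N"
    unfolding measurable_cong_sets[OF sets refl] by measurable
  have "(\<integral>x. cis (t \<bullet> x) \<partial>N) = char (distr N borel (\<lambda>x. t \<bullet> x)) 1"
    unfolding char_def using meas by (subst integral_distr) (auto simp: cis_conv_exp)
  also have "distr N borel (\<lambda>x. t \<bullet> x) = normal_measure 0 (t \<bullet> (S *v t))"
    using assms(1) by (simp add: is_gaussian_def)
  finally show ?thesis
    using char_normal_measure(1)[OF assms(2), of 1] by simp
qed

text \<open>\<open>N'\<close> is the law of \<open>x + z *\<^sub>R b\<close> with \<open>x\<close>
  distributed according to \<open>N\<close> and \<open>z\<close> an independent standard normal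
  variable.\<close>

lemma gaussian_add_rank_one:
  fixes N :: "(real ^ 'n) measure" and S S' :: "real ^ 'n ^ 'n"
  assumes N: "is_gaussian N 0 S" and S: "\<And>t. 0 \<le> t \<bullet> (S *v t)"
    and S': "\<And>t. t \<bullet> (S' *v t) = t \<bullet> (S *v t) + (t \<bullet> b)\<^sup>2"
  obtains N' where "is_gaussian N' 0 S'"
proof -
  have setsN: "sets N = sets borel" and probN: "prob_space N"
    using N by (simp_all add: is_gaussian_def)
  interpret N: prob_space N by (rule probN)
  interpret std: real_distribution std_normal_distribution
    by (rule real_dist_normal_dist)
  interpret pp: pair_prob_space N std_normal_distribution ..
  let ?P = "N \<Otimes>\<^sub>M std_normal_distribution"
  have sets_P: "sets ?P = sets (borel \<Otimes>\<^sub>M borel)"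
    by (rule sets_pair_measure_cong) (simp_all add: setsN)
  define \<phi> where "\<phi> = (\<lambda>(x, z). x + z *\<^sub>R b)"
  have \<phi>: "\<phi> \<in> measurable ?P borel"
    unfolding measurable_cong_sets[OF sets_P refl] \<phi>_def by measurable
  define N' where "N' = distr ?P borel \<phi>"
  have "is_gaussian N' 0 S'"
  proof (rule is_gaussianI)
    show "prob_space N'" unfolding N'_def by (rule pp.P.prob_space_distr[OF \<phi>])
    show "sets N' = sets borel" by (simp add: N'_def)
    show "0 \<le> t \<bullet> (S' *v t)" for t using S[of t] by (simp add: S')
    fix t
    have mN: "(\<lambda>x. t \<bullet> x) \<in> borel_measurable N"
      unfolding measurable_cong_sets[OF setsN refl] by measurable
    have "(\<integral>x. cis (t \<bullet> x) \<partial>N') = (\<integral>w. cis (t \<bullet> \<phi> w) \<partial>?P)"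
      unfolding N'_def by (rule integral_distr[OF \<phi>]) measurable
    also have "\<dots> = (\<integral>x. \<integral>z. cis (t \<bullet> \<phi> (x, z)) \<partial>std_normal_distribution \<partial>N)"
    proof (rule pp.integral_fst'[symmetric])
      have "(\<lambda>w. cis (t \<bullet> \<phi> w)) \<in> borel_measurable ?P"
        by (rule measurable_compose[OF \<phi>]) measurable
      then show "integrable ?P (\<lambda>w. cis (t \<bullet> \<phi> w))"
        by (intro pp.P.integrable_const_bound[where B = 1]) auto
    qed
    also have "(\<lambda>x. \<integral>z. cis (t \<bullet> \<phi> (x, z)) \<partial>std_normal_distribution)
        = (\<lambda>x. cis (t \<bullet> x) * char std_normal_distribution (t \<bullet> b))"
    proof
      fix x
      have "cis (t \<bullet> \<phi> (x, z)) = cis (t \<bullet> x) * cis ((t \<bullet> b) * z)" for z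
        by (simp add: \<phi>_def inner_add_right cis_mult mult.commute)
      then have "(\<lambda>z. cis (t \<bullet> \<phi> (x, z))) = (\<lambda>z. cis (t \<bullet> x) * iexp ((t \<bullet> b) * z))"
        by (simp only: cis_conv_exp)
      then show "(\<integral>z. cis (t \<bullet> \<phi> (x, z)) \<partial>std_normal_distribution)
          = cis (t \<bullet> x) * char std_normal_distribution (t \<bullet> b)"
        by (simp only: char_def integral_mult_right_zero)
    qed
    also have "(\<integral>x. cis (t \<bullet> x) * char std_normal_distribution (t \<bullet> b) \<partial>N)
        = of_real (exp (- ((t \<bullet> (S *v t)) / 2))) * of_real (exp (- (t \<bullet> b)\<^sup>2 / 2))"
      by (simp add: gaussian_char[OF N S] char_std_normal_distribution)
    also have "\<dots> = of_real (exp (- ((t \<bullet> (S' *v t)) / 2)))"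
      unfolding of_real_mult[symmetric] exp_add[symmetric] S' by (simp add: add_divide_distrib)
    finally show "(\<integral>x. cis (t \<bullet> x) \<partial>N') = of_real (exp (- ((t \<bullet> (S' *v t)) / 2)))" .
  qed
  then show thesis using that by blast
qed

text \<open>As a polynomial in \<open>c\<close> this serves two arguments: a vanishing diagonal
  entry forces a vanishing row, and the minimum over \<open>c\<close> shows that elimination
  preserves positivity.\<close>

lemma quadratic_form_axis:
  fixes S :: "real ^ 'n ^ 'n"
  assumes sym: "symmetric_mat S"
  shows "(x + c *\<^sub>R axis i 1) \<bullet> (S *v (x + c *\<^sub>R axis i 1))
    = x \<bullet> (S *v x) + 2 * c * (S *v x) $ i + c\<^sup>2 * S $ i $ i"
proof -
  have dot: "x \<bullet> (S *v z) = (S *v x) \<bullet> z" for x z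
    using sym dot_lmul_matrix[of x S z] by (simp add: symmetric_mat_def transpose_matrix_vector[symmetric])
  have "(S *v axis i 1) $ i = S $ i $ i"
    by (simp add: matrix_vector_mult_basis column_def)
  moreover have "axis i 1 \<bullet> z = z $ i" "z \<bullet> axis i 1 = z $ i" for z :: "real ^ 'n"
    by (simp_all add: inner_axis' inner_axis)
  ultimately show ?thesis
    using dot[of x "axis i 1"]
    by (simp add: matrix_vector_right_distrib matrix_vector_mult_scaleR inner_add_left inner_add_right
        power2_eq_square algebra_simps)
qed

text \<open>Cholesky elimination: subtracting a matrix of rank one annihilates a diagonal entry and preserves
  positive semi-definiteness.\<close>

lemma gaussian_exists:
  fixes S :: "real ^ 'n ^ 'n"
  assumes "symmetric_mat S" "pos_semidefinite S"
  obtains N where "is_gaussian N 0 S"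
  using assms
proof (induction "card {i. S $ i $ i \<noteq> 0}" arbitrary: S thesis rule: less_induct)
  case less
  have sym: "symmetric_mat S" and psd: "\<And>x. 0 \<le> x \<bullet> (S *v x)"
    using less.prems by (auto simp: pos_semidefinite_def)
  have diag: "0 \<le> S $ i $ i" for i
    using quadratic_form_axis[OF sym, of 0 1 i] psd[of "0 + 1 *\<^sub>R axis i 1"] by simp
  show ?case
  proof (cases "\<exists>i. S $ i $ i \<noteq> 0")
    case False
    have row0: "(S *v x) $ i = 0" for x i
    proof (rule ccontr)
      define q where "q = (S *v x) $ i"
      assume "(S *v x) $ i \<noteq> 0"
      then have q: "q \<noteq> 0" by (simp add: q_def)
      have "0 \<le> x \<bullet> (S *v x) + 2 * c * q" for c
        using psd[of "x + c *\<^sub>R axis i 1"] False unfolding quadratic_form_axis[OF sym] q_def by simp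
      \<comment> \<open>With a vanishing diagonal entry the form is affine in \<open>c\<close>; at
        this \<open>c\<close> it would equal \<open>- 1\<close>.\<close>
      from this[of "- (x \<bullet> (S *v x) + 1) / (2 * q)"] show False
        using q by (simp add: field_simps)
    qed
    have zero: "t \<bullet> (S *v t) = 0" for t
      by (simp add: inner_vec_def row0)
    have "is_gaussian (return borel 0) 0 S"
    proof (rule is_gaussianI)
      show "prob_space (return borel (0 :: real ^ 'n))" by (rule prob_space_return) simp
      show "(\<integral>x. cis (t \<bullet> x) \<partial>return borel 0) = of_real (exp (- ((t \<bullet> (S *v t)) / 2)))" for t
        by (subst integral_return) (auto simp: zero)
    qed (simp_all add: zero)
    then show ?thesis using less.prems by blast
  next
    case True
    then obtain i where "S $ i $ i \<noteq> 0" by blast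
    then have Si: "0 < S $ i $ i" using diag[of i] by simp
    \<comment> \<open>The rank-one matrix formed from \<open>b\<close> agrees with \<open>S\<close>
      in row and column \<open>i\<close>.\<close>
    define b :: "real ^ 'n" where "b = (1 / sqrt (S $ i $ i)) *\<^sub>R (S $ i)"
    define S' :: "real ^ 'n ^ 'n" where "S' = (\<chi> j k. S $ j $ k - b $ j * b $ k)"
    have S'v: "S' *v x = S *v x - (b \<bullet> x) *\<^sub>R b" for x
      by (simp add: vec_eq_iff S'_def matrix_vector_mult_def inner_vec_def sum_subtractf algebra_simps
          sum_distrib_left)
    have S'q: "x \<bullet> (S' *v x) = x \<bullet> (S *v x) - (x \<bullet> b)\<^sup>2" for x
      by (simp add: S'v inner_diff_right power2_eq_square inner_commute)
    have "S $ j $ k = S $ k $ j" for j k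
      using sym unfolding symmetric_mat_def transpose_def by (metis vec_lambda_beta)
    then have sym': "symmetric_mat S'"
      by (simp add: symmetric_mat_def transpose_def vec_eq_iff S'_def mult.commute)
    have bx: "(x \<bullet> b)\<^sup>2 = ((S *v x) $ i)\<^sup>2 / S $ i $ i" for x
    proof -
      have "x \<bullet> b = (S *v x) $ i / sqrt (S $ i $ i)"
        by (simp add: b_def matrix_vector_mul_component inner_commute)
      then show ?thesis using Si by (simp add: power_divide)
    qed
    have psd': "0 \<le> x \<bullet> (S' *v x)" for x
    proof -
      \<comment> \<open>The minimiser in \<open>c\<close> of the form at
        \<open>x + c *\<^sub>R axis i 1\<close>; the minimum is exactly the reduced form at
        \<open>x\<close>.\<close>
      define c where "c = - (S *v x) $ i / S $ i $ i"
      have "0 \<le> x \<bullet> (S *v x) + 2 * c * (S *v x) $ i + c\<^sup>2 * S $ i $ i"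
        using psd[of "x + c *\<^sub>R axis i 1"] unfolding quadratic_form_axis[OF sym] .
      also have "2 * c * (S *v x) $ i + c\<^sup>2 * S $ i $ i = - (((S *v x) $ i)\<^sup>2 / S $ i $ i)"
        using Si by (simp add: c_def power2_eq_square field_simps)
      then have "x \<bullet> (S *v x) + 2 * c * (S *v x) $ i + c\<^sup>2 * S $ i $ i = x \<bullet> (S' *v x)"
        unfolding S'q bx by linarith
      finally show ?thesis .
    qed
    have diag': "0 \<le> S' $ j $ j" for j
      using quadratic_form_axis[OF sym', of 0 1 j] psd'[of "0 + 1 *\<^sub>R axis j 1"] by simp
    \<comment> \<open>The induction measure drops: entry \<open>i\<close> becomes zero, and a zero
      entry stays zero because a square is subtracted from it and the result is nonnegative.\<close>
    have "{j. S' $ j $ j \<noteq> 0} \<subset> {j. S $ j $ j \<noteq> 0}"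
    proof
      show "{j. S' $ j $ j \<noteq> 0} \<subseteq> {j. S $ j $ j \<noteq> 0}"
      proof clarify
        fix j assume "S' $ j $ j \<noteq> 0" "S $ j $ j = 0"
        moreover from this have "S' $ j $ j = - (b $ j * b $ j)" by (simp add: S'_def)
        ultimately have "0 < - (b $ j * b $ j)" using diag'[of j] by linarith
        then show False using zero_le_square[of "b $ j"] by linarith
      qed
      have "S' $ i $ i = 0" using Si by (simp add: S'_def b_def)
      then show "{j. S' $ j $ j \<noteq> 0} \<noteq> {j. S $ j $ j \<noteq> 0}" using Si by force
    qed
    then have "card {j. S' $ j $ j \<noteq> 0} < card {j. S $ j $ j \<noteq> 0}"
      by (intro psubset_card_mono) auto
    moreover have "pos_semidefinite S'" using psd' by (simp add: pos_semidefinite_def)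
    ultimately obtain N where N: "is_gaussian N 0 S'"
      using less.hyps sym' by blast
    obtain N' where "is_gaussian N' 0 S"
      by (rule gaussian_add_rank_one[OF N psd', of S b]) (auto simp: S'q)
    then show ?thesis using less.prems by blast
  qed
qed

section \<open>The algebra of real trigonometric polynomials\<close>

inductive trig :: "('a::euclidean_space \<Rightarrow> real) \<Rightarrow> bool" where
  cos: "trig (\<lambda>x. a * cos (t \<bullet> x))"
| sin: "trig (\<lambda>x. a * sin (t \<bullet> x))"
| add: "trig f \<Longrightarrow> trig g \<Longrightarrow> trig (\<lambda>x. f x + g x)"

lemma trig_const: "trig (\<lambda>x. a)"
  using trig.cos[of a 0] by simp

lemma trig_sum: "finite A \<Longrightarrow> (\<And>i. i \<in> A \<Longrightarrow> trig (f i)) \<Longrightarrow> trig (\<lambda>x. \<Sum>i\<in>A. f i x)"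
  by (induction A rule: finite_induct) (auto intro: trig_const trig.add)

text \<open>Product-to-sum formulas. Closure under products is what turns a polynomial in sines and
  cosines into a member of \<open>trig\<close>.\<close>

lemma trig_mult_aux:
  assumes "trig g"
  shows "trig (\<lambda>x. a * cos (t \<bullet> x) * g x)" "trig (\<lambda>x. a * sin (t \<bullet> x) * g x)"
  using assms
proof (induction rule: trig.induct)
  case (cos c s)
  have 1: "a * cos (t \<bullet> x) * (c * cos (s \<bullet> x))
      = a * c / 2 * cos ((t - s) \<bullet> x) + a * c / 2 * cos ((t + s) \<bullet> x)" for x
    by (simp add: inner_diff_left inner_add_left cos_diff cos_add field_simps)
  have 2: "a * sin (t \<bullet> x) * (c * cos (s \<bullet> x))
      = a * c / 2 * sin ((t - s) \<bullet> x) + a * c / 2 * sin ((t + s) \<bullet> x)" for x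
    by (simp add: inner_diff_left inner_add_left sin_diff sin_add field_simps)
  show "trig (\<lambda>x. a * cos (t \<bullet> x) * (c * cos (s \<bullet> x)))" unfolding 1 by (intro trig.intros)
  show "trig (\<lambda>x. a * sin (t \<bullet> x) * (c * cos (s \<bullet> x)))" unfolding 2 by (intro trig.intros)
next
  case (sin c s)
  have 1: "a * cos (t \<bullet> x) * (c * sin (s \<bullet> x))
      = a * c / 2 * sin ((t + s) \<bullet> x) + (- (a * c / 2)) * sin ((t - s) \<bullet> x)" for x
    by (simp add: inner_diff_left inner_add_left sin_diff sin_add field_simps)
  have 2: "a * sin (t \<bullet> x) * (c * sin (s \<bullet> x))
      = a * c / 2 * cos ((t - s) \<bullet> x) + (- (a * c / 2)) * cos ((t + s) \<bullet> x)" for x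
    by (simp add: inner_diff_left inner_add_left cos_diff cos_add field_simps)
  show "trig (\<lambda>x. a * cos (t \<bullet> x) * (c * sin (s \<bullet> x)))" unfolding 1 by (intro trig.intros)
  show "trig (\<lambda>x. a * sin (t \<bullet> x) * (c * sin (s \<bullet> x)))" unfolding 2 by (intro trig.intros)
next
  case (add f g)
  show "trig (\<lambda>x. a * cos (t \<bullet> x) * (f x + g x))" "trig (\<lambda>x. a * sin (t \<bullet> x) * (f x + g x))"
    unfolding distrib_left by (intro trig.add add)+
qed

lemma trig_mult: "trig f \<Longrightarrow> trig g \<Longrightarrow> trig (\<lambda>x. f x * g x)"
  by (induction f rule: trig.induct) (auto simp: distrib_right intro: trig_mult_aux trig.add)

lemma trig_continuous: "trig f \<Longrightarrow> continuous_on UNIV f"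
  by (induction rule: trig.induct) (auto intro!: continuous_intros)

lemma trig_bounded: "trig f \<Longrightarrow> \<exists>B. \<forall>x. \<bar>f x\<bar> \<le> B"
proof (induction rule: trig.induct)
  case (cos a t)
  have "\<bar>a * cos (t \<bullet> x)\<bar> \<le> \<bar>a\<bar>" for x by (simp add: abs_mult mult_left_le)
  then show ?case by blast
next
  case (sin a t)
  have "\<bar>a * sin (t \<bullet> x)\<bar> \<le> \<bar>a\<bar>" for x by (simp add: abs_mult mult_left_le)
  then show ?case by blast
next
  case (add f g)
  then obtain B C where "\<And>x. \<bar>f x\<bar> \<le> B" "\<And>x. \<bar>g x\<bar> \<le> C" by blast
  then have "\<bar>f x + g x\<bar> \<le> B + C" for x by (meson abs_triangle_ineq add_mono order_trans)
  then show ?case by blast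
qed

section \<open>From characteristic functions to weak convergence\<close>

lemma bounded_borel_integrable:
  fixes f :: "'a::euclidean_space \<Rightarrow> real"
  assumes "prob_space M" "sets M = sets borel" "continuous_on UNIV f" "\<And>x. \<bar>f x\<bar> \<le> B"
  shows "integrable M f"
proof -
  interpret prob_space M by (rule assms)
  have "f \<in> borel_measurable M"
    unfolding measurable_cong_sets[OF assms(2) refl] by (rule borel_measurable_continuous_onI[OF assms(3)])
  then show ?thesis
    by (intro integrable_const_bound[where B = B]) (use assms(4) in auto)
qed

lemma trig_integral_tendsto:
  fixes \<mu> :: "nat \<Rightarrow> 'a::euclidean_space measure"
  assumes \<mu>: "\<And>n. prob_space (\<mu> n)" "\<And>n. sets (\<mu> n) = sets borel"
    and N: "prob_space N" "sets N = sets borel"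
    and char: "\<And>t. (\<lambda>n. \<integral>x. cis (t \<bullet> x) \<partial>\<mu> n) \<longlonglongrightarrow> (\<integral>x. cis (t \<bullet> x) \<partial>N)"
    and f: "trig f"
  shows "(\<lambda>n. \<integral>x. f x \<partial>\<mu> n) \<longlonglongrightarrow> (\<integral>x. f x \<partial>N)"
proof -
  have int: "integrable M (\<lambda>x. cis (t \<bullet> x))" if "prob_space M" "sets M = sets borel" for M :: "'a measure" and t
  proof -
    interpret prob_space M by fact
    have "(\<lambda>x. cis (t \<bullet> x)) \<in> borel_measurable M"
      unfolding measurable_cong_sets[OF that(2) refl] by measurable
    then show ?thesis by (intro integrable_const_bound[where B = 1]) auto
  qed
  have Re: "(\<integral>x. cos (t \<bullet> x) \<partial>M) = Re (\<integral>x. cis (t \<bullet> x) \<partial>M)"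
    and Im: "(\<integral>x. sin (t \<bullet> x) \<partial>M) = Im (\<integral>x. cis (t \<bullet> x) \<partial>M)"
    if "prob_space M" "sets M = sets borel" for M :: "'a measure" and t
    using integral_Re[OF int[OF that, of t]] integral_Im[OF int[OF that, of t]] by simp_all
  show ?thesis
    using f
  proof (induction rule: trig.induct)
    case (cos a t)
    have "(\<lambda>n. a * Re (\<integral>x. cis (t \<bullet> x) \<partial>\<mu> n)) \<longlonglongrightarrow> a * Re (\<integral>x. cis (t \<bullet> x) \<partial>N)"
      by (intro tendsto_intros char)
    then show ?case by (simp add: Re \<mu> N)
  next
    case (sin a t)
    have "(\<lambda>n. a * Im (\<integral>x. cis (t \<bullet> x) \<partial>\<mu> n)) \<longlonglongrightarrow> a * Im (\<integral>x. cis (t \<bullet> x) \<partial>N)"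
      by (intro tendsto_intros char)
    then show ?case by (simp add: Im \<mu> N)
  next
    case (add f g)
    obtain B C where B: "\<And>x. \<bar>f x\<bar> \<le> B" and C: "\<And>x. \<bar>g x\<bar> \<le> C"
      using trig_bounded[OF add(1)] trig_bounded[OF add(2)] by blast
    have fi: "integrable M f" "integrable M g" if "prob_space M" "sets M = sets borel" for M
      using bounded_borel_integrable[OF that trig_continuous[OF add(1)] B]
        bounded_borel_integrable[OF that trig_continuous[OF add(2)] C] by auto
    show ?case
      using tendsto_add[OF add(3,4)] by (simp add: fi \<mu> N)
  qed
qed


text \<open>Levy's continuity theorem on the line, applied to projections; it serves to keep mass
  from escaping to infinity.\<close>

lemma marginal_tendsto:
  fixes \<mu> :: "nat \<Rightarrow> 'a::euclidean_space measure" and h :: "real \<Rightarrow> real"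
  assumes \<mu>: "\<And>n. prob_space (\<mu> n)" "\<And>n. sets (\<mu> n) = sets borel"
    and N: "prob_space N" "sets N = sets borel"
    and char: "\<And>t. (\<lambda>n. \<integral>x. cis (t \<bullet> x) \<partial>\<mu> n) \<longlonglongrightarrow> (\<integral>x. cis (t \<bullet> x) \<partial>N)"
    and h: "continuous_on UNIV h" "\<And>x. \<bar>h x\<bar> \<le> B"
  shows "(\<lambda>n. \<integral>x. h (x \<bullet> b) \<partial>\<mu> n) \<longlonglongrightarrow> (\<integral>x. h (x \<bullet> b) \<partial>N)"
proof -
  have meas: "(\<lambda>x. x \<bullet> b) \<in> borel_measurable M" if "sets M = sets borel" for M :: "'a measure"
    unfolding measurable_cong_sets[OF that refl] by measurable
  define proj where "proj M = distr M borel (\<lambda>x. x \<bullet> b)" for M :: "'a measure"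
  have proj_rd: "real_distribution (proj M)" if "prob_space M" "sets M = sets borel" for M
    unfolding proj_def by (rule prob_space.real_distribution_distr[OF that(1) meas[OF that(2)]])
  have proj_char: "char (proj M) u = (\<integral>x. cis ((u *\<^sub>R b) \<bullet> x) \<partial>M)" if "sets M = sets borel" for M u
    unfolding char_def proj_def using meas[OF that]
    by (subst integral_distr) (auto simp: cis_conv_exp inner_commute)
  have h_meas: "h \<in> borel_measurable borel"
    by (rule borel_measurable_continuous_onI[OF h(1)])
  have proj_int: "(\<integral>x. h x \<partial>proj M) = (\<integral>x. h (x \<bullet> b) \<partial>M)" if "sets M = sets borel" for M
    unfolding proj_def by (rule integral_distr[OF meas[OF that] h_meas])
  have "weak_conv_m (\<lambda>n. proj (\<mu> n)) (proj N)"
  proof (rule levy_continuity)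
    show "(\<lambda>n. char (proj (\<mu> n)) u) \<longlonglongrightarrow> char (proj N) u" for u
      unfolding proj_char[OF \<mu>(2)] proj_char[OF N(2)] by (rule char)
  qed (simp_all add: proj_rd \<mu> N)
  then have "(\<lambda>n. \<integral>x. h x \<partial>proj (\<mu> n)) \<longlonglongrightarrow> (\<integral>x. h x \<partial>proj N)"
    by (intro weak_conv_imp_integral_bdd_continuous_conv[where B = B] proj_rd \<mu> N)
       (use h in \<open>auto simp: continuous_on_eq_continuous_at\<close>)
  then show ?thesis by (simp add: proj_int \<mu> N)
qed

text \<open>A continuous majorant of the indicator of \<open>L \<le> \<bar>y\<bar>\<close> that
  vanishes for \<open>\<bar>y\<bar> \<le> L - 1\<close>, so that convergence of the projections
  applies to it.\<close>

definition ramp :: "real \<Rightarrow> real \<Rightarrow> real" where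
  "ramp L y = min 1 (max 0 (\<bar>y\<bar> - L + 1))"

lemma ramp_bounds: "0 \<le> ramp L y" "ramp L y \<le> 1" "L \<le> \<bar>y\<bar> \<Longrightarrow> ramp L y = 1"
  by (auto simp: ramp_def)

lemma ramp_continuous: "continuous_on A (ramp L)"
  unfolding ramp_def by (intro continuous_intros)

text \<open>Under the limit law the ramp integrals vanish as the level grows, by dominated
  convergence; at a fixed level those under \<open>\<mu> n\<close> converge to them. Their sum over
  the basis bounds the mass outside a cube.\<close>

lemma uniformly_tight:
  fixes \<mu> :: "nat \<Rightarrow> 'a::euclidean_space measure"
  assumes \<mu>: "\<And>n. prob_space (\<mu> n)" "\<And>n. sets (\<mu> n) = sets borel"
    and N: "prob_space N" "sets N = sets borel"
    and char: "\<And>t. (\<lambda>n. \<integral>x. cis (t \<bullet> x) \<partial>\<mu> n) \<longlonglongrightarrow> (\<integral>x. cis (t \<bullet> x) \<partial>N)"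
    and e: "0 < e"
  obtains L where "0 \<le> L" "(\<integral>x. (\<Sum>b\<in>Basis. ramp L (x \<bullet> b)) \<partial>N) < e"
    "eventually (\<lambda>n. (\<integral>x. (\<Sum>b\<in>Basis. ramp L (x \<bullet> b)) \<partial>\<mu> n) < e) sequentially"
proof -
  interpret N: prob_space N by (rule N)
  have ramp_cont: "continuous_on UNIV (\<lambda>x::'a. ramp L (x \<bullet> b))" for L b
    by (intro continuous_on_compose2[OF ramp_continuous] continuous_intros) auto
  have ramp_int: "integrable M (\<lambda>x. ramp L (x \<bullet> b))" if "prob_space M" "sets M = sets borel" for M :: "'a measure" and L b
    by (rule bounded_borel_integrable[OF that ramp_cont, where B = 1]) (simp add: ramp_bounds)
  have "(\<lambda>k. \<integral>x. ramp (real k) (x \<bullet> b) \<partial>N) \<longlonglongrightarrow> (\<integral>x. 0 \<partial>N)" for b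
  proof (rule integral_dominated_convergence[where w = "\<lambda>_. 1"])
    show "AE x in N. (\<lambda>k. ramp (real k) (x \<bullet> b)) \<longlonglongrightarrow> 0"
    proof (rule AE_I2, rule tendsto_eventually)
      fix x :: 'a
      have "eventually (\<lambda>k. nat \<lceil>\<bar>x \<bullet> b\<bar> + 1\<rceil> \<le> k) sequentially" by (rule eventually_ge_at_top)
      then show "eventually (\<lambda>k. ramp (real k) (x \<bullet> b) = 0) sequentially"
      proof eventually_elim
        case (elim k)
        then have "\<bar>x \<bullet> b\<bar> + 1 \<le> real k" by linarith
        then show ?case by (simp add: ramp_def)
      qed
    qed
    show "(\<lambda>x. ramp (real k) (x \<bullet> b)) \<in> borel_measurable N" for k
      using ramp_int[OF N] by (rule borel_measurable_integrable)
  qed (auto simp: ramp_bounds)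
  then have "(\<lambda>k. \<Sum>b\<in>Basis. \<integral>x. ramp (real k) (x \<bullet> b) \<partial>N) \<longlonglongrightarrow> (\<Sum>b\<in>(Basis :: 'a set). 0)"
    by (intro tendsto_sum) simp
  then have "(\<lambda>k. \<Sum>b\<in>Basis. \<integral>x. ramp (real k) (x \<bullet> b) \<partial>N) \<longlonglongrightarrow> 0" by simp
  from order_tendstoD(2)[OF this e] obtain k where k: "(\<Sum>b\<in>Basis. \<integral>x. ramp (real k) (x \<bullet> b) \<partial>N) < e"
    by (auto simp: eventually_sequentially)
  have sum_eq: "(\<integral>x. (\<Sum>b\<in>Basis. ramp L (x \<bullet> b)) \<partial>M) = (\<Sum>b\<in>Basis. \<integral>x. ramp L (x \<bullet> b) \<partial>M)"
    if "prob_space M" "sets M = sets borel" for M :: "'a measure" and L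
    by (rule Bochner_Integration.integral_sum) (rule ramp_int[OF that])
  have "(\<lambda>n. \<Sum>b\<in>Basis. \<integral>x. ramp (real k) (x \<bullet> b) \<partial>\<mu> n) \<longlonglongrightarrow> (\<Sum>b\<in>Basis. \<integral>x. ramp (real k) (x \<bullet> b) \<partial>N)"
    by (intro tendsto_sum marginal_tendsto[where B = 1] \<mu> N char ramp_continuous) (simp add: ramp_bounds)
  from order_tendstoD(2)[OF this k]
  have "eventually (\<lambda>n. (\<Sum>b\<in>Basis. \<integral>x. ramp (real k) (x \<bullet> b) \<partial>\<mu> n) < e) sequentially" .
  with k show thesis by (intro that[of "real k"]) (simp_all add: sum_eq \<mu> N)
qed

text \<open>On the part of the torus where all cosines are positive, \<open>arcsin\<close> recovers the point of the
  cube; the product of the cosines cuts \<open>f\<close> off, and the cut-off function is approximated by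
  polynomials on the compact torus.\<close>

lemma torus_approximation:
  fixes f :: "'a::euclidean_space \<Rightarrow> real"
  assumes f: "continuous_on UNIV f" "\<And>x. \<bar>f x\<bar> \<le> B" and B: "0 \<le> B"
    and L: "0 \<le> L" and \<delta>: "0 < \<delta>"
  obtains q where "trig q" "\<And>x. \<bar>f x - q x\<bar> \<le> B * \<delta> + 2 * B * (\<Sum>b\<in>Basis. ramp L (x \<bullet> b)) + \<delta>"
proof -
  \<comment> \<open>On the cube of half-width \<open>L\<close> a large \<open>M\<close> makes the
    product of the cosines exceed \<open>1 - \<delta>\<close>, and \<open>L / M \<le> pi / 2\<close>
    ensures that \<open>arcsin\<close> inverts the sine there.\<close>
  have "((\<lambda>M. cos (L / M) ^ DIM('a)) \<longlongrightarrow> cos 0 ^ DIM('a)) at_top"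
    by (intro tendsto_power tendsto_cos tendsto_divide_0[OF tendsto_const] filterlim_at_top_imp_at_infinity filterlim_ident)
  then have "eventually (\<lambda>M. 1 - \<delta> < cos (L / M) ^ DIM('a)) at_top"
    using \<delta> by (intro order_tendstoD(1)) auto
  moreover have "eventually (\<lambda>M. max 1 (L * 2 / pi) \<le> M) at_top" by (rule eventually_ge_at_top)
  ultimately have "eventually (\<lambda>M. 1 - \<delta> < cos (L / M) ^ DIM('a) \<and> max 1 (L * 2 / pi) \<le> M) at_top"
    by (rule eventually_conj)
  then obtain M where M: "1 - \<delta> < cos (L / M) ^ DIM('a)" "1 \<le> M" "L * 2 / pi \<le> M"
    by (auto simp: eventually_at_top_linorder)
  have LM: "L / M \<le> pi / 2" using M(2,3) by (simp add: field_simps)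
  define \<phi> :: "'a \<Rightarrow> 'a \<times> 'a" where
    "\<phi> x = (\<Sum>b\<in>Basis. cos (x \<bullet> b / M) *\<^sub>R b, \<Sum>b\<in>Basis. sin (x \<bullet> b / M) *\<^sub>R b)" for x
  have \<phi>_inner: "fst (\<phi> x) \<bullet> b = cos (x \<bullet> b / M)" "snd (\<phi> x) \<bullet> b = sin (x \<bullet> b / M)" if "b \<in> Basis" for x b
    using that by (simp_all add: \<phi>_def)
  \<comment> \<open>A box around the torus: compact, containing the image of \<open>\<phi>\<close>,
    and with all coordinates in the domain of \<open>arcsin\<close>.\<close>
  define K :: "('a \<times> 'a) set" where "K = cbox (- One) One \<times> cbox (- One) One"
  have K: "compact K" unfolding K_def by (intro compact_Times compact_cbox)
  have \<phi>_K: "\<phi> x \<in> K" for x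
    using \<phi>_inner[of _ x] unfolding K_def mem_Times_iff mem_box by (auto simp: \<phi>_inner)
  define g :: "'a \<times> 'a \<Rightarrow> real" where "g z = f (\<Sum>b\<in>Basis. (M * arcsin (snd z \<bullet> b)) *\<^sub>R b) * (\<Prod>b\<in>Basis. max 0 (fst z \<bullet> b))" for z
  have arc: "continuous_on K (\<lambda>z. arcsin (snd z \<bullet> b))" if b: "b \<in> Basis" for b
  proof -
    have "\<forall>z\<in>K. - 1 \<le> snd z \<bullet> b \<and> snd z \<bullet> b \<le> 1"
      using b by (force simp: K_def mem_box)
    moreover have "continuous_on K (\<lambda>z. snd z \<bullet> b)" by (intro continuous_intros)
    ultimately show ?thesis by (intro continuous_on_arcsin)
  qed
  have "continuous_on K (\<lambda>z. \<Sum>b\<in>Basis. (M * arcsin (snd z \<bullet> b)) *\<^sub>R b)"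
    by (intro continuous_on_sum continuous_on_scaleR continuous_on_mult continuous_on_const arc)
  then have "continuous_on K (\<lambda>z. f (\<Sum>b\<in>Basis. (M * arcsin (snd z \<bullet> b)) *\<^sub>R b))"
    by (rule continuous_on_compose2[OF f(1)]) simp
  moreover have "continuous_on K (\<lambda>z. \<Prod>b\<in>Basis. max 0 (fst z \<bullet> b))"
    by (intro continuous_intros)
  ultimately have "continuous_on K g"
    unfolding g_def by (rule continuous_on_mult)
  then obtain p where p: "real_polynomial_function p" "\<And>z. z \<in> K \<Longrightarrow> \<bar>g z - p z\<bar> < \<delta>"
    using Stone_Weierstrass_real_polynomial_function[OF K _ \<delta>] by metis
  have trig_p: "trig (\<lambda>x. p (\<phi> x))"
    using p(1)
  proof (induction rule: real_polynomial_function.induct)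
    case (linear h)
    have scale: "x \<bullet> b / M = ((1 / M) *\<^sub>R b) \<bullet> x" for x b :: 'a
      by (simp add: inner_commute)
    have "\<phi> x = (\<Sum>b\<in>Basis. cos (x \<bullet> b / M) *\<^sub>R (b, 0)) + (\<Sum>b\<in>Basis. sin (x \<bullet> b / M) *\<^sub>R (0, b))" for x
      by (simp add: \<phi>_def prod_eq_iff fst_sum snd_sum)
    then have "h (\<phi> x) = (\<Sum>b\<in>Basis. cos (x \<bullet> b / M) * h (b, 0)) + (\<Sum>b\<in>Basis. sin (x \<bullet> b / M) * h (0, b))" for x
      using bounded_linear.linear[OF linear] by (simp only: linear_add linear_sum linear_scale real_scaleR_def)
    then have "h (\<phi> x) = (\<Sum>b\<in>Basis. h (b, 0) * cos (((1 / M) *\<^sub>R b) \<bullet> x))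
        + (\<Sum>b\<in>Basis. h (0, b) * sin (((1 / M) *\<^sub>R b) \<bullet> x))" for x
      by (simp only: scale mult.commute)
    moreover have "trig (\<lambda>x. (\<Sum>b\<in>Basis. h (b, 0) * cos (((1 / M) *\<^sub>R b) \<bullet> x))
        + (\<Sum>b\<in>Basis. h (0, b) * sin (((1 / M) *\<^sub>R b) \<bullet> x)))"
      by (intro trig.add trig_sum trig.cos trig.sin) auto
    ultimately show ?case by simp
  qed (auto intro: trig_const trig.add trig_mult)
  have g_le: "\<bar>g (\<phi> x)\<bar> \<le> B" for x
  proof -
    have "(\<Prod>b\<in>Basis. max 0 (fst (\<phi> x) \<bullet> b)) \<le> 1"
      by (rule prod_le_1) (simp add: \<phi>_inner)
    moreover have "0 \<le> (\<Prod>b\<in>Basis. max 0 (fst (\<phi> x) \<bullet> b))" by (rule prod_nonneg) simp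
    ultimately have "\<bar>g (\<phi> x)\<bar> \<le> B * 1"
      unfolding g_def abs_mult using f(2) B by (intro mult_mono) auto
    then show ?thesis by simp
  qed
  have near: "\<bar>f x - g (\<phi> x)\<bar> \<le> B * \<delta> + 2 * B * (\<Sum>b\<in>Basis. ramp L (x \<bullet> b))" for x
  proof (cases "\<forall>b\<in>Basis. \<bar>x \<bullet> b\<bar> \<le> L")
    case True
    have small: "\<bar>x \<bullet> b / M\<bar> \<le> L / M" if "b \<in> Basis" for b
      using True that M(2) by (simp add: divide_right_mono)
    have arc: "arcsin (sin (x \<bullet> b / M)) = x \<bullet> b / M" if "b \<in> Basis" for b
      using small[OF that] LM by (intro arcsin_sin) linarith+
    have "(\<Sum>b\<in>Basis. (M * arcsin (snd (\<phi> x) \<bullet> b)) *\<^sub>R b) = (\<Sum>b\<in>Basis. (x \<bullet> b) *\<^sub>R b)"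
      using M(2) by (intro sum.cong) (simp_all add: \<phi>_inner arc)
    then have g: "g (\<phi> x) = f x * (\<Prod>b\<in>Basis. max 0 (fst (\<phi> x) \<bullet> b))"
      by (simp add: g_def euclidean_representation)
    have "cos (L / M) ^ DIM('a) = (\<Prod>b\<in>(Basis :: 'a set). cos (L / M))" by simp
    also have "\<dots> \<le> (\<Prod>b\<in>Basis. max 0 (fst (\<phi> x) \<bullet> b))"
    proof (rule prod_mono)
      fix b :: 'a assume b: "b \<in> Basis"
      have "0 \<le> L / M" using L M(2) by simp
      then have "0 \<le> cos (L / M)" using LM by (intro cos_ge_zero) linarith+
      moreover have "cos (L / M) \<le> cos \<bar>x \<bullet> b / M\<bar>"
        using small[OF b] LM pi_gt_zero by (intro cos_monotone_0_pi_le) linarith+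
      then have "cos (L / M) \<le> cos (x \<bullet> b / M)" by (simp only: cos_abs_real)
      ultimately show "0 \<le> cos (L / M) \<and> cos (L / M) \<le> max 0 (fst (\<phi> x) \<bullet> b)"
        using b by (simp add: \<phi>_inner)
    qed
    finally have "1 - \<delta> \<le> (\<Prod>b\<in>Basis. max 0 (fst (\<phi> x) \<bullet> b))" using M(1) by linarith
    moreover have "(\<Prod>b\<in>Basis. max 0 (fst (\<phi> x) \<bullet> b)) \<le> 1"
      by (rule prod_le_1) (simp add: \<phi>_inner)
    ultimately have "\<bar>1 - (\<Prod>b\<in>Basis. max 0 (fst (\<phi> x) \<bullet> b))\<bar> \<le> \<delta>" by linarith
    then have "\<bar>f x\<bar> * \<bar>1 - (\<Prod>b\<in>Basis. max 0 (fst (\<phi> x) \<bullet> b))\<bar> \<le> B * \<delta>"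
      using f(2) B by (intro mult_mono) auto
    moreover have "f x - g (\<phi> x) = f x * (1 - (\<Prod>b\<in>Basis. max 0 (fst (\<phi> x) \<bullet> b)))"
      by (simp add: g right_diff_distrib)
    moreover have "0 \<le> 2 * B * (\<Sum>b\<in>Basis. ramp L (x \<bullet> b))"
      using B by (intro mult_nonneg_nonneg sum_nonneg) (auto simp: ramp_bounds)
    ultimately show ?thesis by (simp add: abs_mult)
  next
    case False
    \<comment> \<open>Outside the cube one of the ramps equals 1 and pays for the trivial bound
      \<open>2 * B\<close>.\<close>
    then obtain b where b: "b \<in> Basis" "L \<le> \<bar>x \<bullet> b\<bar>" by force
    then have "1 \<le> (\<Sum>b\<in>Basis. ramp L (x \<bullet> b))"
      using member_le_sum[of b Basis "\<lambda>b. ramp L (x \<bullet> b)"] by (simp add: ramp_bounds)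
    then have "2 * B * 1 \<le> 2 * B * (\<Sum>b\<in>Basis. ramp L (x \<bullet> b))"
      using B by (intro mult_left_mono) auto
    moreover have "\<bar>f x - g (\<phi> x)\<bar> \<le> 2 * B"
      using f(2)[of x] g_le[of x] by linarith
    moreover have "0 \<le> B * \<delta>" using B \<delta> by simp
    ultimately show ?thesis by linarith
  qed
  have "\<bar>f x - p (\<phi> x)\<bar> \<le> B * \<delta> + 2 * B * (\<Sum>b\<in>Basis. ramp L (x \<bullet> b)) + \<delta>" for x
    using near[of x] p(2)[OF \<phi>_K[of x]] by linarith
  with trig_p that show thesis by blast
qed

text \<open>For trigonometric polynomials convergence is the hypothesis. A bounded continuous
  \<open>f\<close> is replaced by one of them at a cost governed by the ramp integrals, which
  tightness makes small under \<open>N\<close> and eventually under \<open>\<mu> n\<close>.\<close>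

theorem weak_convergence_from_char:
  fixes \<mu> :: "nat \<Rightarrow> 'a::euclidean_space measure" and f :: "'a \<Rightarrow> real"
  assumes \<mu>: "\<And>n. prob_space (\<mu> n)" "\<And>n. sets (\<mu> n) = sets borel"
    and N: "prob_space N" "sets N = sets borel"
    and char: "\<And>t. (\<lambda>n. \<integral>x. cis (t \<bullet> x) \<partial>\<mu> n) \<longlonglongrightarrow> (\<integral>x. cis (t \<bullet> x) \<partial>N)"
    and f: "continuous_on UNIV f" "bounded (range f)"
  shows "(\<lambda>n. \<integral>x. f x \<partial>\<mu> n) \<longlonglongrightarrow> (\<integral>x. f x \<partial>N)"
proof (rule tendstoI)
  fix \<epsilon> :: real assume \<epsilon>: "0 < \<epsilon>"
  obtain B where B: "0 \<le> B" "\<And>x. \<bar>f x\<bar> \<le> B"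
    using f(2) unfolding bounded_iff by (metis abs_ge_zero order_trans rangeI real_norm_def)
  \<comment> \<open>The approximation costs \<open>(B + 2 * B + 1) * \<delta>\<close> under each of
    the two measures, together \<open>\<epsilon> / 2\<close>.\<close>
  define \<delta> where "\<delta> = \<epsilon> / (4 * (3 * B + 1))"
  have \<delta>: "0 < \<delta>" "2 * (3 * B + 1) * \<delta> = \<epsilon> / 2"
    using \<epsilon> B(1) by (simp_all add: \<delta>_def add_pos_nonneg field_simps)
  obtain L where L: "0 \<le> L" "(\<integral>x. (\<Sum>b\<in>Basis. ramp L (x \<bullet> b)) \<partial>N) < \<delta>"
    "eventually (\<lambda>n. (\<integral>x. (\<Sum>b\<in>Basis. ramp L (x \<bullet> b)) \<partial>\<mu> n) < \<delta>) sequentially"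
    using uniformly_tight[OF \<mu> N char \<delta>(1)] by blast
  obtain q where q: "trig q" "\<And>x. \<bar>f x - q x\<bar> \<le> B * \<delta> + 2 * B * (\<Sum>b\<in>Basis. ramp L (x \<bullet> b)) + \<delta>"
    using torus_approximation[OF f(1) B(2,1) L(1) \<delta>(1)] by blast
  obtain C where C: "\<And>x. \<bar>q x\<bar> \<le> C" using trig_bounded[OF q(1)] by blast
  have close: "\<bar>(\<integral>x. f x \<partial>M) - (\<integral>x. q x \<partial>M)\<bar> \<le> (3 * B + 1) * \<delta>"
    if M: "prob_space M" "sets M = sets borel" and small: "(\<integral>x. (\<Sum>b\<in>Basis. ramp L (x \<bullet> b)) \<partial>M) < \<delta>" for M :: "'a measure"
  proof -
    interpret prob_space M by fact
    have fi: "integrable M f" by (rule bounded_borel_integrable[OF M f(1) B(2)])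
    have qi: "integrable M q" by (rule bounded_borel_integrable[OF M trig_continuous[OF q(1)] C])
    have ri: "integrable M (\<lambda>x. \<Sum>b\<in>Basis. ramp L (x \<bullet> b))"
    proof (rule Bochner_Integration.integrable_sum)
      fix b :: 'a
      have "continuous_on UNIV (\<lambda>x::'a. ramp L (x \<bullet> b))"
        by (intro continuous_on_compose2[OF ramp_continuous] continuous_intros) auto
      then show "integrable M (\<lambda>x. ramp L (x \<bullet> b))"
        by (rule bounded_borel_integrable[OF M, where B = 1]) (simp add: ramp_bounds)
    qed
    have "\<bar>(\<integral>x. f x \<partial>M) - (\<integral>x. q x \<partial>M)\<bar> = \<bar>\<integral>x. f x - q x \<partial>M\<bar>"
      using fi qi by simp
    also have "\<dots> \<le> (\<integral>x. \<bar>f x - q x\<bar> \<partial>M)" by (rule integral_abs_bound)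
    also have "\<dots> \<le> (\<integral>x. B * \<delta> + 2 * B * (\<Sum>b\<in>Basis. ramp L (x \<bullet> b)) + \<delta> \<partial>M)"
    proof (rule integral_mono)
      show "integrable M (\<lambda>x. B * \<delta> + 2 * B * (\<Sum>b\<in>Basis. ramp L (x \<bullet> b)) + \<delta>)"
        by (intro Bochner_Integration.integrable_add integrable_mult_right ri integrable_const)
    qed (use fi qi q(2) in auto)
    also have "\<dots> = B * \<delta> + 2 * B * (\<integral>x. (\<Sum>b\<in>Basis. ramp L (x \<bullet> b)) \<partial>M) + \<delta>"
    proof -
      have "(\<integral>x. B * \<delta> + 2 * B * (\<Sum>b\<in>Basis. ramp L (x \<bullet> b)) + \<delta> \<partial>M)
          = (\<integral>x. B * \<delta> + 2 * B * (\<Sum>b\<in>Basis. ramp L (x \<bullet> b)) \<partial>M) + (\<integral>x. \<delta> \<partial>M)"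
        by (intro Bochner_Integration.integral_add Bochner_Integration.integrable_add integrable_mult_right ri integrable_const)
      also have "(\<integral>x. B * \<delta> + 2 * B * (\<Sum>b\<in>Basis. ramp L (x \<bullet> b)) \<partial>M)
          = (\<integral>x. B * \<delta> \<partial>M) + (\<integral>x. 2 * B * (\<Sum>b\<in>Basis. ramp L (x \<bullet> b)) \<partial>M)"
        by (intro Bochner_Integration.integral_add integrable_mult_right ri integrable_const)
      finally show ?thesis by (simp add: prob_space)
    qed
    also have "2 * B * (\<integral>x. (\<Sum>b\<in>Basis. ramp L (x \<bullet> b)) \<partial>M) \<le> 2 * B * \<delta>"
      using small B(1) by (intro mult_left_mono) auto
    finally show ?thesis by (simp add: algebra_simps)
  qed
  have "eventually (\<lambda>n. dist (\<integral>x. q x \<partial>\<mu> n) (\<integral>x. q x \<partial>N) < \<epsilon> / 2) sequentially"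
    using trig_integral_tendsto[OF \<mu> N char q(1)] by (rule tendstoD) (use \<epsilon> in simp)
  with L(3) show "eventually (\<lambda>n. dist (\<integral>x. f x \<partial>\<mu> n) (\<integral>x. f x \<partial>N) < \<epsilon>) sequentially"
  proof eventually_elim
    case (elim n)
    show ?case
      using close[OF \<mu>(1,2) elim(1)] close[OF N L(2)] elim(2) \<delta>(2) unfolding dist_real_def by linarith
  qed
qed

section \<open>The central limit theorem for paths\<close>

context based_digraph begin

lemma renewal_structure:
  obtains h \<epsilon> l0 where "renewal first_loops (avoid v) paths (path_sum len) h \<epsilon> l0"
proof -
  obtain h h' where h: "0 < h'" "h' < h" "F h = 1" "F h' < \<infinity>" "Q h' v < \<infinity>"
    by (rule entropy, rule that)
  obtain l0 where l0: "0 < l0" "\<And>e. e \<in> arcs G \<Longrightarrow> l0 \<le> len e" using min_len by blast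
  \<comment> \<open>With \<open>\<epsilon> = h - h'\<close>, the rate \<open>h - \<epsilon>\<close>
    is the exponent \<open>h'\<close> at which loops and avoiding paths remain summable.\<close>
  have "renewal first_loops (avoid v) paths (path_sum len) h (h - h') l0"
  proof unfold_locales
    show "paths = avoid v \<union> (\<lambda>(g, p). g @ p) ` (first_loops \<times> paths)" by (rule paths_decomp)
    show "inj_on (\<lambda>(g, p). g @ p) (first_loops \<times> paths)" by (rule first_loop_inj)
    show "avoid v \<inter> (\<lambda>(g, p). g @ p) ` (first_loops \<times> paths) = {}" by (rule avoid_first_loops_disjoint)
    show "0 \<le> path_sum len p" if "p \<in> paths" for p
      using that path_sum_len_nonneg by (auto simp: paths_def)
    show "l0 \<le> path_sum len g" if "g \<in> first_loops" for g
    proof -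
      have "awalk v g v" "g \<noteq> []" using that by (auto simp: first_loops_def)
      then have "l0 * 1 \<le> l0 * real (length g)"
        using l0(1) by (intro mult_left_mono) (auto simp: Suc_leI)
      also have "\<dots> \<le> path_sum len g"
        using \<open>awalk v g v\<close> l0(2) by (rule path_length_le)
      finally show ?thesis by simp
    qed
    show "[] \<in> avoid v" using v_verts by (auto simp: avoid_def awalk_Nil_iff)
    show "finite {p \<in> paths. path_sum len p < t}" for t by (rule finite_paths_below)
    show "(\<integral>\<^sup>+g. ennreal (exp (- h * path_sum len g)) \<partial>count_space first_loops) = 1"
      using h(3) by (simp add: F_def wt_def)
    show "(\<integral>\<^sup>+g. ennreal (exp (- (h - (h - h')) * path_sum len g)) \<partial>count_space first_loops) < \<infinity>"
      using h(4) by (simp add: F_def wt_def)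
    show "(\<integral>\<^sup>+r. ennreal (exp (- (h - (h - h')) * path_sum len r)) \<partial>count_space (avoid v)) < \<infinity>"
      using h(5) by (simp add: Q_def wt_def)
    show "\<not> (\<exists>d>0. \<forall>g\<in>first_loops. \<exists>k::int. path_sum len g = d * of_int k)"
      by (rule first_loop_nonlattice)
  qed (use h l0 in auto)
  then show thesis using that by blast
qed

lemma cost_vec_append:
  fixes c :: "'n::finite \<Rightarrow> 'e \<Rightarrow> real"
  shows "cost_vec c (p @ q) = cost_vec c p + cost_vec c q"
  by (simp add: cost_vec_def vec_eq_iff)

lemma cost_vec_bound:
  fixes c :: "'n::finite \<Rightarrow> 'e \<Rightarrow> real"
  assumes "\<And>i. is_cost G len (c i)"
  obtains C where "0 \<le> C" "\<And>u p w. awalk u p w \<Longrightarrow> norm (cost_vec c p) \<le> C * path_sum len p"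
proof -
  have "\<forall>i. \<exists>C>0. \<forall>e\<in>arcs G. \<bar>c i e\<bar> \<le> C * len e"
    using assms by (simp add: is_cost_def)
  then obtain K where K: "\<And>i. 0 < K i" "\<And>i e. e \<in> arcs G \<Longrightarrow> \<bar>c i e\<bar> \<le> K i * len e"
    by metis
  have path: "\<bar>path_sum (c i) p\<bar> \<le> K i * path_sum len p" if "awalk u p w" for i u p w
    using that
  proof (induction p arbitrary: u)
    case (Cons e p)
    then have "\<bar>path_sum (c i) p\<bar> \<le> K i * path_sum len p" "e \<in> arcs G"
      by (auto simp: awalk_Cons_iff)
    with K(2)[of e i] show ?case
      by (simp add: distrib_left)
  qed simp
  have "norm (cost_vec c p) \<le> (\<Sum>i\<in>UNIV. K i) * path_sum len p" if "awalk u p w" for u p w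
  proof -
    have "norm (cost_vec c p) \<le> (\<Sum>i\<in>UNIV. \<bar>cost_vec c p $ i\<bar>)" by (rule norm_le_l1_cart)
    also have "\<dots> \<le> (\<Sum>i\<in>UNIV. K i * path_sum len p)"
      by (intro sum_mono) (simp add: cost_vec_def path[OF that])
    finally show ?thesis by (simp add: sum_distrib_right)
  qed
  moreover have "0 \<le> (\<Sum>i\<in>UNIV. K i)" using K(1) by (intro sum_nonneg less_imp_le) auto
  ultimately show thesis using that by blast
qed

theorem path_clt:
  fixes c :: "'n::finite \<Rightarrow> 'e \<Rightarrow> real"
  assumes costs: "\<And>i. is_cost G len (c i)"
  shows "\<exists>\<Sigma> :: real ^ 'n ^ 'n.
    symmetric_mat \<Sigma> \<and> pos_semidefinite \<Sigma> \<and>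
    (\<exists>N. is_gaussian N 0 \<Sigma> \<and>
       weak_conv_to
         (\<lambda>T. distr (path_measure G len v T) borel
                (\<lambda>p. (1 / sqrt T) *\<^sub>R (cost_vec c p - T *\<^sub>R asymp_avg G len v c)))
         N at_top) \<and>
    (pos_definite \<Sigma> \<longleftrightarrow>
       \<not> (\<exists>t. t \<noteq> 0 \<and>
            (\<forall>p. closed_w p \<longrightarrow> t \<bullet> (cost_vec c p - path_sum len p *\<^sub>R asymp_avg G len v c) = 0)))"
proof -
  obtain h \<epsilon> l0 where "renewal first_loops (avoid v) paths (path_sum len) h \<epsilon> l0"
    by (rule renewal_structure, rule that)
  then interpret rn: renewal first_loops "avoid v" paths "path_sum len" h \<epsilon> l0 .
  obtain C where C: "0 \<le> C" "\<And>u p w. awalk u p w \<Longrightarrow> norm (cost_vec c p) \<le> C * path_sum len p"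
    by (rule cost_vec_bound[of c, OF costs], rule that)
  interpret rv: renewal_vector first_loops "avoid v" paths "path_sum len" h \<epsilon> l0 "cost_vec c" C
  proof unfold_locales
    show "norm (cost_vec c p) \<le> C * path_sum len p" if "p \<in> paths" for p
      using that C(2) by (auto simp: paths_def)
  qed (use C(1) in \<open>auto simp: cost_vec_append\<close>)
  have below: "paths_below G len v T = rn.below paths T" for T
    by (auto simp: paths_below_def rn.below_def paths_def)
  have "((\<lambda>T. (1 / real (card (paths_below G len v T))) *\<^sub>R
      (\<Sum>p\<in>paths_below G len v T. (1 / T) *\<^sub>R cost_vec c p)) \<longlongrightarrow> rv.drift) at_top"
    using rv.drift_limit unfolding rn.avg_def below .
  \<comment> \<open>\<open>asymp_avg\<close> is given by a limit operator, whose value is determined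
    only once convergence is known.\<close>
  then have drift: "asymp_avg G len v c = rv.drift"
    unfolding asymp_avg_def by (intro tendsto_Lim) auto
  define \<Sigma> :: "real ^ 'n ^ 'n" where "\<Sigma> = (\<chi> i j. rn.E (\<lambda>g. rv.z g $ i * rv.z g $ j) / rn.m)"
  have z_int: "integrable (measure_pmf rn.D) (\<lambda>g. rv.z g $ i * rv.z g $ j)" for i j
    using rv.z_product_integrable[of "axis i 1" "axis j 1"] by (simp add: inner_axis')
  have quad: "t \<bullet> (\<Sigma> *v t) = rn.E (\<lambda>g. (t \<bullet> rv.z g)\<^sup>2) / rn.m" for t
  proof -
    have "rn.E (\<lambda>g. (t \<bullet> rv.z g)\<^sup>2) = rn.E (\<lambda>g. \<Sum>i\<in>UNIV. \<Sum>j\<in>UNIV. t $ i * t $ j * (rv.z g $ i * rv.z g $ j))"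
      by (intro Bochner_Integration.integral_cong refl)
         (simp add: inner_vec_def power2_eq_square sum_product mult_ac)
    also have "\<dots> = (\<Sum>i\<in>UNIV. \<Sum>j\<in>UNIV. t $ i * t $ j * rn.E (\<lambda>g. rv.z g $ i * rv.z g $ j))"
      using z_int by (simp add: Bochner_Integration.integral_sum)
    also have "\<dots> / rn.m = t \<bullet> (\<Sigma> *v t)"
      by (simp add: inner_vec_def matrix_vector_mult_def \<Sigma>_def sum_distrib_left sum_divide_distrib mult_ac)
    finally show ?thesis by simp
  qed
  have psd: "0 \<le> t \<bullet> (\<Sigma> *v t)" for t
    unfolding quad using rn.m_pos by (intro divide_nonneg_pos Bochner_Integration.integral_nonneg) auto
  have sym: "symmetric_mat \<Sigma>"
    by (simp add: symmetric_mat_def transpose_def vec_eq_iff \<Sigma>_def mult.commute)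
  have "pos_semidefinite \<Sigma>" using psd by (simp add: pos_semidefinite_def)
  then obtain N where N: "is_gaussian N 0 \<Sigma>"
    using gaussian_exists[OF sym] by blast
  have probN: "prob_space N" "sets N = sets borel" using N by (simp_all add: is_gaussian_def)
  define X :: "real \<Rightarrow> 'e list \<Rightarrow> real ^ 'n" where
    "X T p = (1 / sqrt T) *\<^sub>R (cost_vec c p - T *\<^sub>R rv.drift)" for T p
  have meas: "X T \<in> measurable (path_measure G len v T) borel" for T
    by (simp add: path_measure_def measurable_def space_uniform_count_measure sets_uniform_count_measure)
  have integral_paths: "(\<integral>p. g p \<partial>path_measure G len v T) = rn.avg g T"
    for g :: "'e list \<Rightarrow> complex" and T
    unfolding path_measure_def below uniform_count_measure_def rn.avg_def
    by (subst lebesgue_integral_point_measure_finite) (auto simp: scaleR_sum_right)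
  have weak: "weak_conv_to (\<lambda>T. distr (path_measure G len v T) borel (X T)) N at_top"
    unfolding weak_conv_to_def
  proof (intro allI impI)
    fix f :: "real ^ 'n \<Rightarrow> real" assume f: "continuous_on UNIV f" "bounded (range f)"
    show "((\<lambda>T. \<integral>x. f x \<partial>distr (path_measure G len v T) borel (X T)) \<longlongrightarrow> (\<integral>x. f x \<partial>N)) at_top"
    proof (rule tendsto_at_topI_sequentially)
      fix S :: "nat \<Rightarrow> real" assume S: "filterlim S at_top sequentially"
      \<comment> \<open>For nonpositive \<open>S n\<close> there are no paths to count and no
        probability measure; this changes only finitely many terms up to those with
        \<open>S n < 1\<close>.\<close>
      define T where "T n = max 1 (S n)" for n
      have ev: "eventually (\<lambda>n. T n = S n) sequentially"
        using S unfolding filterlim_at_top by (auto simp: T_def elim!: allE[of _ 1] eventually_mono)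
      have T: "filterlim T at_top sequentially"
        by (rule filterlim_at_top_mono[OF S]) (simp add: T_def)
      have prob: "prob_space (distr (path_measure G len v (T n)) borel (X (T n)))" for n
      proof (rule prob_space.prob_space_distr[OF _ meas])
        have "0 < T n" by (simp add: T_def)
        then have "rn.below paths (T n) \<noteq> {}" using rn.card_below_pos by force
        then show "prob_space (path_measure G len v (T n))"
          unfolding path_measure_def below by (intro prob_space_uniform_count_measure) auto
      qed
      have char: "(\<lambda>n. \<integral>x. cis (t \<bullet> x) \<partial>distr (path_measure G len v (T n)) borel (X (T n)))
          \<longlonglongrightarrow> (\<integral>x. cis (t \<bullet> x) \<partial>N)" for t
      proof -
        have eq: "(\<integral>x. cis (t \<bullet> x) \<partial>distr (path_measure G len v s) borel (X s)) = rn.avg (\<lambda>p. cis (t \<bullet> X s p)) s" for s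
        proof -
          have "(\<integral>x. cis (t \<bullet> x) \<partial>distr (path_measure G len v s) borel (X s))
              = (\<integral>p. cis (t \<bullet> X s p) \<partial>path_measure G len v s)"
            by (rule integral_distr[OF meas]) measurable
          also have "\<dots> = rn.avg (\<lambda>p. cis (t \<bullet> X s p)) s"
            by (rule integral_paths)
          finally show ?thesis .
        qed
        have "((\<lambda>s. rn.avg (\<lambda>p. cis (t \<bullet> X s p)) s) \<longlongrightarrow> (\<integral>x. cis (t \<bullet> x) \<partial>N)) at_top"
          using rv.char_limit[of t] unfolding gaussian_char[OF N psd] quad X_def by (simp add: mult.commute)
        from filterlim_compose[OF this T] show ?thesis unfolding eq .
      qed
      have "(\<lambda>n. \<integral>x. f x \<partial>distr (path_measure G len v (T n)) borel (X (T n))) \<longlonglongrightarrow> (\<integral>x. f x \<partial>N)"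
        by (rule weak_convergence_from_char[OF prob _ probN char f]) simp
      moreover have "eventually (\<lambda>n. (\<integral>x. f x \<partial>distr (path_measure G len v (T n)) borel (X (T n)))
          = (\<integral>x. f x \<partial>distr (path_measure G len v (S n)) borel (X (S n)))) sequentially"
        using ev by eventually_elim simp
      ultimately show "(\<lambda>n. \<integral>x. f x \<partial>distr (path_measure G len v (S n)) borel (X (S n))) \<longlonglongrightarrow> (\<integral>x. f x \<partial>N)"
        by (rule Lim_transform_eventually)
    qed
  qed
  have zero_iff: "t \<bullet> (\<Sigma> *v t) = 0 \<longleftrightarrow> (\<forall>p. closed_w p \<longrightarrow> t \<bullet> (cost_vec c p - path_sum len p *\<^sub>R rv.drift) = 0)" for t
  proof -
    have "t \<bullet> (\<Sigma> *v t) = 0 \<longleftrightarrow> (\<forall>g\<in>first_loops. t \<bullet> rv.z g = 0)"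
      unfolding quad using rn.m_pos by (simp add: rv.variance_zero_iff)
    also have "\<dots> \<longleftrightarrow> (\<forall>p. closed_w p \<longrightarrow> t \<bullet> rv.z p = 0)"
    proof (intro iffI allI impI ballI)
      fix p assume *: "\<forall>g\<in>first_loops. t \<bullet> rv.z g = 0" and p: "closed_w p"
      have "t \<bullet> rv.z p \<in> {0}"
      proof (rule closed_induct[OF _ _ _ _ _ p])
        show "t \<bullet> rv.z (q @ r) = t \<bullet> rv.z q + t \<bullet> rv.z r" for q r
          by (simp add: rv.z_def cost_vec_append scaleR_left_distrib inner_diff_right inner_add_right)
      qed (use * in auto)
      then show "t \<bullet> rv.z p = 0" by simp
    next
      fix g assume *: "\<forall>p. closed_w p \<longrightarrow> t \<bullet> rv.z p = 0" and g: "g \<in> first_loops"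
      have "closed_w g" using g by (auto simp: first_loops_def closed_w_def)
      then show "t \<bullet> rv.z g = 0" using * by blast
    qed
    finally show ?thesis by (simp add: rv.z_def)
  qed
  have "pos_definite \<Sigma> \<longleftrightarrow> (\<forall>t. t \<noteq> 0 \<longrightarrow> t \<bullet> (\<Sigma> *v t) \<noteq> 0)"
    unfolding pos_definite_def using psd by (metis less_eq_real_def less_irrefl)
  then have posdef: "pos_definite \<Sigma> \<longleftrightarrow>
       \<not> (\<exists>t. t \<noteq> 0 \<and> (\<forall>p. closed_w p \<longrightarrow> t \<bullet> (cost_vec c p - path_sum len p *\<^sub>R rv.drift) = 0))"
    unfolding zero_iff by blast
  show ?thesis
    unfolding drift
    by (rule exI[of _ \<Sigma>], intro conjI exI[of _ N]) (use sym psd N weak posdef in \<open>simp_all add: pos_semidefinite_def X_def[abs_def]\<close>)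
qed

end

theorem theorem2p6:
  fixes G :: "('v, 'e) pre_digraph"
    and len :: "'e \<Rightarrow> real"
    and v :: 'v
    and c :: "'n::finite \<Rightarrow> 'e \<Rightarrow> real"
  assumes "length_digraph G len"
    and "v \<in> verts G"
    and "\<And>i. is_cost G len (c i)"
  shows "\<exists>\<Sigma> :: real ^ 'n ^ 'n.
    symmetric_mat \<Sigma> \<and> pos_semidefinite \<Sigma> \<and>
    (\<exists>N. is_gaussian N 0 \<Sigma> \<and>
       weak_conv_to
         (\<lambda>T. distr (path_measure G len v T) borel
                (\<lambda>p. (1 / sqrt T) *\<^sub>R (cost_vec c p - T *\<^sub>R asymp_avg G len v c)))
         N at_top) \<and>
    (pos_definite \<Sigma> \<longleftrightarrow>
       \<not> (\<exists>t. t \<noteq> 0 \<and>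
            (\<forall>p. wf_digraph.closed_w G p \<longrightarrow>
               t \<bullet> (cost_vec c p - path_sum len p *\<^sub>R asymp_avg G len v c) = 0)))"
proof -
  interpret length_digraph G len by fact
  interpret based_digraph G len v by unfold_locales fact
  show ?thesis by (rule path_clt) fact
qed

end
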